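(* Let $f\in L_2(\Omega)$, let $(\boldsymbol\sigma,w)\in\Sigma\times W$ be the unique solution of $$a^{\mathrm{dual}}(\boldsymbol\sigma,\boldsymbol\tau)+b^{\mathrm{dual}}(w,\boldsymbol\tau)=(f,-\varepsilon\,\mathrm{div}_{\mathcal T}\boldsymbol\tau)_\Omega,\qquad b^{\mathrm{dual}}(v,\boldsymbol\sigma)=0\qquad\text{for all }(\boldsymbol\tau,v)\in\Sigma\times W,$$ and let $(\boldsymbol\sigma_h,w_h)\in\Sigma_h\times W_h$ be the unique solution of $$a^{\mathrm{dual}}(\boldsymbol\sigma_h,\boldsymbol\tau_h)+b^{\mathrm{dual}}(w_h,\boldsymbol\tau_h)=(f,-\varepsilon\,\mathrm{div}_{\mathcal T}\boldsymbol\tau_h)_\Omega,\qquad b^{\mathrm{dual}}(v_h,\boldsymbol\sigma_h)=0\qquad\text{for all }(\boldsymbol\tau_h,v_h)\in\Sigma_h\times W_h.$$ Then there is a constant $C>0$, independent of $\varepsilon$ and of the mesh except for its shape-regularity, such that for every $T\in\mathcal T$ $$\min\{\varepsilon^{1/2},h_T^{1/2}\}\,\|[\boldsymbol\sigma_h\cdot\boldsymbol n]\|_{\partial T\setminus\partial\Omega}\le C\big(\|\boldsymbol\sigma-\boldsymbol\sigma_h\|_{\Omega_T}+\varepsilon\|\mathrm{div}\,\boldsymbol\sigma-\mathrm{div}_{\mathcal T}\boldsymbol\sigma_h\|_{\Omega_T}\big).$$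
   Context: $\Omega\subseteq\mathbb R^d$ ($d=2,3$) is a bounded open Lipschitz domain with polygonal/polyhedral boundary, $0<\varepsilon\le 1$; $(\cdot,\cdot)_T$ and $\|\cdot\|_T$ are the $L_2(T)$ inner product and norm. $\mathcal T$ is a conforming mesh of $\Omega$ into shape-regular simplices ($\max_{T\in\mathcal T}h_T^d/|T|\le\kappa$), $h_T=\mathrm{diam}(T)$. $\Omega_T=\mathrm{int}\big(\bigcup\{\overline{T'}:T'\in\mathcal T,\ \overline T\cap\overline{T'}\ne\emptyset\}\big)$. Continuous spaces: $\boldsymbol H(\mathrm{div};T)=\{\boldsymbol\tau\in L_2(T)^d: \mathrm{div}\,\boldsymbol\tau\in L_2(T)\}$. $\Sigma:=\boldsymbol H(\mathrm{div};\mathcal T)=\{\boldsymbol\tau\in L_2(\Omega)^d:\boldsymbol\tau|_T\in\boldsymbol H(\mathrm{div};T)\ \forall T\in\mathcal T\}$ with piecewise divergence $\mathrm{div}_{\mathcal T}$. $\mathrm{tr}^{\nabla}_{\mathcal T}:H^1(\Omega)\to\Sigma'$, $\langle\mathrm{tr}^{\nabla}_{\mathcal T}v,\boldsymbol\tau\rangle_{\partial\mathcal T}=\sum_{T}[(\mathrm{div}\,\boldsymbol\tau,v)_T+(\boldsymbol\tau,\nabla v)_T]$; $W:=\mathrm{tr}^{\nabla}_{\mathcal T}(H_0^1(\Omega))$. The duality $\langle w,\boldsymbol\tau\rangle_{\partial\mathcal T}$ is also written $\langle\boldsymbol\tau\cdot\boldsymbol n,w\rangle_{\partial\mathcal T}$.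 Bilinear forms: $a^{\mathrm{dual}}(\boldsymbol\sigma,\boldsymbol\tau)=\varepsilon^2(\mathrm{div}_{\mathcal T}\boldsymbol\sigma,\mathrm{div}_{\mathcal T}\boldsymbol\tau)_\Omega+(\boldsymbol\sigma,\boldsymbol\tau)_\Omega$, $b^{\mathrm{dual}}(w,\boldsymbol\tau)=-\varepsilon\langle\boldsymbol\tau\cdot\boldsymbol n,w\rangle_{\partial\mathcal T}$. (The component $\boldsymbol\sigma$ of the continuous solution lies in $\boldsymbol H(\mathrm{div};\Omega)$.) Discrete spaces: $P^p(T)$ (resp. $P^p(\mathcal T)$) denotes polynomials on $T$ (resp. $\mathcal T$-piecewise polynomials) of degree $\le p$. $W_h=\mathrm{tr}^{\nabla}_{\mathcal T}(P^1(\mathcal T)\cap H_0^1(\Omega))$. For $T\in\mathcal T$ let $\mathcal V_T$ be its vertices, $\mathcal F_T$ its facets, $\boldsymbol n_T$ the exterior unit normal on $\partial T$, $\eta_z^T$ the barycentric coordinate of $z\in\mathcal V_T$; for $F\in\mathcal F_T$ let $z_F^T$ be the vertex opposite $F$, and set $\eta_F^T=\prod_{z\in\mathcal V_T\setminus\{z_F^T\}}\eta_z^T$, $d_F^T=\eta^T_{z_F^T}$, $\eta_{F,\varepsilon}^T=\exp(-(h_T/\varepsilon)d_F^T)\,\eta_F^T$, $\boldsymbol\eta_F^T=\eta_F^T\boldsymbol n_T|_F$, $\boldsymbol\eta_{F,\varepsilon}^T=\eta_{F,\varepsilon}^T\boldsymbol n_T|_F$. Fix for each $T$ a vertex $z_T\in\mathcal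 V_T$; $\mathcal E_{T,z_T}$ is the set of the $d$ edges of $T$ sharing $z_T$; for $E\in\mathcal E_{T,z_T}$ let $\boldsymbol t_E^T$ be a unit tangent vector and $\eta_E^T$ the product of the barycentric coordinates of the two endpoints of $E$. With $\boldsymbol{RT}^0(T)=P^0(T)^d+\boldsymbol xP^0(T)$, set $\Sigma_h=\prod_{T\in\mathcal T}\Sigma_{h,\varepsilon}(T)$, where $\Sigma_{h,\varepsilon}(T)=\boldsymbol{RT}^0(T)+\mathrm{span}\{\boldsymbol\eta_{F,\varepsilon}^T:F\in\mathcal F_T\}+\mathrm{span}\{\eta_E^T\boldsymbol t_E^T:E\in\mathcal E_{T,z_T}\}$ if $\varepsilon<h_T$, and the same with $\boldsymbol\eta_{F,\varepsilon}^T$ replaced by $\boldsymbol\eta_F^T$ if $\varepsilon\ge h_T$. $[\boldsymbol\tau\cdot\boldsymbol n]$ is the jump of the normal component across a facet, taken facet by facet. *)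

theory Defs
  imports "HOL-Analysis.Analysis"
begin

section \<open>Lebesgue and Sobolev spaces\<close>

text \<open>Functions are honest functions on the whole space; only their values on the set
  under consideration matter, and only up to null sets.\<close>

definition L2 :: "'a::euclidean_space set \<Rightarrow> ('a \<Rightarrow> 'b::euclidean_space) set" where
  "L2 U = {f. f \<in> borel_measurable (lebesgue_on U) \<and>
              integrable (lebesgue_on U) (\<lambda>x. (norm (f x))\<^sup>2)}"

definition l2_inner ::
  "'a::euclidean_space set \<Rightarrow> ('a \<Rightarrow> 'b::euclidean_space) \<Rightarrow> ('a \<Rightarrow> 'b) \<Rightarrow> real" where
  "l2_inner U f g = (LINT x|lebesgue_on U. f x \<bullet> g x)"

definition l2_norm :: "'a::euclidean_space set \<Rightarrow> ('a \<Rightarrow> 'b::euclidean_space) \<Rightarrow> real" where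
  "l2_norm U f = sqrt (l2_inner U f f)"

definition partial :: "'n::finite \<Rightarrow> (real^'n \<Rightarrow> real) \<Rightarrow> real^'n \<Rightarrow> real" where
  "partial i \<phi> x = frechet_derivative \<phi> (at x) (axis i 1)"

primrec C_k :: "nat \<Rightarrow> (real^'n::finite \<Rightarrow> real) \<Rightarrow> bool" where
  "C_k 0 \<phi> \<longleftrightarrow> continuous_on UNIV \<phi>"
| "C_k (Suc k) \<phi> \<longleftrightarrow> (\<forall>x. \<phi> differentiable (at x)) \<and> (\<forall>i. C_k k (partial i \<phi>))"

definition test_functions :: "(real^'n::finite) set \<Rightarrow> (real^'n \<Rightarrow> real) set" where
  "test_functions U = {\<phi>. (\<forall>k. C_k k \<phi>) \<and> compact (closure {x. \<phi> x \<noteq> 0}) \<and>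
                           closure {x. \<phi> x \<noteq> 0} \<subseteq> U}"

definition has_weak_gradient ::
  "(real^'n::finite \<Rightarrow> real) \<Rightarrow> (real^'n \<Rightarrow> real^'n) \<Rightarrow> (real^'n) set \<Rightarrow> bool" where
  "has_weak_gradient v g U \<longleftrightarrow>
     (\<forall>\<phi>\<in>test_functions U. \<forall>i.
        l2_inner U v (partial i \<phi>) = - l2_inner U (\<lambda>x. g x $ i) \<phi>)"

definition has_weak_divergence ::
  "(real^'n::finite \<Rightarrow> real^'n) \<Rightarrow> (real^'n \<Rightarrow> real) \<Rightarrow> (real^'n) set \<Rightarrow> bool" where
  "has_weak_divergence \<tau> g U \<longleftrightarrow>
     (\<forall>\<phi>\<in>test_functions U.
        l2_inner U \<tau> (\<lambda>x. \<chi> i. partial i \<phi> x) = - l2_inner U g \<phi>)"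

text \<open>On an open set \<open>U\<close> the chosen representatives are unique up to null sets
  whenever they exist.\<close>

definition weak_grad :: "(real^'n::finite) set \<Rightarrow> (real^'n \<Rightarrow> real) \<Rightarrow> real^'n \<Rightarrow> real^'n" where
  "weak_grad U v = (SOME g. g \<in> L2 U \<and> has_weak_gradient v g U)"

definition weak_div :: "(real^'n::finite) set \<Rightarrow> (real^'n \<Rightarrow> real^'n) \<Rightarrow> real^'n \<Rightarrow> real" where
  "weak_div U \<tau> = (SOME g. g \<in> L2 U \<and> has_weak_divergence \<tau> g U)"

definition H1 :: "(real^'n::finite) set \<Rightarrow> (real^'n \<Rightarrow> real) set" where
  "H1 U = {v \<in> L2 U. \<exists>g\<in>L2 U. has_weak_gradient v g U}"

definition h1_norm :: "(real^'n::finite) set \<Rightarrow> (real^'n \<Rightarrow> real) \<Rightarrow> real" where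
  "h1_norm U v = sqrt ((l2_norm U v)\<^sup>2 + (l2_norm U (weak_grad U v))\<^sup>2)"

definition H10 :: "(real^'n::finite) set \<Rightarrow> (real^'n \<Rightarrow> real) set" where
  "H10 U = {v \<in> H1 U. \<forall>\<delta>>0. \<exists>\<phi>\<in>test_functions U. h1_norm U (\<lambda>x. v x - \<phi> x) < \<delta>}"

definition Hdiv :: "(real^'n::finite) set \<Rightarrow> (real^'n \<Rightarrow> real^'n) set" where
  "Hdiv U = {\<tau> \<in> L2 U. \<exists>g\<in>L2 U. has_weak_divergence \<tau> g U}"


section \<open>Domain and mesh\<close>

text \<open>Near each boundary point the domain lies strictly above the graph of a Lipschitz
  function defined on the hyperplane orthogonal to a unit vector \<open>\<nu>\<close>.\<close>

definition lipschitz_domain :: "(real^'n::finite) set \<Rightarrow> bool" where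
  "lipschitz_domain \<Omega> \<longleftrightarrow> \<Omega> \<noteq> {} \<and> open \<Omega> \<and> connected \<Omega> \<and>
     (\<forall>x\<in>frontier \<Omega>. \<exists>\<nu> r L \<gamma>. norm \<nu> = 1 \<and> 0 < r \<and> L-lipschitz_on {z. z \<bullet> \<nu> = 0} \<gamma> \<and>
        (\<forall>y\<in>ball x r. y \<in> \<Omega> \<longleftrightarrow> \<gamma> (y - (y \<bullet> \<nu>) *\<^sub>R \<nu>) < y \<bullet> \<nu>))"

definition polyhedral_boundary :: "(real^'n::finite) set \<Rightarrow> bool" where
  "polyhedral_boundary \<Omega> \<longleftrightarrow>
     (\<exists>\<P>. finite \<P> \<and> (\<forall>P\<in>\<P>. polytope P \<and> aff_dim P = int CARD('n) - 1) \<and> frontier \<Omega> = \<Union>\<P>)"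

text \<open>Mesh elements are represented by closed simplices \<open>T\<close>; the open element is
  \<open>interior T\<close>. The predicate \<open>triangulation\<close> supplies finiteness and conformity
  (the intersection of two elements is a common, possibly empty, face).\<close>

definition mesh_of :: "(real^'n::finite) set \<Rightarrow> (real^'n) set set \<Rightarrow> bool" where
  "mesh_of \<Omega> \<T> \<longleftrightarrow> triangulation \<T> \<and> (\<forall>T\<in>\<T>. int CARD('n) simplex T) \<and> \<Union>\<T> = closure \<Omega>"

definition shape_regular :: "real \<Rightarrow> (real^'n::finite) set set \<Rightarrow> bool" where
  "shape_regular \<kappa> \<T> \<longleftrightarrow> (\<forall>T\<in>\<T>. diameter T ^ CARD('n) / measure lebesgue T \<le> \<kappa>)"

definition patch :: "(real^'n::finite) set set \<Rightarrow> (real^'n) set \<Rightarrow> (real^'n) set" where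
  "patch \<T> T = interior (\<Union>{T' \<in> \<T>. T \<inter> T' \<noteq> {}})"


section \<open>Continuous spaces, trace operator and bilinear forms\<close>

definition Sigma_space ::
  "(real^'n::finite) set \<Rightarrow> (real^'n) set set \<Rightarrow> (real^'n \<Rightarrow> real^'n) set" where
  "Sigma_space \<Omega> \<T> = {\<tau> \<in> L2 \<Omega>. \<forall>T\<in>\<T>. \<tau> \<in> Hdiv (interior T)}"

definition div_mesh ::
  "(real^'n::finite) set set \<Rightarrow> (real^'n \<Rightarrow> real^'n) \<Rightarrow> real^'n \<Rightarrow> real" where
  "div_mesh \<T> \<tau> x = (\<Sum>T\<in>\<T>. indicator (interior T) x * weak_div (interior T) \<tau> x)"

definition trace_grad ::
  "(real^'n::finite) set \<Rightarrow> (real^'n) set set \<Rightarrow> (real^'n \<Rightarrow> real) \<Rightarrow> (real^'n \<Rightarrow> real^'n) \<Rightarrow> real" where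
  "trace_grad \<Omega> \<T> v = (\<lambda>\<tau>\<in>Sigma_space \<Omega> \<T>.
     \<Sum>T\<in>\<T>. l2_inner (interior T) (weak_div (interior T) \<tau>) v
            + l2_inner (interior T) \<tau> (weak_grad \<Omega> v))"

definition W_space ::
  "(real^'n::finite) set \<Rightarrow> (real^'n) set set \<Rightarrow> ((real^'n \<Rightarrow> real^'n) \<Rightarrow> real) set" where
  "W_space \<Omega> \<T> = trace_grad \<Omega> \<T> ` H10 \<Omega>"

definition a_dual ::
  "real \<Rightarrow> (real^'n::finite) set \<Rightarrow> (real^'n) set set \<Rightarrow>
    (real^'n \<Rightarrow> real^'n) \<Rightarrow> (real^'n \<Rightarrow> real^'n) \<Rightarrow> real" where
  "a_dual \<epsilon> \<Omega> \<T> \<sigma> \<tau> =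
     \<epsilon>\<^sup>2 * l2_inner \<Omega> (div_mesh \<T> \<sigma>) (div_mesh \<T> \<tau>) + l2_inner \<Omega> \<sigma> \<tau>"

definition b_dual ::
  "real \<Rightarrow> ((real^'n::finite \<Rightarrow> real^'n) \<Rightarrow> real) \<Rightarrow> (real^'n \<Rightarrow> real^'n) \<Rightarrow> real" where
  "b_dual \<epsilon> w \<tau> = - \<epsilon> * w \<tau>"


section \<open>Local geometry and bubble functions\<close>

definition vertices :: "(real^'n::finite) set \<Rightarrow> (real^'n) set" where
  "vertices T = {z. z extreme_point_of T}"

definition facets :: "(real^'n::finite) set \<Rightarrow> (real^'n) set set" where
  "facets T = {F. F facet_of T}"

text \<open>The barycentric coordinate of \<open>z\<close> as an affine function on the whole space.\<close>

definition bary :: "(real^'n::finite) set \<Rightarrow> real^'n \<Rightarrow> real^'n \<Rightarrow> real" where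
  "bary T z x = (THE c. \<exists>u. sum u (vertices T) = 1 \<and>
                          (\<Sum>v\<in>vertices T. u v *\<^sub>R v) = x \<and> c = u z)"

definition exterior_normal :: "(real^'n::finite) set \<Rightarrow> (real^'n) set \<Rightarrow> real^'n" where
  "exterior_normal T F = (THE \<nu>. norm \<nu> = 1 \<and> (\<forall>x\<in>F. \<forall>y\<in>T. (y - x) \<bullet> \<nu> \<le> 0))"

definition opp_vertex :: "(real^'n::finite) set \<Rightarrow> (real^'n) set \<Rightarrow> real^'n" where
  "opp_vertex T F = (THE z. z \<in> vertices T \<and> z \<notin> F)"

definition facet_bubble :: "(real^'n::finite) set \<Rightarrow> (real^'n) set \<Rightarrow> real^'n \<Rightarrow> real" where
  "facet_bubble T F x = (\<Prod>z\<in>vertices T - {opp_vertex T F}. bary T z x)"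

definition facet_bubble_eps ::
  "real \<Rightarrow> (real^'n::finite) set \<Rightarrow> (real^'n) set \<Rightarrow> real^'n \<Rightarrow> real" where
  "facet_bubble_eps \<epsilon> T F x =
     exp (- (diameter T / \<epsilon>) * bary T (opp_vertex T F) x) * facet_bubble T F x"

definition edges_at :: "(real^'n::finite) set \<Rightarrow> real^'n \<Rightarrow> (real^'n) set set" where
  "edges_at T z = {E. E edge_of T \<and> z \<in> E}"

definition unit_tangent :: "real^'n::finite \<Rightarrow> (real^'n) set \<Rightarrow> bool" where
  "unit_tangent t E \<longleftrightarrow> norm t = 1 \<and> (\<exists>x\<in>E. \<exists>y\<in>E. \<exists>c. t = c *\<^sub>R (y - x))"

definition edge_bubble ::
  "(real^'n::finite) set \<Rightarrow> (real^'n) set \<Rightarrow> real^'n \<Rightarrow> real" where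
  "edge_bubble T E x = (\<Prod>z\<in>{z. z extreme_point_of E}. bary T z x)"


section \<open>Discrete spaces\<close>

text \<open>The arguments \<open>zv\<close> and \<open>tv\<close> are the fixed selections of a vertex \<open>zv T\<close> of every
  element and of unit tangents \<open>tv T E\<close> to its edges. The local space is written out as
  the set of linear combinations of its generators.\<close>

definition local_space ::
  "real \<Rightarrow> ((real^'n::finite) set \<Rightarrow> real^'n) \<Rightarrow> ((real^'n) set \<Rightarrow> (real^'n) set \<Rightarrow> real^'n) \<Rightarrow>
    (real^'n) set \<Rightarrow> (real^'n \<Rightarrow> real^'n) set" where
  "local_space \<epsilon> zv tv T =
     {\<tau>. \<exists>a c \<alpha> \<beta>. \<tau> = (\<lambda>x. a + c *\<^sub>R x
        + (\<Sum>F\<in>facets T. (\<alpha> F * (if \<epsilon> < diameter T then facet_bubble_eps \<epsilon> T F x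
                                else facet_bubble T F x)) *\<^sub>R exterior_normal T F)
        + (\<Sum>E\<in>edges_at T (zv T). (\<beta> E * edge_bubble T E x) *\<^sub>R tv T E))}"

text \<open>An element of the product space is a family indexed by the elements. Its components
  are given by formulas valid on the whole space, so evaluating \<open>\<tau> T\<close> on a facet of \<open>T\<close> is
  the trace from inside \<open>T\<close>. The function \<open>glue\<close> produces the piecewise function.\<close>

definition Sigma_h ::
  "real \<Rightarrow> ((real^'n::finite) set \<Rightarrow> real^'n) \<Rightarrow> ((real^'n) set \<Rightarrow> (real^'n) set \<Rightarrow> real^'n) \<Rightarrow>
    (real^'n) set set \<Rightarrow> ((real^'n) set \<Rightarrow> real^'n \<Rightarrow> real^'n) set" where
  "Sigma_h \<epsilon> zv tv \<T> = PiE \<T> (local_space \<epsilon> zv tv)"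

definition glue ::
  "(real^'n::finite) set set \<Rightarrow> ((real^'n) set \<Rightarrow> real^'n \<Rightarrow> real^'n) \<Rightarrow> real^'n \<Rightarrow> real^'n" where
  "glue \<T> \<tau> x = (\<Sum>T\<in>\<T>. indicator (interior T) x *\<^sub>R \<tau> T x)"

definition P1_mesh :: "(real^'n::finite) set set \<Rightarrow> (real^'n \<Rightarrow> real) set" where
  "P1_mesh \<T> = {v. \<forall>T\<in>\<T>. \<exists>a b. \<forall>x\<in>interior T. v x = a \<bullet> x + b}"

definition W_h ::
  "(real^'n::finite) set \<Rightarrow> (real^'n) set set \<Rightarrow> ((real^'n \<Rightarrow> real^'n) \<Rightarrow> real) set" where
  "W_h \<Omega> \<T> = trace_grad \<Omega> \<T> ` (P1_mesh \<T> \<inter> H10 \<Omega>)"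


section \<open>Continuous and discrete problems\<close>

definition dual_solution ::
  "real \<Rightarrow> (real^'n::finite) set \<Rightarrow> (real^'n) set set \<Rightarrow> (real^'n \<Rightarrow> real) \<Rightarrow>
    (real^'n \<Rightarrow> real^'n) \<Rightarrow> ((real^'n \<Rightarrow> real^'n) \<Rightarrow> real) \<Rightarrow> bool" where
  "dual_solution \<epsilon> \<Omega> \<T> f \<sigma> w \<longleftrightarrow>
     \<sigma> \<in> Sigma_space \<Omega> \<T> \<and> w \<in> W_space \<Omega> \<T> \<and>
     (\<forall>\<tau>\<in>Sigma_space \<Omega> \<T>. a_dual \<epsilon> \<Omega> \<T> \<sigma> \<tau> + b_dual \<epsilon> w \<tau>
        = l2_inner \<Omega> f (\<lambda>x. - \<epsilon> * div_mesh \<T> \<tau> x)) \<and>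
     (\<forall>v\<in>W_space \<Omega> \<T>. b_dual \<epsilon> v \<sigma> = 0)"

definition discrete_dual_solution ::
  "real \<Rightarrow> (real^'n::finite) set \<Rightarrow> (real^'n) set set \<Rightarrow>
    ((real^'n) set \<Rightarrow> real^'n) \<Rightarrow> ((real^'n) set \<Rightarrow> (real^'n) set \<Rightarrow> real^'n) \<Rightarrow>
    (real^'n \<Rightarrow> real) \<Rightarrow>
    ((real^'n) set \<Rightarrow> real^'n \<Rightarrow> real^'n) \<Rightarrow> ((real^'n \<Rightarrow> real^'n) \<Rightarrow> real) \<Rightarrow> bool" where
  "discrete_dual_solution \<epsilon> \<Omega> \<T> zv tv f \<sigma>h wh \<longleftrightarrow>
     \<sigma>h \<in> Sigma_h \<epsilon> zv tv \<T> \<and> wh \<in> W_h \<Omega> \<T> \<and>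
     (\<forall>\<tau>h\<in>Sigma_h \<epsilon> zv tv \<T>.
        a_dual \<epsilon> \<Omega> \<T> (glue \<T> \<sigma>h) (glue \<T> \<tau>h) + b_dual \<epsilon> wh (glue \<T> \<tau>h)
        = l2_inner \<Omega> f (\<lambda>x. - \<epsilon> * div_mesh \<T> (glue \<T> \<tau>h) x)) \<and>
     (\<forall>vh\<in>W_h \<Omega> \<T>. b_dual \<epsilon> vh (glue \<T> \<sigma>h) = 0)"


section \<open>Normal jumps\<close>

text \<open>Surface measure of a facet: the \<open>(d-1)\<close>-dimensional measure of a set \<open>A \<subseteq> F\<close> is the
  \<open>d\<close>-dimensional Lebesgue measure of the right prism of height one with base \<open>A\<close>.\<close>

definition facet_measure :: "(real^'n::finite) set \<Rightarrow> (real^'n) set \<Rightarrow> (real^'n) measure" where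
  "facet_measure T F =
     distr (lebesgue_on {y + t *\<^sub>R exterior_normal T F | y t. y \<in> F \<and> 0 \<le> t \<and> t \<le> 1})
       borel (closest_point (affine hull F))"

definition normal_jump ::
  "(real^'n::finite) set set \<Rightarrow> ((real^'n) set \<Rightarrow> real^'n \<Rightarrow> real^'n) \<Rightarrow>
    (real^'n) set \<Rightarrow> real^'n \<Rightarrow> real" where
  "normal_jump \<T> \<tau> F y = (\<Sum>T\<in>{T \<in> \<T>. F facet_of T}. \<tau> T y \<bullet> exterior_normal T F)"

text \<open>The \<open>L\<^sub>2\<close> norm of the normal jump on \<open>\<partial>T\<close> without \<open>\<partial>\<Omega>\<close>.\<close>

definition jump_norm ::
  "(real^'n::finite) set \<Rightarrow> (real^'n) set set \<Rightarrow> ((real^'n) set \<Rightarrow> real^'n \<Rightarrow> real^'n) \<Rightarrow>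
    (real^'n) set \<Rightarrow> real" where
  "jump_norm \<Omega> \<T> \<tau> T =
     sqrt (\<Sum>F\<in>facets T. LINT y:(F - frontier \<Omega>)|facet_measure T F. (normal_jump \<T> \<tau> F y)\<^sup>2)"

end

theory Submission
  imports Defs
begin

text \<open>Across a facet \<open>F\<close> common to \<open>T\<close> and \<open>T'\<close> the jump of the normal trace is a multi-affine
  polynomial in the barycentric coordinates of \<open>F\<close>, whatever \<open>\<epsilon>\<close> is: the exponential factor of
  the facet bubbles equals one on \<open>F\<close>. Extend this polynomial constantly in the normal direction
  and multiply it by smooth cut-offs in the tangential coordinates and in the distance to \<open>F\<close>, the
  latter at the scale \<open>\<delta>\<close> proportional to \<open>min \<epsilon> (diameter T)\<close>. Shape regularity puts the
  support of the product \<open>\<phi>\<close> into the interior of \<open>T \<union> T'\<close>. The second equation of the continuous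
  problem makes the exact solution \<open>H(div)\<close>-conforming, so integration by parts shows that the
  integral of the jump against \<open>\<phi>\<close> equals the integral of \<open>div e \<phi> + e \<bullet> grad \<phi>\<close> for the error \<open>e\<close>.
  By compactness on a reference facet the former dominates \<open>|F|\<close> times the square of the sum \<open>L\<close> of the
  absolute values of the coefficients. Since \<open>\<phi>\<close> and its gradient are of size \<open>L\<close> and
  \<open>L / \<delta>\<close> on a set of measure at most \<open>2 \<delta> |F|\<close>, Cauchy--Schwarz bounds the latter, and
  dividing by \<open>sqrt |F| L\<close> gives the estimate.\<close>

section \<open>Calculus on the whole space: smooth functions, cut-offs and the divergence
  theorem\<close>

section \<open>Smooth functions\<close>

text \<open>Three constraints shape the test function. Weak divergences are tested only with smooth
  functions of compact support, so the cut-offs are built from the flat function exp(-1/s). Near the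
  relative boundary of \<open>F\<close> the union T \<union> T' need not be a neighbourhood, so the
  tangential cut-off keeps all barycentric coordinates of \<open>F\<close> above \<beta> = 1/(2d),
  half of their value at the barycentre; the part of the facet that remains still determines the
  polynomial. Finally the layer has to fit on both sides: if K \<ge> 1 bounds |grad| h for the
  coordinates of every element, then K^2 / h_T bounds the gradients of the coordinates of both T and
  T', which leads to \<delta> = c0 min(\<epsilon>, h_T) with c0 = \<beta> / (4 K^2). The two entries
  of the minimum act separately: the diameter makes the layer fit, and \<epsilon> keeps the weight
  of the divergence error at most \<epsilon>. A facet measure is defined through a prism of height
  one, so the divergence theorem and the passage to the reference facet become identities between
  volume integrals; they rest on translation invariance and Fubini.\<close>

definition smooth :: "(real^'n::finite \<Rightarrow> real) \<Rightarrow> bool" where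
  "smooth \<phi> \<longleftrightarrow> (\<forall>k. C_k k \<phi>)"

lemma partial_eq: "(\<phi> has_derivative D) (at x) \<Longrightarrow> partial i \<phi> x = D (axis i 1)"
  unfolding partial_def using frechet_derivative_at by metis

text \<open>The predicate for \<open>Suc k\<close> does not contain the one for \<open>k\<close>, so
  the induction runs over all functions: at order zero differentiability gives continuity, above it
  the hypothesis is applied to the partial derivatives. The product rule needs this because it keeps
  undifferentiated factors.\<close>

lemma C_k_Suc_imp: "C_k (Suc k) \<phi> \<Longrightarrow> C_k k \<phi>"
proof (induction k arbitrary: \<phi>)
  case 0
  then show ?case
    by (auto intro!: continuous_at_imp_continuous_on differentiable_imp_continuous_within)
next
  case (Suc k)
  then show ?case by (auto simp del: C_k.simps(2) simp: C_k.simps(2)[of "Suc k"] C_k.simps(2)[of k])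
qed

lemma C_k_const: "C_k k (\<lambda>x. c)"
proof (induction k arbitrary: c)
  case (Suc k)
  have "partial i (\<lambda>x::real^'a. c) = (\<lambda>x. 0)" for i :: 'a
    by (rule ext, subst partial_eq) (auto intro!: derivative_eq_intros)
  then show ?case using Suc by simp
qed simp

lemma partial_add:
  assumes "f differentiable (at x)" "g differentiable (at x)"
  shows "partial i (\<lambda>x. f x + g x) x = partial i f x + partial i g x"
  using assms unfolding frechet_derivative_works
  by (subst partial_eq[where x = x]) (auto intro!: derivative_eq_intros simp: partial_def)

lemma partial_mult:
  assumes "f differentiable (at x)" "g differentiable (at x)"
  shows "partial i (\<lambda>x. f x * g x) x = partial i f x * g x + f x * partial i g x"
  using assms unfolding frechet_derivative_works
  by (subst partial_eq[where x = x]) (auto intro!: derivative_eq_intros simp: partial_def)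

lemma C_k_add: "C_k k f \<Longrightarrow> C_k k g \<Longrightarrow> C_k k (\<lambda>x. f x + g x)"
proof (induction k arbitrary: f g)
  case (Suc k)
  then have "partial i (\<lambda>x. f x + g x) = (\<lambda>x. partial i f x + partial i g x)" for i
    by (auto simp: partial_add)
  with Suc show ?case by simp
qed (simp add: continuous_on_add)

lemma C_k_mult: "C_k k f \<Longrightarrow> C_k k g \<Longrightarrow> C_k k (\<lambda>x. f x * g x)"
proof (induction k arbitrary: f g)
  case (Suc k)
  then have eq: "partial i (\<lambda>x. f x * g x) = (\<lambda>x. partial i f x * g x + f x * partial i g x)" for i
    by (auto simp: partial_mult)
  have "C_k k f" "C_k k g" using Suc.prems C_k_Suc_imp by blast+
  with Suc show ?case by (simp add: eq C_k_add)
qed (simp add: continuous_on_mult)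

lemma smooth_const: "smooth (\<lambda>x. c)"
  and smooth_add: "smooth f \<Longrightarrow> smooth g \<Longrightarrow> smooth (\<lambda>x. f x + g x)"
  and smooth_mult: "smooth f \<Longrightarrow> smooth g \<Longrightarrow> smooth (\<lambda>x. f x * g x)"
  by (simp_all add: smooth_def C_k_const C_k_add C_k_mult)

lemma smooth_sum: "(\<And>i. i \<in> I \<Longrightarrow> smooth (f i)) \<Longrightarrow> smooth (\<lambda>x. \<Sum>i\<in>I. f i x)"
  by (induction I rule: infinite_finite_induct) (auto simp: smooth_const smooth_add)

lemma smooth_prod: "(\<And>i. i \<in> I \<Longrightarrow> smooth (f i)) \<Longrightarrow> smooth (\<lambda>x. \<Prod>i\<in>I. f i x)"
  by (induction I rule: infinite_finite_induct) (auto simp: smooth_const smooth_mult)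

text \<open>The successive derivatives are supplied as a tower \<open>D\<close>, so that induction
  on the order can climb it: a partial derivative of \<open>D m\<close> after an affine map is a
  constant multiple of \<open>D (Suc m)\<close> after the same map.\<close>

lemma smooth_compose_affine:
  assumes D: "\<And>m s. (D m has_real_derivative D (Suc m) s) (at s)"
  shows "smooth (\<lambda>x. D m (g \<bullet> x + c))"
proof -
  have "C_k k (\<lambda>x. D m (g \<bullet> x + c))" for k
  proof (induction k arbitrary: m)
    case 0
    have "continuous_on UNIV (D m)"
      using D by (meson DERIV_isCont continuous_at_imp_continuous_on)
    then show ?case
      by (auto intro!: continuous_intros continuous_on_compose2[where f = "\<lambda>x. g \<bullet> x + c"])
  next
    case (Suc k)
    have der: "((\<lambda>x. D m (g \<bullet> x + c)) has_derivative (\<lambda>h. D (Suc m) (g \<bullet> x + c) * (g \<bullet> h))) (at x)"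
      for x
      by (rule has_derivative_compose[of "\<lambda>x. g \<bullet> x + c", where g = "D m", OF _ D[unfolded has_field_derivative_def], simplified])
        (auto intro!: derivative_eq_intros)
    have "partial i (\<lambda>x. D m (g \<bullet> x + c)) = (\<lambda>x. D (Suc m) (g \<bullet> x + c) * (g $ i))" for i
      by (rule ext, subst partial_eq[OF der]) (simp add: inner_axis)
    then show ?case using der Suc C_k_mult[OF Suc C_k_const] by (auto simp: differentiable_def)
  qed
  then show ?thesis by (simp add: smooth_def)
qed

lemma smooth_affine: "smooth (\<lambda>x. g \<bullet> x + c)"
proof -
  define D :: "nat \<Rightarrow> real \<Rightarrow> real" where
    "D m = (case m of 0 \<Rightarrow> (\<lambda>s. s) | Suc k \<Rightarrow> (\<lambda>s. if k = 0 then 1 else 0))" for m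
  have "(D m has_real_derivative D (Suc m) s) (at s)" for m s
    by (cases m) (auto simp: D_def)
  from smooth_compose_affine[of D, OF this, of 0] show ?thesis by (simp add: D_def)
qed

lemma smooth_exp_affine: "smooth (\<lambda>x. exp (g \<bullet> x + c))"
  by (rule smooth_compose_affine[of "\<lambda>_. exp" 0]) (auto intro: DERIV_exp)

lemma smooth_C_k: "smooth f \<Longrightarrow> C_k k f"
  by (simp add: smooth_def)

lemma smooth_partial: "smooth f \<Longrightarrow> smooth (partial i f)"
  unfolding smooth_def[of "partial i f"] using smooth_C_k[of f "Suc k" for k] by simp

lemma smooth_differentiable: "smooth f \<Longrightarrow> f differentiable (at x)"
  using smooth_C_k[of f "Suc 0"] by simp

lemma smooth_continuous: "smooth f \<Longrightarrow> continuous_on S f"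
  using smooth_C_k[of f 0] continuous_on_subset by fastforce

lemma continuous_on_partial: "smooth f \<Longrightarrow> continuous_on S (partial i f)"
  by (simp add: smooth_continuous smooth_partial)

abbreviation gradient :: "(real^'n::finite \<Rightarrow> real) \<Rightarrow> real^'n \<Rightarrow> real^'n" where
  "gradient f x \<equiv> (\<chi> i. partial i f x)"

lemma has_derivative_gradient:
  assumes "f differentiable (at x)"
  shows "(f has_derivative (\<lambda>h. gradient f x \<bullet> h)) (at x)"
proof -
  obtain D where D: "(f has_derivative D) (at x)" using assms by (auto simp: differentiable_def)
  have "D h = gradient f x \<bullet> h" for h
  proof -
    interpret linear D using D has_derivative_linear by blast
    have "D h = D (\<Sum>i\<in>UNIV. h $ i *\<^sub>R axis i 1)"
      by (rule arg_cong[OF basis_expansion[of h, unfolded scalar_mult_eq_scaleR, symmetric]])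
    also have "\<dots> = (\<Sum>i\<in>UNIV. h $ i * partial i f x)"
      by (simp only: sum scaleR partial_eq[OF D] real_scaleR_def)
    also have "\<dots> = gradient f x \<bullet> h" by (simp add: inner_vec_def mult.commute)
    finally show ?thesis .
  qed
  then have "D = (\<lambda>h. gradient f x \<bullet> h)" by (rule ext)
  with D show ?thesis by (rule subst[rotated])
qed

lemma gradient_eq: "(f has_derivative (\<lambda>h. g \<bullet> h)) (at x) \<Longrightarrow> gradient f x = g"
proof -
  assume "(f has_derivative (\<lambda>h. g \<bullet> h)) (at x)"
  from partial_eq[OF this] have "partial i f x = g $ i" for i
    by (simp only: inner_axis) simp
  then show ?thesis by (simp add: vec_eq_iff)
qed

lemma continuous_on_gradient: "smooth f \<Longrightarrow> continuous_on S (gradient f)"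
  by (intro continuous_on_vec_lambda continuous_on_partial)

lemma outside_closure_support: "x \<notin> closure {x. f x \<noteq> 0} \<Longrightarrow> f x = 0"
  using subsetD[OF closure_subset, of x "{x. f x \<noteq> 0}"] by (simp only: mem_Collect_eq) argo

lemma partial_outside_support:
  assumes "x \<notin> closure {x. f x \<noteq> 0}"
  shows "partial i f x = 0"
proof -
  define U where "U = - closure {x. f x \<noteq> 0}"
  have 0: "f y = 0" if "y \<in> U" for y
    using that unfolding U_def by (intro outside_closure_support) (rule ComplD)
  have "open U" unfolding U_def by (rule open_Compl[OF closed_closure])
  moreover have "x \<in> U" unfolding U_def using assms by (simp only: Compl_iff not_False_eq_True)
  ultimately have "(f has_derivative (\<lambda>_. 0)) (at x)"
    by (rule has_derivative_transform_within_open[OF has_derivative_const]) (simp add: 0)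
  from partial_eq[OF this] show ?thesis .
qed

section \<open>A flat function\<close>

text \<open>Polynomials in 1/s times exp(-1/s), extended by zero, are closed under differentiation.
  The whole family is introduced because all derivatives of the single cut-off exp(-1/s) stay inside
  it.\<close>

definition flat :: "real poly \<Rightarrow> real \<Rightarrow> real" where
  "flat p s = (if s > 0 then poly p (1 / s) * exp (- (1 / s)) else 0)"

text \<open>In the variable u = 1/s one has d/ds = - u^2 d/du, and d/du maps p exp(-u) to (p' - p)
  exp(-u); the coefficient list stands for u^2.\<close>

definition flat_deriv :: "real poly \<Rightarrow> real poly" where
  "flat_deriv p = [:0, 0, 1:] * (p - pderiv p)"

lemma poly_exp_tendsto_0: "((\<lambda>u::real. poly p u * exp (- u)) \<longlongrightarrow> 0) at_top"
proof -
  have "((\<lambda>u. \<Sum>i\<le>degree p. coeff p i * (u ^ i / exp u)) \<longlongrightarrow> (\<Sum>i\<le>degree p. coeff p i * 0)) at_top"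
    by (intro tendsto_sum tendsto_mult tendsto_const tendsto_power_div_exp_0)
  then show ?thesis
    by (simp add: poly_altdef sum_distrib_right exp_minus divide_inverse mult.assoc)
qed

lemma flat_has_derivative: "(flat p has_real_derivative flat (flat_deriv p) s) (at s)"
proof -
  consider "s < 0" | "s > 0" | "s = 0" by linarith
  then show ?thesis
  proof cases
    case 1
    have "(flat p has_real_derivative 0) (at s)"
      by (rule has_field_derivative_transform_within_open[where f = "\<lambda>_. 0" and S = "{..<0}"])
         (use 1 in \<open>auto simp: flat_def\<close>)
    then show ?thesis using 1 by (simp add: flat_def)
  next
    case 2
    have inv: "((\<lambda>s. 1 / s) has_real_derivative - (1 / s)\<^sup>2) (at s)"
      using 2 by (auto intro!: derivative_eq_intros simp: power2_eq_square)
    have "((\<lambda>s. poly p (1 / s)) has_real_derivative poly (pderiv p) (1 / s) * (- (1 / s)\<^sup>2)) (at s)"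
      by (rule DERIV_chain2[OF poly_DERIV inv])
    moreover have "((\<lambda>s. exp (- (1 / s))) has_real_derivative exp (- (1 / s)) * (- (- (1 / s)\<^sup>2))) (at s)"
      by (rule DERIV_chain2[OF DERIV_exp DERIV_minus[OF inv]])
    ultimately have "((\<lambda>s. poly p (1 / s) * exp (- (1 / s))) has_real_derivative
        poly p (1 / s) * (exp (- (1 / s)) * (- (- (1 / s)\<^sup>2))) + poly (pderiv p) (1 / s) * (- (1 / s)\<^sup>2) * exp (- (1 / s))) (at s)"
      by (rule DERIV_mult')
    moreover have "poly p (1 / s) * (exp (- (1 / s)) * (- (- (1 / s)\<^sup>2))) + poly (pderiv p) (1 / s) * (- (1 / s)\<^sup>2) * exp (- (1 / s))
      = poly (flat_deriv p) (1 / s) * exp (- (1 / s))"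
      unfolding flat_deriv_def by (simp add: power2_eq_square algebra_simps)
    ultimately have "((\<lambda>s. poly p (1 / s) * exp (- (1 / s))) has_real_derivative
        poly (flat_deriv p) (1 / s) * exp (- (1 / s))) (at s)"
      by simp
    then have "((\<lambda>s. poly p (1 / s) * exp (- (1 / s))) has_real_derivative flat (flat_deriv p) s) (at s)"
      using 2 by (simp add: flat_def)
    then show ?thesis
      by (rule has_field_derivative_transform_within_open[where S = "{0<..}"])
        (use 2 in \<open>auto simp: flat_def\<close>)
  next
    case 3
    have "((\<lambda>s. flat p s / s) \<longlongrightarrow> 0) (at_right 0)"
    proof -
      \<comment> \<open>Dividing by s multiplies the polynomial in 1/s by its variable, so the
        right-hand difference quotient at 0 is again a polynomial times exp(-u), with u tending to
        infinity.\<close>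
      have "((\<lambda>s. poly (pCons 0 p) (inverse s) * exp (- (inverse s))) \<longlongrightarrow> 0) (at_right 0)"
        by (rule filterlim_compose[OF poly_exp_tendsto_0 filterlim_inverse_at_top_right])
      then show ?thesis
        by (rule Lim_transform_eventually)
           (auto simp: flat_def divide_inverse intro!: eventually_mono[OF eventually_at_right_less])
    qed
    moreover have "((\<lambda>s. flat p s / s) \<longlongrightarrow> 0) (at_left 0)"
      by (rule tendsto_eventually) (auto simp: flat_def eventually_at_left_field intro!: exI[of _ "-1"])
    ultimately have "((\<lambda>s. flat p s / s) \<longlongrightarrow> 0) (at 0)"
      by (simp add: filterlim_split_at)
    then show ?thesis using 3 by (simp add: has_field_derivative_iff flat_def)
  qed
qed

lemma smooth_flat_affine: "smooth (\<lambda>x. flat p (g \<bullet> x + c))"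
  using smooth_compose_affine[of "\<lambda>m. flat ((flat_deriv ^^ m) p)" 0 g c] flat_has_derivative
  by simp

definition bump :: "real \<Rightarrow> real" where
  "bump = flat 1"

lemma bump_eq: "bump s = (if s > 0 then exp (- (1 / s)) else 0)"
  by (simp add: bump_def flat_def)

lemma bump_bounds: "0 \<le> bump s" "bump s \<le> 1"
  by (auto simp: bump_eq)

lemma bump_pos_iff: "0 < bump s \<longleftrightarrow> 0 < s"
  by (auto simp: bump_eq)

text \<open>With u = 1/s the derivative is u^2 exp(-u), and exp u is at least u^2 / 2.\<close>

lemma bump_deriv_bound: "\<bar>flat (flat_deriv 1) s\<bar> \<le> 2"
proof (cases "s > 0")
  case True
  have "(1 / s)\<^sup>2 / 2 \<le> exp (1 / s)"
    using exp_lower_Taylor_quadratic[of "1 / s"] True by (smt (verit) divide_pos_pos)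
  from mult_right_mono[OF this, of "exp (- (1 / s))"]
  have "(1 / s)\<^sup>2 / 2 * exp (- (1 / s)) \<le> 1"
    by (simp add: exp_minus)
  then have "(1 / s)\<^sup>2 * exp (- (1 / s)) \<le> 2" by simp
  then show ?thesis using True by (simp add: flat_def flat_deriv_def power2_eq_square abs_mult)
qed (simp add: flat_def)

lemma smooth_bump_affine: "smooth (\<lambda>x. bump (g \<bullet> x + c))"
  unfolding bump_def by (rule smooth_flat_affine)

lemma gradient_bump_affine:
  "gradient (\<lambda>x. bump (g \<bullet> x + c)) x = flat (flat_deriv 1) (g \<bullet> x + c) *\<^sub>R g"
proof (rule gradient_eq)
  have "((\<lambda>x. g \<bullet> x + c) has_derivative (\<lambda>h. g \<bullet> h)) (at x)"
    by (auto intro!: derivative_eq_intros)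
  from has_derivative_compose[OF this flat_has_derivative[of 1, unfolded has_field_derivative_def]]
  show "((\<lambda>x. bump (g \<bullet> x + c)) has_derivative (\<lambda>h. (flat (flat_deriv 1) (g \<bullet> x + c) *\<^sub>R g) \<bullet> h)) (at x)"
    unfolding bump_def by simp
qed

section \<open>Integration along lines and linear changes of variables\<close>

lemma nn_integral_lborel_translate:
  fixes h :: "'a::euclidean_space \<Rightarrow> ennreal"
  assumes [measurable]: "h \<in> borel_measurable borel"
  shows "(\<integral>\<^sup>+x. h (x + v) \<partial>lborel) = (\<integral>\<^sup>+x. h x \<partial>lborel)"
  by (subst lborel_distr_plus[of v, symmetric], subst nn_integral_distr) (auto simp: add.commute)

lemma integral_lborel_translate:
  fixes h :: "'a::euclidean_space \<Rightarrow> 'b::{banach, second_countable_topology}"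
  assumes [measurable]: "h \<in> borel_measurable borel"
  shows "(\<integral>x. h (x + v) \<partial>lborel) = (\<integral>x. h x \<partial>lborel)"
  by (subst lborel_distr_plus[of v, symmetric], subst integral_distr) (auto simp: add.commute)

text \<open>Both sides average the translation-invariant integral of \<open>h\<close> over the translates by
  multiples of \<open>u\<close>; this replaces a choice of orthonormal coordinates adapted to \<open>u\<close>.\<close>

lemma nn_integral_slab:
  fixes h :: "'a::euclidean_space \<Rightarrow> ennreal"
  assumes [measurable]: "h \<in> borel_measurable borel" and u: "norm u = 1" and "a \<le> b"
  shows "(\<integral>\<^sup>+x. indicator {x. a \<le> x \<bullet> u \<and> x \<bullet> u \<le> b} x * (\<integral>\<^sup>+t. h (x + t *\<^sub>R u) \<partial>lborel) \<partial>lborel)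
         = ennreal (b - a) * (\<integral>\<^sup>+x. h x \<partial>lborel)"
proof -
  define S where "S = {x. a \<le> x \<bullet> u \<and> x \<bullet> u \<le> b}"
  have [measurable]: "S \<in> sets borel" unfolding S_def by measurable
  have uu: "u \<bullet> u = 1" using u by (simp add: norm_eq_1)
  have "(\<integral>\<^sup>+x. indicator S x * (\<integral>\<^sup>+t. h (x + t *\<^sub>R u) \<partial>lborel) \<partial>lborel)
      = (\<integral>\<^sup>+x. (\<integral>\<^sup>+t. indicator S x * h (x + t *\<^sub>R u) \<partial>lborel) \<partial>lborel)"
    by (intro nn_integral_cong nn_integral_cmult[symmetric]) measurable
  also have "\<dots> = (\<integral>\<^sup>+t. (\<integral>\<^sup>+x. indicator S x * h (x + t *\<^sub>R u) \<partial>lborel) \<partial>lborel)"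
    by (rule lborel_pair.Fubini'[symmetric]) measurable
  also have "\<dots> = (\<integral>\<^sup>+t. (\<integral>\<^sup>+x. indicator {x \<bullet> u - b..x \<bullet> u - a} t * h x \<partial>lborel) \<partial>lborel)"
  proof (rule nn_integral_cong)
    fix t :: real
    have "(\<integral>\<^sup>+x. indicator S x * h (x + t *\<^sub>R u) \<partial>lborel)
        = (\<integral>\<^sup>+x. indicator S (x + t *\<^sub>R u - t *\<^sub>R u) * h (x + t *\<^sub>R u) \<partial>lborel)"
      by simp
    also have "\<dots> = (\<integral>\<^sup>+x. indicator S (x - t *\<^sub>R u) * h x \<partial>lborel)"
      by (rule nn_integral_lborel_translate[where h = "\<lambda>x. indicator S (x - t *\<^sub>R u) * h x"]) measurable
    also have "\<dots> = (\<integral>\<^sup>+x. indicator {x \<bullet> u - b..x \<bullet> u - a} t * h x \<partial>lborel)"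
      by (intro nn_integral_cong) (auto simp: S_def indicator_def inner_diff_left uu)
    finally show "(\<integral>\<^sup>+x. indicator S x * h (x + t *\<^sub>R u) \<partial>lborel)
        = (\<integral>\<^sup>+x. indicator {x \<bullet> u - b..x \<bullet> u - a} t * h x \<partial>lborel)" .
  qed
  also have "\<dots> = (\<integral>\<^sup>+x. (\<integral>\<^sup>+t. indicator {x \<bullet> u - b..x \<bullet> u - a} t * h x \<partial>lborel) \<partial>lborel)"
  proof (rule lborel_pair.Fubini')
    have "(\<lambda>(x, t). indicator {x \<bullet> u - b..x \<bullet> u - a} t * h x)
      = (\<lambda>p. indicator {p. fst p \<bullet> u - b \<le> snd p \<and> snd p \<le> fst p \<bullet> u - a} p * h (fst p))"
      by (auto simp: fun_eq_iff indicator_def)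
    then show "(\<lambda>(x, t). indicator {x \<bullet> u - b..x \<bullet> u - a} t * h x) \<in> borel_measurable (lborel \<Otimes>\<^sub>M lborel)"
      by simp
  qed
  also have "\<dots> = (\<integral>\<^sup>+x. ennreal (b - a) * h x \<partial>lborel)"
    using \<open>a \<le> b\<close> by (intro nn_integral_cong) (simp add: nn_integral_multc)
  also have "\<dots> = ennreal (b - a) * (\<integral>\<^sup>+x. h x \<partial>lborel)"
    by (rule nn_integral_cmult) measurable
  finally show ?thesis by (simp add: S_def)
qed

text \<open>The version for nonnegative functions, applied to the absolute value of
  \<open>h\<close>, supplies the integrability on the product space that Fubini asks for; after that
  the averaging argument is the same.\<close>

lemma integral_slab:
  fixes h :: "'a::euclidean_space \<Rightarrow> real"
  assumes h: "integrable lborel h" and u: "norm u = 1" and "a \<le> b"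
  shows "(\<integral>x. indicator {x. a \<le> x \<bullet> u \<and> x \<bullet> u \<le> b} x * (\<integral>t. h (x + t *\<^sub>R u) \<partial>lborel) \<partial>lborel)
         = (b - a) * (\<integral>x. h x \<partial>lborel)"
proof -
  define S where "S = {x. a \<le> x \<bullet> u \<and> x \<bullet> u \<le> b}"
  have [measurable]: "S \<in> sets borel" unfolding S_def by measurable
  have [measurable]: "h \<in> borel_measurable borel" using h by simp
  have uu: "u \<bullet> u = 1" using u by (simp add: norm_eq_1)
  have int: "integrable (lborel \<Otimes>\<^sub>M lborel) (\<lambda>(x, t). indicator S x * h (x + t *\<^sub>R u))"
  proof (rule integrableI_bounded)
    have "(\<integral>\<^sup>+p. ennreal (norm (case p of (x, t) \<Rightarrow> indicator S x * h (x + t *\<^sub>R u))) \<partial>(lborel \<Otimes>\<^sub>M lborel))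
      = (\<integral>\<^sup>+x. (\<integral>\<^sup>+t. indicator S x * ennreal (norm (h (x + t *\<^sub>R u))) \<partial>lborel) \<partial>lborel)"
      by (subst lborel.nn_integral_fst[symmetric])
         (auto simp: indicator_def intro!: nn_integral_cong)
    also have "\<dots> = (\<integral>\<^sup>+x. indicator S x * (\<integral>\<^sup>+t. ennreal (norm (h (x + t *\<^sub>R u))) \<partial>lborel) \<partial>lborel)"
      by (intro nn_integral_cong nn_integral_cmult) measurable
    also have "\<dots> = ennreal (b - a) * (\<integral>\<^sup>+x. ennreal (norm (h x)) \<partial>lborel)"
      unfolding S_def by (rule nn_integral_slab[OF _ u \<open>a \<le> b\<close>]) measurable
    also have "\<dots> < \<infinity>"
      using h by (simp add: integrable_iff_bounded ennreal_mult_less_top)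
    finally show "(\<integral>\<^sup>+p. ennreal (norm (case p of (x, t) \<Rightarrow> indicator S x * h (x + t *\<^sub>R u))) \<partial>(lborel \<Otimes>\<^sub>M lborel)) < \<infinity>" .
  qed measurable
  have "(\<integral>x. indicator S x * (\<integral>t. h (x + t *\<^sub>R u) \<partial>lborel) \<partial>lborel)
      = (\<integral>x. (\<integral>t. indicator S x * h (x + t *\<^sub>R u) \<partial>lborel) \<partial>lborel)"
    by simp
  also have "\<dots> = (\<integral>t. (\<integral>x. indicator S x * h (x + t *\<^sub>R u) \<partial>lborel) \<partial>lborel)"
    by (rule lborel_pair.Fubini_integral[symmetric, OF int])
  also have "\<dots> = (\<integral>t. (\<integral>x. indicator {x \<bullet> u - b..x \<bullet> u - a} t * h x \<partial>lborel) \<partial>lborel)"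
  proof (rule Bochner_Integration.integral_cong[OF refl])
    fix t :: real
    have "(\<integral>x. indicator S x * h (x + t *\<^sub>R u) \<partial>lborel)
        = (\<integral>x. indicator S (x + t *\<^sub>R u - t *\<^sub>R u) * h (x + t *\<^sub>R u) \<partial>lborel)"
      by simp
    also have "\<dots> = (\<integral>x. indicator S (x - t *\<^sub>R u) * h x \<partial>lborel)"
      by (rule integral_lborel_translate[where h = "\<lambda>x. indicator S (x - t *\<^sub>R u) * h x"]) measurable
    also have "\<dots> = (\<integral>x. indicator {x \<bullet> u - b..x \<bullet> u - a} t * h x \<partial>lborel)"
      by (intro Bochner_Integration.integral_cong) (auto simp: S_def indicator_def inner_diff_left uu)
    finally show "(\<integral>x. indicator S x * h (x + t *\<^sub>R u) \<partial>lborel)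
        = (\<integral>x. indicator {x \<bullet> u - b..x \<bullet> u - a} t * h x \<partial>lborel)" .
  qed
  also have "\<dots> = (\<integral>x. (\<integral>t. indicator {x \<bullet> u - b..x \<bullet> u - a} t * h x \<partial>lborel) \<partial>lborel)"
  proof (rule lborel_pair.Fubini_integral)
    have eq: "(\<lambda>(x, t). indicator {x \<bullet> u - b..x \<bullet> u - a} t * h x)
      = (\<lambda>p. indicator {p. fst p \<bullet> u - b \<le> snd p \<and> snd p \<le> fst p \<bullet> u - a} p * h (fst p))"
      by (auto simp: fun_eq_iff indicator_def)
    show "integrable (lborel \<Otimes>\<^sub>M lborel) (\<lambda>(x, t). indicator {x \<bullet> u - b..x \<bullet> u - a} t * h x)"
    proof (rule integrableI_bounded)
      show "(\<lambda>(x, t). indicator {x \<bullet> u - b..x \<bullet> u - a} t * h x) \<in> borel_measurable (lborel \<Otimes>\<^sub>M lborel)"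
        unfolding eq by measurable
      have "(\<integral>\<^sup>+p. ennreal (norm (case p of (x, t) \<Rightarrow> indicator {x \<bullet> u - b..x \<bullet> u - a} t * h x)) \<partial>(lborel \<Otimes>\<^sub>M lborel))
        = (\<integral>\<^sup>+x. (\<integral>\<^sup>+t. indicator {x \<bullet> u - b..x \<bullet> u - a} t * ennreal (norm (h x)) \<partial>lborel) \<partial>lborel)"
        unfolding eq by (subst lborel.nn_integral_fst[symmetric])
           (auto simp: indicator_def intro!: nn_integral_cong)
      also have "\<dots> = (\<integral>\<^sup>+x. ennreal (b - a) * ennreal (norm (h x)) \<partial>lborel)"
        using \<open>a \<le> b\<close> by (intro nn_integral_cong) (simp add: nn_integral_multc)
      also have "\<dots> = ennreal (b - a) * (\<integral>\<^sup>+x. ennreal (norm (h x)) \<partial>lborel)"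
        by (rule nn_integral_cmult) measurable
      also have "\<dots> < \<infinity>"
        using h by (simp add: integrable_iff_bounded ennreal_mult_less_top)
      finally show "(\<integral>\<^sup>+p. ennreal (norm (case p of (x, t) \<Rightarrow> indicator {x \<bullet> u - b..x \<bullet> u - a} t * h x)) \<partial>(lborel \<Otimes>\<^sub>M lborel)) < \<infinity>" .
    qed
  qed
  also have "\<dots> = (\<integral>x. (b - a) * h x \<partial>lborel)"
    using \<open>a \<le> b\<close> by (intro Bochner_Integration.integral_cong) simp_all
  finally show ?thesis by (simp add: S_def)
qed

text \<open>Uniqueness of Haar measure: integrating \<open>f (L y) g (x)\<close> over both variables and using
  translation invariance twice exchanges the roles of \<open>f\<close> and \<open>g\<close>. (The change of variables
  theorems of the library need a well-ordered index type.)\<close>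

lemma nn_integral_linear_swap:
  fixes L :: "'a::euclidean_space \<Rightarrow> 'a" and f g :: "'a \<Rightarrow> ennreal"
  assumes L: "linear L" and M: "\<And>y. L (M y) = y"
    and [measurable]: "f \<in> borel_measurable borel" "g \<in> borel_measurable borel"
  shows "(\<integral>\<^sup>+y. f (L y) \<partial>lborel) * (\<integral>\<^sup>+x. g x \<partial>lborel) = (\<integral>\<^sup>+y. g (L y) \<partial>lborel) * (\<integral>\<^sup>+x. f x \<partial>lborel)"
proof -
  interpret L: linear L by fact
  have [measurable]: "L \<in> borel_measurable borel"
    using L by (intro borel_measurable_continuous_onI linear_continuous_on linear_conv_bounded_linear[THEN iffD1])
  have "(\<integral>\<^sup>+y. f (L y) \<partial>lborel) * (\<integral>\<^sup>+x. g x \<partial>lborel) = (\<integral>\<^sup>+y. f (L y) * (\<integral>\<^sup>+x. g (x + L y) \<partial>lborel) \<partial>lborel)"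
    by (subst nn_integral_lborel_translate) (auto simp: nn_integral_multc)
  also have "\<dots> = (\<integral>\<^sup>+y. (\<integral>\<^sup>+x. f (L y) * g (x + L y) \<partial>lborel) \<partial>lborel)"
    by (intro nn_integral_cong nn_integral_cmult[symmetric]) measurable
  also have "\<dots> = (\<integral>\<^sup>+x. (\<integral>\<^sup>+y. f (L y) * g (x + L y) \<partial>lborel) \<partial>lborel)"
    by (rule lborel_pair.Fubini') measurable
  also have "\<dots> = (\<integral>\<^sup>+x. (\<integral>\<^sup>+y. f (L y - x) * g (L y) \<partial>lborel) \<partial>lborel)"
  proof (rule nn_integral_cong)
    fix x
    \<comment> \<open>Shifting \<open>y\<close> by \<open>M x\<close> adds \<open>x\<close> to
      \<open>L y\<close>; this removes \<open>x\<close> from the argument of \<open>g\<close> and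
      moves it, with a minus sign, into that of \<open>f\<close>.\<close>
    have "(\<integral>\<^sup>+y. f (L y) * g (x + L y) \<partial>lborel)
      = (\<integral>\<^sup>+y. f (L (y + M x) - x) * g (L (y + M x)) \<partial>lborel)"
      by (simp add: L.add M add.commute)
    also have "\<dots> = (\<integral>\<^sup>+y. f (L y - x) * g (L y) \<partial>lborel)"
      by (rule nn_integral_lborel_translate[where h = "\<lambda>y. f (L y - x) * g (L y)"]) measurable
    finally show "(\<integral>\<^sup>+y. f (L y) * g (x + L y) \<partial>lborel) = (\<integral>\<^sup>+y. f (L y - x) * g (L y) \<partial>lborel)" .
  qed
  also have "\<dots> = (\<integral>\<^sup>+y. (\<integral>\<^sup>+x. f (L y - x) * g (L y) \<partial>lborel) \<partial>lborel)"
    by (rule lborel_pair.Fubini') measurable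
  also have "\<dots> = (\<integral>\<^sup>+y. (\<integral>\<^sup>+x. f (- x) \<partial>lborel) * g (L y) \<partial>lborel)"
  proof (rule nn_integral_cong)
    fix y
    have "(\<integral>\<^sup>+x. f (L y - x) * g (L y) \<partial>lborel) = (\<integral>\<^sup>+x. f (L y - (x + L y)) * g (L y) \<partial>lborel)"
      by (rule nn_integral_lborel_translate[where h = "\<lambda>x. f (L y - x) * g (L y)", symmetric]) measurable
    also have "\<dots> = (\<integral>\<^sup>+x. f (- x) \<partial>lborel) * g (L y)"
      by (simp add: nn_integral_multc)
    finally show "(\<integral>\<^sup>+x. f (L y - x) * g (L y) \<partial>lborel) = (\<integral>\<^sup>+x. f (- x) \<partial>lborel) * g (L y)" .
  qed
  also have "\<dots> = (\<integral>\<^sup>+x. f (- x) \<partial>lborel) * (\<integral>\<^sup>+y. g (L y) \<partial>lborel)"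
    by (rule nn_integral_cmult) measurable
  \<comment> \<open>The exchange leaves \<open>f\<close> reflected at the origin, and Lebesgue
    measure is invariant under reflection.\<close>
  also have "(\<integral>\<^sup>+x. f (- x) \<partial>lborel) = (\<integral>\<^sup>+x. f x \<partial>lborel)"
    by (subst (2) lborel_affine[of "-1" 0]) (simp_all add: nn_integral_density nn_integral_distr)
  finally show ?thesis by (simp add: mult.commute)
qed

text \<open>In the exchange identity take for \<open>g\<close> the indicator of the image of the
  unit cube. One integral of \<open>g\<close> then equals one, and the other is the constant
  \<open>D\<close>, the volume of that image.\<close>

lemma nn_integral_lborel_linear:
  fixes L :: "'a::euclidean_space \<Rightarrow> 'a"
  assumes L: "linear L" and M: "\<And>y. L (M y) = y"
  obtains D where "0 \<le> D"
    "\<And>f::'a \<Rightarrow> ennreal. f \<in> borel_measurable borel \<Longrightarrow> (\<integral>\<^sup>+x. f x \<partial>lborel) = ennreal D * (\<integral>\<^sup>+y. f (L y) \<partial>lborel)"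
proof -
  let ?B = "cbox 0 One :: 'a set"
  have cont: "continuous_on S L" for S
    using L by (intro linear_continuous_on linear_conv_bounded_linear[THEN iffD1])
  have comp: "compact (L ` ?B)" by (intro compact_continuous_image cont compact_cbox)
  have inj: "inj L"
    using L M by (metis linear_surj_imp_inj surjI)
  show thesis
  proof (rule that[of "measure lborel (L ` ?B)"])
    fix f :: "'a \<Rightarrow> ennreal" assume f: "f \<in> borel_measurable borel"
    have [measurable]: "L ` ?B \<in> sets borel" using comp by (simp add: borel_compact)
    have "indicator (L ` ?B) (L y) = (indicator ?B y :: ennreal)" for y
      using inj by (auto simp: indicator_def inj_image_mem_iff)
    then have "(\<integral>\<^sup>+y. indicator (L ` ?B) (L y) \<partial>lborel) = (1::ennreal)"
      by simp
    with nn_integral_linear_swap[OF L M f, of "indicator (L ` ?B)"]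
    have "(\<integral>\<^sup>+y. f (L y) \<partial>lborel) * emeasure lborel (L ` ?B) = (\<integral>\<^sup>+x. f x \<partial>lborel)"
      by simp
    moreover have "emeasure lborel (L ` ?B) = ennreal (measure lborel (L ` ?B))"
      using emeasure_compact_finite[OF comp] by (intro emeasure_eq_ennreal_measure) auto
    ultimately show "(\<integral>\<^sup>+x. f x \<partial>lborel) = ennreal (measure lborel (L ` ?B)) * (\<integral>\<^sup>+y. f (L y) \<partial>lborel)"
      by (simp add: mult.commute)
  qed simp
qed

section \<open>The divergence theorem in a half-space\<close>

lemma integrable_compact_support:
  fixes g :: "'a::euclidean_space \<Rightarrow> 'b::{banach, second_countable_topology}"
  assumes "continuous_on UNIV g" "compact K" "\<And>x. x \<notin> K \<Longrightarrow> g x = 0"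
  shows "integrable lborel g"
proof -
  have "integrable lborel (\<lambda>x. indicator K x *\<^sub>R g x)"
    using assms(1,2) continuous_on_subset by (intro borel_integrable_compact) auto
  also have "(\<lambda>x. indicator K x *\<^sub>R g x) = g"
    using assms(3) by (auto simp: indicator_def fun_eq_iff)
  finally show ?thesis .
qed

lemma integral_deriv_compact_support:
  fixes F f :: "real \<Rightarrow> real"
  assumes F: "\<And>t. (F has_real_derivative f t) (at t)" and f: "continuous_on UNIV f"
    and R: "\<And>t. R < \<bar>t\<bar> \<Longrightarrow> F t = 0" "\<And>t. R < \<bar>t\<bar> \<Longrightarrow> f t = 0"
  shows "(\<integral>t. indicator {..b} t * f t \<partial>lborel) = F b" "(\<integral>t. f t \<partial>lborel) = 0"
proof -
  have half: "(\<integral>t. indicator {..b} t * f t \<partial>lborel) = F b" for b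
  proof -
    \<comment> \<open>A point to the left of both \<open>b\<close> and the support, where
      \<open>F\<close> vanishes. The sign of \<open>R\<close> is unknown, hence the absolute
      value.\<close>
    define a where "a = min b (- \<bar>R\<bar> - 1)"
    have Rt: "R < \<bar>t\<bar>" if "t < a \<or> t = a" for t
      using that by (auto simp: a_def)
    have "indicator {..b} t * f t = indicator {a..b} t *\<^sub>R f t" for t
      using R(2)[OF Rt[of t]] by (auto simp: indicator_def)
    then have "(\<integral>t. indicator {..b} t * f t \<partial>lborel) = (\<integral>t. indicator {a..b} t *\<^sub>R f t \<partial>lborel)"
      by presburger
    also have "\<dots> = F b - F a"
    proof (rule integral_FTC_Icc)
      show "a \<le> b" by (simp add: a_def)
      show "(F has_vector_derivative f x) (at x within {a..b})" for x
        using F[of x] by (simp add: has_real_derivative_iff_has_vector_derivative has_vector_derivative_at_within)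
      show "continuous_on {a..b} f" using f continuous_on_subset by blast
    qed
    also have "F a = 0" using R(1)[OF Rt[of a]] by simp
    finally show ?thesis by simp
  qed
  show "(\<integral>t. indicator {..b} t * f t \<partial>lborel) = F b" by (rule half)
  have "indicator {..\<bar>R\<bar> + 1} t * f t = f t" for t
    using R(2)[of t] by (auto simp: indicator_def)
  with half[of "\<bar>R\<bar> + 1"] R(1)[of "\<bar>R\<bar> + 1"] show "(\<integral>t. f t \<partial>lborel) = 0"
    by simp
qed

context
  fixes \<psi> :: "real^'n::finite \<Rightarrow> real" and K :: "(real^'n) set"
  assumes smooth: "smooth \<psi>" and K: "compact K" "\<And>x. x \<notin> K \<Longrightarrow> \<psi> x = 0"
begin

lemma gradient_outside: "x \<notin> K \<Longrightarrow> gradient \<psi> x = 0"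
proof -
  assume x: "x \<notin> K"
  have "closure {x. \<psi> x \<noteq> 0} \<subseteq> K"
    using K compact_imp_closed by (intro closure_minimal) auto
  then have "partial i \<psi> x = 0" for i
    using x partial_outside_support[of x \<psi> i] by (meson subsetD)
  then show ?thesis by (simp add: vec_eq_iff)
qed

lemma line_derivative:
  shows "((\<lambda>t. \<psi> (x + t *\<^sub>R v)) has_real_derivative gradient \<psi> (x + t *\<^sub>R v) \<bullet> v) (at t)"
proof -
  have "((\<lambda>t. x + t *\<^sub>R v) has_derivative (\<lambda>h. h *\<^sub>R v)) (at t)"
    by (auto intro!: derivative_eq_intros)
  from has_derivative_compose[OF this has_derivative_gradient[OF smooth_differentiable[OF smooth]]]
  show ?thesis
    unfolding has_field_derivative_def by (rule has_derivative_eq_rhs) (simp add: fun_eq_iff)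
qed

lemma line_continuous: "continuous_on UNIV (\<lambda>t::real. gradient \<psi> (x + t *\<^sub>R v) \<bullet> v)"
  by (intro continuous_intros continuous_on_compose2[OF continuous_on_gradient[OF smooth, of UNIV]]) auto

lemma line_bounded:
  assumes "norm v = 1"
  obtains R where "\<And>t::real. R < \<bar>t\<bar> \<Longrightarrow> x + t *\<^sub>R v \<notin> K"
proof -
  obtain B where B: "\<And>y. y \<in> K \<Longrightarrow> norm y \<le> B"
    using compact_imp_bounded[OF K(1)] bounded_iff by blast
  show thesis
  proof (rule that[of "B + norm x"])
    fix t :: real assume t: "B + norm x < \<bar>t\<bar>"
    show "x + t *\<^sub>R v \<notin> K"
    proof
      assume "x + t *\<^sub>R v \<in> K"
      then have "norm (x + t *\<^sub>R v) \<le> B" by (rule B)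
      moreover have "norm (t *\<^sub>R v) \<le> norm (x + t *\<^sub>R v) + norm x"
        using norm_triangle_ineq4[of "x + t *\<^sub>R v" x] by simp
      ultimately show False using t assms by simp
    qed
  qed
qed

lemma integrable_gradient_inner: "integrable lborel (\<lambda>x. gradient \<psi> x \<bullet> v)"
  by (rule integrable_compact_support[OF _ K(1)])
     (auto simp: gradient_outside intro!: continuous_intros continuous_on_gradient smooth)

text \<open>The half-space is invariant under translations along \<open>v\<close>, so on each line
  in this direction its indicator is constant and the derivative of a compactly supported function
  integrates to zero. The slab identity collects the lines.\<close>

lemma integral_line_parallel:
  assumes v: "norm v = 1" and n: "v \<bullet> n = 0"
  shows "(\<integral>x. indicator {x. x \<bullet> n \<le> c} x * (gradient \<psi> x \<bullet> v) \<partial>lborel) = 0"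
proof -
  let ?h = "\<lambda>x. indicator {x. x \<bullet> n \<le> c} x * (gradient \<psi> x \<bullet> v)"
  have "integrable lborel ?h"
    using integrable_mult_indicator[OF _ integrable_gradient_inner[of v], of "{x. x \<bullet> n \<le> c}"]
    by simp
  from integral_slab[OF this v, of 0 1]
  have "(\<integral>x. ?h x \<partial>lborel) = (\<integral>x. indicator {x. 0 \<le> x \<bullet> v \<and> x \<bullet> v \<le> 1} x *
      (\<integral>t. ?h (x + t *\<^sub>R v) \<partial>lborel) \<partial>lborel)" by simp
  also have "(\<lambda>x. \<integral>t. ?h (x + t *\<^sub>R v) \<partial>lborel) = (\<lambda>x. 0)"
  proof
    fix x
    obtain R where R: "\<And>t::real. R < \<bar>t\<bar> \<Longrightarrow> x + t *\<^sub>R v \<notin> K"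
      using line_bounded[OF v] by blast
    have "(\<integral>t. gradient \<psi> (x + t *\<^sub>R v) \<bullet> v \<partial>lborel) = 0"
      by (rule integral_deriv_compact_support(2)[OF line_derivative line_continuous, of R])
         (use R K(2) gradient_outside in \<open>auto simp del: vec_lambda_unique\<close>)
    then show "(\<integral>t. ?h (x + t *\<^sub>R v) \<partial>lborel) = 0"
      using n by (simp add: inner_add_left indicator_def)
  qed
  finally show ?thesis by simp
qed

text \<open>On a normal line the half-space cuts off a half-line, and the fundamental theorem leaves
  the value of \<psi> at the foot point. Averaging over the slab of width one beyond the hyperplane
  gives the boundary integral in the prism form of \<open>facet_measure\<close>.\<close>

lemma integral_line_normal:
  assumes n: "norm n = 1"
  shows "(\<integral>x. indicator {x. x \<bullet> n \<le> c} x * (gradient \<psi> x \<bullet> n) \<partial>lborel)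
       = (\<integral>x. indicator {x. c \<le> x \<bullet> n \<and> x \<bullet> n \<le> c + 1} x * \<psi> (x - (x \<bullet> n - c) *\<^sub>R n) \<partial>lborel)"
proof -
  let ?h = "\<lambda>x. indicator {x. x \<bullet> n \<le> c} x * (gradient \<psi> x \<bullet> n)"
  have nn: "n \<bullet> n = 1" using n by (simp add: norm_eq_1)
  have "integrable lborel ?h"
    using integrable_mult_indicator[OF _ integrable_gradient_inner[of n], of "{x. x \<bullet> n \<le> c}"]
    by simp
  from integral_slab[OF this n, of c "c + 1"]
  have "(\<integral>x. ?h x \<partial>lborel) = (\<integral>x. indicator {x. c \<le> x \<bullet> n \<and> x \<bullet> n \<le> c + 1} x *
      (\<integral>t. ?h (x + t *\<^sub>R n) \<partial>lborel) \<partial>lborel)" by simp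
  also have "(\<lambda>x. \<integral>t. ?h (x + t *\<^sub>R n) \<partial>lborel) = (\<lambda>x. \<psi> (x - (x \<bullet> n - c) *\<^sub>R n))"
  proof
    fix x
    obtain R where R: "\<And>t::real. R < \<bar>t\<bar> \<Longrightarrow> x + t *\<^sub>R n \<notin> K"
      using line_bounded[OF n] by blast
    have "(\<integral>t. indicator {..c - x \<bullet> n} t * (gradient \<psi> (x + t *\<^sub>R n) \<bullet> n) \<partial>lborel) = \<psi> (x + (c - x \<bullet> n) *\<^sub>R n)"
      by (rule integral_deriv_compact_support(1)[OF line_derivative line_continuous, of R])
         (use R K(2) gradient_outside in \<open>auto simp del: vec_lambda_unique\<close>)
    moreover have "(\<integral>t. ?h (x + t *\<^sub>R n) \<partial>lborel)
        = (\<integral>t. indicator {..c - x \<bullet> n} t * (gradient \<psi> (x + t *\<^sub>R n) \<bullet> n) \<partial>lborel)"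
      by (rule Bochner_Integration.integral_cong) (auto simp: inner_add_left nn indicator_def)
    ultimately have "(\<integral>t. ?h (x + t *\<^sub>R n) \<partial>lborel) = \<psi> (x + (c - x \<bullet> n) *\<^sub>R n)"
      by (simp only:)
    also have "x + (c - x \<bullet> n) *\<^sub>R n = x - (x \<bullet> n - c) *\<^sub>R n" by (simp add: algebra_simps)
    finally show "(\<integral>t. ?h (x + t *\<^sub>R n) \<partial>lborel) = \<psi> (x - (x \<bullet> n - c) *\<^sub>R n)" .
  qed
  finally show ?thesis .
qed

text \<open>The tangential part of \<open>v\<close> contributes nothing, the normal part gives the
  boundary integral. The tangential part is normalised first because the line argument works with
  unit vectors.\<close>

lemma integral_halfspace_gradient:
  assumes n: "norm n = 1"
  shows "(\<integral>x. indicator {x. x \<bullet> n \<le> c} x * (gradient \<psi> x \<bullet> v) \<partial>lborel)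
       = (n \<bullet> v) * (\<integral>x. indicator {x. c \<le> x \<bullet> n \<and> x \<bullet> n \<le> c + 1} x * \<psi> (x - (x \<bullet> n - c) *\<^sub>R n) \<partial>lborel)"
proof -
  define w where "w = v - (n \<bullet> v) *\<^sub>R n"
  have wn: "w \<bullet> n = 0" using n by (simp add: w_def inner_diff_left norm_eq_1 inner_commute[of v n])
  have tan: "(\<integral>x. indicator {x. x \<bullet> n \<le> c} x * (gradient \<psi> x \<bullet> w) \<partial>lborel) = 0"
  proof (cases "w = 0")
    case False
    have "(\<integral>x. indicator {x. x \<bullet> n \<le> c} x * (gradient \<psi> x \<bullet> (w /\<^sub>R norm w)) \<partial>lborel) = 0"
      by (rule integral_line_parallel) (use False wn in auto)
    then have "(\<integral>x. inverse (norm w) * (indicator {x. x \<bullet> n \<le> c} x * (gradient \<psi> x \<bullet> w)) \<partial>lborel) = 0"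
      by (simp add: mult.left_commute)
    then show ?thesis using False by simp
  qed simp
  have int: "integrable lborel (\<lambda>x. indicator {x. x \<bullet> n \<le> c} x * (gradient \<psi> x \<bullet> u))" for u
    using integrable_mult_indicator[OF _ integrable_gradient_inner[of u], of "{x. x \<bullet> n \<le> c}"]
    by simp
  have "indicator {x. x \<bullet> n \<le> c} x * (gradient \<psi> x \<bullet> v) =
     indicator {x. x \<bullet> n \<le> c} x * (gradient \<psi> x \<bullet> w) + (n \<bullet> v) * (indicator {x. x \<bullet> n \<le> c} x * (gradient \<psi> x \<bullet> n))" for x
    by (simp add: w_def inner_diff_right algebra_simps)
  then have "(\<integral>x. indicator {x. x \<bullet> n \<le> c} x * (gradient \<psi> x \<bullet> v) \<partial>lborel) =
    (\<integral>x. indicator {x. x \<bullet> n \<le> c} x * (gradient \<psi> x \<bullet> w) + (n \<bullet> v) * (indicator {x. x \<bullet> n \<le> c} x * (gradient \<psi> x \<bullet> n)) \<partial>lborel)"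
    by presburger
  also have "\<dots> = (n \<bullet> v) * (\<integral>x. indicator {x. x \<bullet> n \<le> c} x * (gradient \<psi> x \<bullet> n) \<partial>lborel)"
    using tan int by simp
  finally show ?thesis by (simp only: integral_line_normal[OF n])
qed

lemma integral_partial_eq_0: "(\<integral>x. partial i \<psi> x \<partial>lborel) = 0"
proof -
  \<comment> \<open>The zero vector in the role of the normal turns the half-space into the whole
    space.\<close>
  have "(\<integral>x. partial i \<psi> x \<partial>lborel) = (\<integral>x. indicator {x::real^'n. x \<bullet> 0 \<le> 0} x * (gradient \<psi> x \<bullet> axis i 1) \<partial>lborel)"
    by (simp add: inner_axis)
  also have "\<dots> = 0" by (rule integral_line_parallel) auto
  finally show ?thesis .
qed

end

section \<open>Square-integrable functions, test functions and weak derivatives\<close>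

section \<open>Square-integrable functions\<close>

lemma L2_measurable: "f \<in> L2 U \<Longrightarrow> f \<in> borel_measurable (lebesgue_on U)"
  by (simp add: L2_def)

lemma L2_integrable: "f \<in> L2 U \<Longrightarrow> integrable (lebesgue_on U) (\<lambda>x. (norm (f x))\<^sup>2)"
  by (simp add: L2_def)

lemma L2I_bound:
  assumes f: "f \<in> borel_measurable (lebesgue_on U)" and g: "integrable (lebesgue_on U) g"
    and le: "\<And>x. (norm (f x))\<^sup>2 \<le> g x"
  shows "f \<in> L2 U"
proof -
  have "integrable (lebesgue_on U) (\<lambda>x. (norm (f x))\<^sup>2)"
  proof (rule Bochner_Integration.integrable_bound[OF g])
    show "(\<lambda>x. (norm (f x))\<^sup>2) \<in> borel_measurable (lebesgue_on U)" using f by measurable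
    show "AE x in lebesgue_on U. norm ((norm (f x))\<^sup>2) \<le> norm (g x)"
      using le by (intro AE_I2) (smt (verit, best) real_norm_def zero_le_power2)
  qed
  with f show ?thesis by (simp add: L2_def)
qed

lemma L2_inner_integrable:
  assumes f: "f \<in> L2 U" and g: "g \<in> L2 U"
  shows "integrable (lebesgue_on U) (\<lambda>x. f x \<bullet> g x)"
proof (rule Bochner_Integration.integrable_bound)
  show "integrable (lebesgue_on U) (\<lambda>x. (norm (f x))\<^sup>2 + (norm (g x))\<^sup>2)"
    using f g by (simp add: L2_def)
  show "(\<lambda>x. f x \<bullet> g x) \<in> borel_measurable (lebesgue_on U)"
    using L2_measurable[OF f] L2_measurable[OF g] by measurable
  have "\<bar>a \<bullet> b\<bar> \<le> (norm a)\<^sup>2 + (norm b)\<^sup>2" for a b :: 'b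
  proof -
    have "\<bar>a \<bullet> b\<bar> \<le> norm a * norm b" by (rule Cauchy_Schwarz_ineq2)
    also have "\<dots> \<le> (norm a)\<^sup>2 + (norm b)\<^sup>2"
      using sum_squares_bound[of "norm a" "norm b"] zero_le_power2[of "norm a"] zero_le_power2[of "norm b"]
        norm_ge_zero[of a] norm_ge_zero[of b] mult_nonneg_nonneg[of "norm a" "norm b"] by linarith
    finally show ?thesis .
  qed
  then show "AE x in lebesgue_on U. norm (f x \<bullet> g x) \<le> norm ((norm (f x))\<^sup>2 + (norm (g x))\<^sup>2)"
    by (intro AE_I2) (simp add: add_nonneg_nonneg)
qed

lemma L2_add:
  assumes f: "f \<in> L2 U" and g: "g \<in> L2 U"
  shows "(\<lambda>x. f x + g x) \<in> L2 U"
proof (rule L2I_bound)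
  show "(\<lambda>x. f x + g x) \<in> borel_measurable (lebesgue_on U)"
    using L2_measurable[OF f] L2_measurable[OF g] by measurable
  show "integrable (lebesgue_on U) (\<lambda>x. 2 * (norm (f x))\<^sup>2 + 2 * (norm (g x))\<^sup>2)"
    using f g by (simp add: L2_def)
  fix x
  have "(norm (f x + g x))\<^sup>2 \<le> (norm (f x) + norm (g x))\<^sup>2"
    by (intro power_mono norm_triangle_ineq) simp
  also have "\<dots> \<le> 2 * (norm (f x))\<^sup>2 + 2 * (norm (g x))\<^sup>2"
    using sum_squares_bound[of "norm (f x)" "norm (g x)"] by (simp add: power2_sum)
  finally show "(norm (f x + g x))\<^sup>2 \<le> 2 * (norm (f x))\<^sup>2 + 2 * (norm (g x))\<^sup>2" .
qed

lemma L2_scaleR: "f \<in> L2 U \<Longrightarrow> (\<lambda>x. c *\<^sub>R f x) \<in> L2 U"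
  by (auto simp: L2_def power_mult_distrib)

lemma L2_diff: "f \<in> L2 U \<Longrightarrow> g \<in> L2 U \<Longrightarrow> (\<lambda>x. f x - g x) \<in> L2 U"
  using L2_add[of f U "\<lambda>x. (-1) *\<^sub>R g x"] L2_scaleR[of g U "-1"] by simp

lemma L2_inner_const:
  assumes "f \<in> L2 U" shows "(\<lambda>x. f x \<bullet> b) \<in> L2 U"
proof (rule L2I_bound)
  show "(\<lambda>x. f x \<bullet> b) \<in> borel_measurable (lebesgue_on U)" using L2_measurable[OF assms] by measurable
  show "integrable (lebesgue_on U) (\<lambda>x. (norm b)\<^sup>2 * (norm (f x))\<^sup>2)" using assms by (simp add: L2_def)
  show "(norm (f x \<bullet> b))\<^sup>2 \<le> (norm b)\<^sup>2 * (norm (f x))\<^sup>2" for x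
    using power_mono[OF Cauchy_Schwarz_ineq2[of "f x" b], of 2] by (simp add: power_mult_distrib mult.commute)
qed

lemma L2_subset:
  assumes f: "f \<in> L2 U" and sub: "V \<subseteq> U" and U: "U \<in> sets lebesgue" and V: "V \<in> sets lebesgue"
  shows "f \<in> L2 V"
proof -
  have "f \<in> borel_measurable (lebesgue_on V)"
    using measurable_restrict_mono[OF L2_measurable[OF f] sub] .
  moreover have "integrable (lebesgue_on V) (\<lambda>x. (norm (f x))\<^sup>2)"
  proof -
    have "integrable lebesgue (\<lambda>x. indicator U x *\<^sub>R (norm (f x))\<^sup>2)"
      using L2_integrable[OF f] U by (subst (asm) integrable_restrict_space) auto
    then have "integrable lebesgue (\<lambda>x. indicator V x *\<^sub>R indicator U x *\<^sub>R (norm (f x))\<^sup>2)"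
      by (rule integrable_mult_indicator[OF V])
    also have "(\<lambda>x. indicator V x *\<^sub>R indicator U x *\<^sub>R (norm (f x))\<^sup>2) = (\<lambda>x. indicator V x *\<^sub>R (norm (f x))\<^sup>2)"
      using sub by (auto simp: indicator_def fun_eq_iff)
    finally show ?thesis
      using V by (subst integrable_restrict_space) auto
  qed
  ultimately show ?thesis by (simp add: L2_def)
qed

lemma finite_measure_lebesgue_on:
  assumes "U \<in> sets lebesgue" "bounded U" shows "finite_measure (lebesgue_on U)"
proof (rule finite_measureI)
  have "emeasure (lebesgue_on U) (space (lebesgue_on U)) = emeasure lebesgue U"
    using assms(1) by (simp add: space_restrict_space emeasure_restrict_space)
  also have "\<dots> < \<infinity>"
    using fmeasurableD2[OF bounded_set_imp_lmeasurable[OF assms(2,1)]] by (simp add: top.not_eq_extremum)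
  finally show "emeasure (lebesgue_on U) (space (lebesgue_on U)) \<noteq> \<infinity>" by simp
qed

lemma L2_bounded:
  assumes "f \<in> borel_measurable (lebesgue_on U)" "U \<in> sets lebesgue" "bounded U"
    and B: "\<And>x. x \<in> U \<Longrightarrow> norm (f x) \<le> B"
  shows "f \<in> L2 U"
proof -
  interpret finite_measure "lebesgue_on U" using assms finite_measure_lebesgue_on by blast
  have "integrable (lebesgue_on U) (\<lambda>x. (norm (f x))\<^sup>2)"
  proof (rule integrable_const_bound[where B = "B\<^sup>2"])
    show "AE x in lebesgue_on U. norm ((norm (f x))\<^sup>2) \<le> B\<^sup>2"
      using power_mono[OF B, of _ 2] by (intro AE_I2) (simp add: space_restrict_space)
    show "(\<lambda>x. (norm (f x))\<^sup>2) \<in> borel_measurable (lebesgue_on U)" using assms(1) by measurable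
  qed
  with assms show ?thesis by (simp add: L2_def)
qed

lemma borel_measurable_lebesgue_on_continuous:
  "continuous_on UNIV f \<Longrightarrow> f \<in> borel_measurable (lebesgue_on U)"
  by (intro measurable_restrict_space1 measurable_completion)
     (simp add: borel_measurable_continuous_onI)

lemma L2_continuous:
  fixes f :: "'a::euclidean_space \<Rightarrow> 'b::euclidean_space"
  assumes f: "continuous_on UNIV f" and U: "U \<in> sets lebesgue" "bounded U"
  shows "f \<in> L2 U"
proof -
  have "compact (f ` closure U)"
    by (rule compact_continuous_image[OF continuous_on_subset[OF f subset_UNIV]])
       (simp only: compact_closure U)
  from compact_imp_bounded[OF this] obtain B where B: "\<And>y. y \<in> f ` closure U \<Longrightarrow> norm y \<le> B"
    unfolding bounded_iff by metis
  show ?thesis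
  proof (rule L2_bounded[OF borel_measurable_lebesgue_on_continuous[OF f] U])
    fix x assume "x \<in> U"
    then have "x \<in> closure U" by (rule subsetD[OF closure_subset])
    then show "norm (f x) \<le> B" by (intro B imageI)
  qed
qed

lemma l2_inner_diff_left:
  "f \<in> L2 U \<Longrightarrow> g \<in> L2 U \<Longrightarrow> h \<in> L2 U \<Longrightarrow> l2_inner U (\<lambda>x. f x - g x) h = l2_inner U f h - l2_inner U g h"
  by (simp add: l2_inner_def inner_diff_left L2_inner_integrable)

lemma l2_norm_nonneg: "0 \<le> l2_norm U f"
  by (simp add: l2_norm_def l2_inner_def)

text \<open>On functions, as opposed to classes, \<open>l2_inner\<close> is only semidefinite. The
  discriminant argument therefore treats the case c = 0 separately.\<close>

lemma l2_Cauchy_Schwarz: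
  assumes f: "f \<in> L2 U" and g: "g \<in> L2 U"
  shows "\<bar>l2_inner U f g\<bar> \<le> l2_norm U f * l2_norm U g"
proof -
  define a b c where "a = l2_inner U f f" and "b = l2_inner U f g" and "c = l2_inner U g g"
  have quad: "0 \<le> a + 2 * t * b + t\<^sup>2 * c" for t
  proof -
    have "0 \<le> (LINT x|lebesgue_on U. (f x + t *\<^sub>R g x) \<bullet> (f x + t *\<^sub>R g x))"
      by (simp add: Bochner_Integration.integral_nonneg)
    also have "\<dots> = (LINT x|lebesgue_on U. f x \<bullet> f x + (2 * t) * (f x \<bullet> g x) + t\<^sup>2 * (g x \<bullet> g x))"
      by (rule Bochner_Integration.integral_cong)
         (auto simp: inner_add_left inner_add_right inner_commute power2_eq_square algebra_simps)
    also have "\<dots> = a + 2 * t * b + t\<^sup>2 * c"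
      using L2_inner_integrable[OF f f] L2_inner_integrable[OF f g] L2_inner_integrable[OF g g]
      by (simp add: a_def b_def c_def l2_inner_def)
    finally show ?thesis .
  qed
  have nonneg: "0 \<le> a" "0 \<le> c" by (simp_all add: a_def c_def l2_inner_def)
  have "b\<^sup>2 \<le> a * c"
  proof (cases "c = 0")
    case True
    have "b = 0"
    proof (rule ccontr)
      assume "b \<noteq> 0"
      \<comment> \<open>At this value of t the quadratic, now affine in t, equals -1.\<close>
      then have "2 * (- (a + 1) / (2 * b)) * b = - (a + 1)" by (simp add: field_simps)
      with quad[of "- (a + 1) / (2 * b)"] True show False by (simp only: mult_zero_right)
    qed
    with True show ?thesis by simp
  next
    case False
    with nonneg quad[of "- b / c"] have "0 \<le> (a - b\<^sup>2 / c) * c"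
      by (simp add: power2_eq_square)
    with False show ?thesis by (simp add: algebra_simps)
  qed
  then have "sqrt (b\<^sup>2) \<le> sqrt (a * c)" by (rule real_sqrt_le_mono)
  then show ?thesis by (simp add: l2_norm_def real_sqrt_mult a_def b_def c_def)
qed

lemma l2_inner_cong_AE:
  assumes "AE x in lebesgue_on U. f x \<bullet> g x = f' x \<bullet> g' x"
    and "f \<in> borel_measurable (lebesgue_on U)" "g \<in> borel_measurable (lebesgue_on U)"
    and "f' \<in> borel_measurable (lebesgue_on U)" "g' \<in> borel_measurable (lebesgue_on U)"
  shows "l2_inner U f g = l2_inner U f' g'"
  unfolding l2_inner_def using assms by (intro integral_cong_AE) auto

lemma l2_inner_cong:
  "(\<And>x. x \<in> U \<Longrightarrow> f x \<bullet> g x = f' x \<bullet> g' x) \<Longrightarrow> l2_inner U f g = l2_inner U f' g'"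
  unfolding l2_inner_def by (rule Bochner_Integration.integral_cong) (auto simp: space_restrict_space)

lemma integral_lebesgue_on:
  fixes h :: "'a::euclidean_space \<Rightarrow> real"
  assumes "U \<in> sets lebesgue"
  shows "integral\<^sup>L (lebesgue_on U) h = (LINT x|lebesgue. indicator U x * h x)"
  using assms by (subst integral_restrict_space) auto

lemma l2_inner_eq_lborel:
  fixes f g :: "'a::euclidean_space \<Rightarrow> 'b::euclidean_space"
  assumes U: "U \<in> sets lebesgue" and "(\<lambda>x. f x \<bullet> g x) \<in> borel_measurable borel"
    and "\<And>x. x \<notin> U \<Longrightarrow> f x \<bullet> g x = 0"
  shows "l2_inner U f g = (\<integral>x. f x \<bullet> g x \<partial>lborel)"
proof -
  have "l2_inner U f g = (LINT x|lebesgue. f x \<bullet> g x)"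
    unfolding l2_inner_def integral_lebesgue_on[OF U]
    by (rule Bochner_Integration.integral_cong) (use assms in \<open>auto simp: indicator_def\<close>)
  also have "\<dots> = (\<integral>x. f x \<bullet> g x \<partial>lborel)"
    using assms by (intro integral_completion) simp
  finally show ?thesis .
qed

section \<open>Test functions and weak derivatives\<close>

lemma test_functions_smooth: "\<phi> \<in> test_functions U \<Longrightarrow> smooth \<phi>"
  by (simp add: test_functions_def smooth_def)

lemma test_functionsI:
  assumes "smooth \<phi>" "compact K" "K \<subseteq> U" "\<And>x. x \<notin> K \<Longrightarrow> \<phi> x = 0"
  shows "\<phi> \<in> test_functions U"
proof -
  have "closure {x. \<phi> x \<noteq> 0} \<subseteq> K"
    using assms compact_imp_closed by (intro closure_minimal) auto
  moreover have "compact (closure {x. \<phi> x \<noteq> 0})"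
    using calculation assms(2) bounded_subset compact_imp_bounded compact_eq_bounded_closed closed_closure by metis
  ultimately show ?thesis
    using assms by (simp add: test_functions_def smooth_def)
qed

lemma test_functions_support:
  assumes "\<phi> \<in> test_functions U"
  obtains K where "compact K" "K \<subseteq> U" "\<And>x. x \<notin> K \<Longrightarrow> \<phi> x = 0"
proof
  show "compact (closure {x. \<phi> x \<noteq> 0})" "closure {x. \<phi> x \<noteq> 0} \<subseteq> U"
    using assms by (simp_all add: test_functions_def)
qed (rule outside_closure_support)

lemma test_functions_mono: "U \<subseteq> V \<Longrightarrow> test_functions U \<subseteq> test_functions V"
  unfolding test_functions_def by (intro subsetI) (simp, meson order_trans)

lemma test_functions_outside:
  assumes "\<phi> \<in> test_functions U" "x \<notin> U"
  shows "\<phi> x = 0" "gradient \<phi> x = 0" "partial i \<phi> x = 0"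
proof -
  obtain K where K: "compact K" "K \<subseteq> U" "\<And>x. x \<notin> K \<Longrightarrow> \<phi> x = 0"
    using test_functions_support assms by blast
  show "\<phi> x = 0" using K assms by blast
  show g: "gradient \<phi> x = 0"
    using gradient_outside[OF test_functions_smooth[OF assms(1)] K(1) K(3), of x] K(2) assms(2) by blast
  show "partial i \<phi> x = 0"
    using arg_cong[OF g, of "\<lambda>v. v $ i"] by simp
qed

lemma integral_by_parts:
  assumes f: "smooth f" and \<phi>: "\<phi> \<in> test_functions U"
  shows "(\<integral>x. f x * partial i \<phi> x \<partial>lborel) = - (\<integral>x. partial i f x * \<phi> x \<partial>lborel)"
proof -
  obtain K where K: "compact K" "K \<subseteq> U" "\<And>x. x \<notin> K \<Longrightarrow> \<phi> x = 0"
    using test_functions_support \<phi> by blast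
  note s = f test_functions_smooth[OF \<phi>]
  have zero: "x \<notin> K \<Longrightarrow> partial i \<phi> x = 0" for x
    using gradient_outside[OF s(2) K(1) K(3), of x] by (simp add: vec_eq_iff)
  have int: "integrable lborel (\<lambda>x. f x * partial i \<phi> x)" "integrable lborel (\<lambda>x. partial i f x * \<phi> x)"
    by (rule integrable_compact_support[OF _ K(1)];
        use s K(3) zero in \<open>auto intro!: continuous_intros smooth_continuous smooth_mult smooth_partial\<close>)+
  have "0 = (\<integral>x. partial i (\<lambda>x. f x * \<phi> x) x \<partial>lborel)"
    by (rule integral_partial_eq_0[symmetric, OF smooth_mult[OF s] K(1)]) (simp add: K(3))
  also have "\<dots> = (\<integral>x. partial i f x * \<phi> x + f x * partial i \<phi> x \<partial>lborel)"
    using s by (simp add: partial_mult smooth_differentiable)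
  finally show ?thesis using int by simp
qed

definition divergence :: "(real^'n::finite \<Rightarrow> real^'n) \<Rightarrow> real^'n \<Rightarrow> real" where
  "divergence \<tau> x = (\<Sum>i\<in>UNIV. partial i (\<lambda>x. \<tau> x $ i) x)"

lemma continuous_on_divergence: "(\<And>i. smooth (\<lambda>x. \<tau> x $ i)) \<Longrightarrow> continuous_on S (divergence \<tau>)"
  unfolding divergence_def by (intro continuous_intros continuous_on_partial)

lemma continuous_on_smooth_vec: "(\<And>i. smooth (\<lambda>x. \<tau> x $ i)) \<Longrightarrow> continuous_on S \<tau>"
  using continuous_on_vec_lambda[of S "\<lambda>i x. \<tau> x $ i", OF smooth_continuous] by simp

lemma has_weak_gradient_smooth:
  assumes f: "smooth f" and U: "U \<in> sets lebesgue"
  shows "has_weak_gradient f (gradient f) U"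
  unfolding has_weak_gradient_def
proof (intro ballI allI)
  fix \<phi> i assume \<phi>: "\<phi> \<in> test_functions U"
  note s = f test_functions_smooth[OF \<phi>]
  have "l2_inner U f (partial i \<phi>) = (\<integral>x. f x * partial i \<phi> x \<partial>lborel)"
    using s test_functions_outside(3)[OF \<phi>, of _ i]
    by (subst l2_inner_eq_lborel[OF U])
       (auto intro!: borel_measurable_continuous_onI continuous_intros smooth_continuous smooth_mult smooth_partial)
  also have "\<dots> = - (\<integral>x. partial i f x * \<phi> x \<partial>lborel)"
    by (rule integral_by_parts[OF f \<phi>])
  also have "(\<integral>x. partial i f x * \<phi> x \<partial>lborel) = l2_inner U (\<lambda>x. gradient f x $ i) \<phi>"
    using s test_functions_outside(1)[OF \<phi>]
    by (subst l2_inner_eq_lborel[OF U])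
       (auto intro!: borel_measurable_continuous_onI continuous_intros smooth_continuous smooth_mult smooth_partial)
  finally show "l2_inner U f (partial i \<phi>) = - l2_inner U (\<lambda>x. gradient f x $ i) \<phi>" .
qed

lemma has_weak_divergence_smooth:
  assumes \<tau>: "\<And>i. smooth (\<lambda>x. \<tau> x $ i)" and U: "U \<in> sets lebesgue"
  shows "has_weak_divergence \<tau> (divergence \<tau>) U"
  unfolding has_weak_divergence_def
proof (intro ballI)
  fix \<phi> assume \<phi>: "\<phi> \<in> test_functions U"
  note s = \<tau> test_functions_smooth[OF \<phi>]
  obtain K where K: "compact K" "K \<subseteq> U" "\<And>x. x \<notin> K \<Longrightarrow> \<phi> x = 0"
    using test_functions_support \<phi> by blast
  have zero: "x \<notin> K \<Longrightarrow> partial i \<phi> x = 0" for x i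
    using gradient_outside[OF s(2) K(1) K(3), of x] by (simp add: vec_eq_iff)
  have int: "integrable lborel (\<lambda>x. \<tau> x $ i * partial i \<phi> x)"
       "integrable lborel (\<lambda>x. partial i (\<lambda>x. \<tau> x $ i) x * \<phi> x)" for i
    by (rule integrable_compact_support[OF _ K(1)];
        use s K(3) zero in \<open>auto intro!: continuous_intros smooth_continuous smooth_mult smooth_partial\<close>)+
  have "l2_inner U \<tau> (gradient \<phi>) = (\<integral>x. \<tau> x \<bullet> gradient \<phi> x \<partial>lborel)"
    using s test_functions_outside(2)[OF \<phi>]
    by (intro l2_inner_eq_lborel[OF U])
       (auto intro!: borel_measurable_continuous_onI continuous_intros continuous_on_partial smooth_partial continuous_on_smooth_vec)
  also have "\<dots> = (\<Sum>i\<in>UNIV. \<integral>x. \<tau> x $ i * partial i \<phi> x \<partial>lborel)"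
    using int by (simp add: inner_vec_def)
  also have "\<dots> = - (\<Sum>i\<in>UNIV. \<integral>x. partial i (\<lambda>x. \<tau> x $ i) x * \<phi> x \<partial>lborel)"
    by (simp add: integral_by_parts[OF \<tau> \<phi>] sum_negf)
  also have "(\<Sum>i\<in>UNIV. \<integral>x. partial i (\<lambda>x. \<tau> x $ i) x * \<phi> x \<partial>lborel) = (\<integral>x. divergence \<tau> x * \<phi> x \<partial>lborel)"
    using int by (simp add: divergence_def sum_distrib_right)
  also have "\<dots> = l2_inner U (divergence \<tau>) \<phi>"
    using test_functions_outside(1)[OF \<phi>]
      continuous_on_mult[OF continuous_on_divergence smooth_continuous, OF s, of UNIV]
    by (subst l2_inner_eq_lborel[OF U]) (auto intro: borel_measurable_continuous_onI)
  finally show "l2_inner U \<tau> (gradient \<phi>) = - l2_inner U (divergence \<tau>) \<phi>" .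
qed

lemma has_weak_divergence_cong:
  assumes "\<And>x. x \<in> U \<Longrightarrow> \<tau> x = \<tau>' x"
  shows "has_weak_divergence \<tau> g U = has_weak_divergence \<tau>' g U"
proof -
  have "l2_inner U \<tau> h = l2_inner U \<tau>' h" for h
    by (rule l2_inner_cong) (simp add: assms)
  then show ?thesis by (simp add: has_weak_divergence_def)
qed

section \<open>Uniqueness of weak derivatives\<close>

lemma box_bump_test_function:
  fixes a b :: "real^'n::finite"
  assumes "cbox a b \<subseteq> U" "0 < m"
  shows "(\<lambda>x. \<Prod>i\<in>UNIV. bump (m * (x $ i - a $ i)) * bump (m * (b $ i - x $ i))) \<in> test_functions U"
    (is "?\<psi> \<in> _")
proof (rule test_functionsI)
  have eq: "?\<psi> = (\<lambda>x. \<Prod>i\<in>UNIV. bump (axis i m \<bullet> x + (- m * a $ i)) * bump (axis i (- m) \<bullet> x + m * b $ i))"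
    by (simp add: fun_eq_iff inner_axis' algebra_simps)
  show "smooth ?\<psi>"
    unfolding eq by (intro smooth_prod smooth_mult smooth_bump_affine)
  show "compact (cbox a b)" "cbox a b \<subseteq> U" using assms by auto
  fix x assume "x \<notin> cbox a b"
  then obtain i where "x $ i < a $ i \<or> b $ i < x $ i" by (auto simp: mem_box_cart not_le)
  then have "bump (m * (x $ i - a $ i)) * bump (m * (b $ i - x $ i)) = 0"
    using assms(2) by (auto simp: bump_eq zero_less_mult_iff)
  then show "?\<psi> x = 0" by (intro prod_zero) auto
qed

text \<open>As m grows, bump (m s) tends to one for s > 0 and is zero otherwise, so the products of
  \<open>box_bump_test_function\<close> converge to the indicator of the open box. They lie between
  0 and 1, hence dominated convergence applies; \<open>Suc m\<close> keeps the scaling factor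
  positive.\<close>

lemma integral_cbox_eq_0:
  fixes g :: "real^'n::finite \<Rightarrow> real"
  assumes G: "integrable lebesgue (\<lambda>x. indicator U x * g x)" and U: "U \<in> sets lebesgue"
    and 0: "\<And>\<phi>. \<phi> \<in> test_functions U \<Longrightarrow> l2_inner U g \<phi> = 0" and ab: "cbox a b \<subseteq> U"
  shows "integral (cbox a b) (\<lambda>x. indicator U x * g x) = 0"
proof -
  define G where "G = (\<lambda>x. indicator U x * g x)"
  define \<psi> :: "nat \<Rightarrow> real^'n \<Rightarrow> real" where "\<psi> m x = (\<Prod>i\<in>UNIV. bump (real (Suc m) * (x $ i - a $ i)) * bump (real (Suc m) * (b $ i - x $ i)))" for m x
  have \<psi>: "\<psi> m \<in> test_functions U" for m
    using box_bump_test_function[OF ab, of "real (Suc m)"] by (simp add: \<psi>_def[abs_def])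
  have Gm [measurable]: "G \<in> borel_measurable lebesgue" using G by (simp add: G_def)
  have \<psi>m [measurable]: "\<psi> m \<in> borel_measurable lebesgue" for m
    using smooth_continuous[OF test_functions_smooth[OF \<psi>[of m]], of UNIV]
    by (intro measurable_completion) (simp add: borel_measurable_continuous_onI)
  have bnd: "0 \<le> \<psi> m x \<and> \<psi> m x \<le> 1" for m x
    unfolding \<psi>_def by (auto intro!: prod_nonneg prod_le_1 mult_nonneg_nonneg mult_le_one bump_bounds)
  have lim: "(\<lambda>m. G x * \<psi> m x) \<longlonglongrightarrow> G x * indicator (box a b) x" for x
  proof -
    have one: "(\<lambda>m. bump (real (Suc m) * s)) \<longlonglongrightarrow> (if s > 0 then 1 else 0)" for s
    proof (cases "s > 0")
      case True
      have "(\<lambda>m. inverse s * inverse (real (Suc m))) \<longlonglongrightarrow> inverse s * 0"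
        by (intro tendsto_intros LIMSEQ_inverse_real_of_nat)
      then have "(\<lambda>m. exp (- (inverse s * inverse (real (Suc m))))) \<longlonglongrightarrow> exp (- (inverse s * 0))"
        by (rule tendsto_exp[OF tendsto_minus])
      moreover have "bump (real (Suc m) * s) = exp (- (inverse s * inverse (real (Suc m))))" for m
        using True by (simp add: bump_eq divide_inverse mult.commute)
      ultimately show ?thesis using True by (simp del: of_nat_Suc)
    next
      case False
      then have "bump (real (Suc m) * s) = 0" for m
        by (simp add: bump_eq zero_less_mult_iff del: of_nat_Suc)
      with False show ?thesis by simp
    qed
    have "(\<lambda>m. \<psi> m x) \<longlonglongrightarrow> (\<Prod>i\<in>UNIV. (if x $ i - a $ i > 0 then 1 else 0) * (if b $ i - x $ i > 0 then 1 else 0))"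
      unfolding \<psi>_def by (intro tendsto_intros one)
    also have "(\<Prod>i\<in>UNIV. (if x $ i - a $ i > 0 then 1 else 0) * (if b $ i - x $ i > 0 then 1 else 0)) = (indicator (box a b) x :: real)"
      by (auto simp: indicator_def mem_box_cart intro!: prod_zero prod.neutral)
    finally show ?thesis by (intro tendsto_intros)
  qed
  have "(\<lambda>m. LINT x|lebesgue. G x * \<psi> m x) \<longlonglongrightarrow> (LINT x|lebesgue. G x * indicator (box a b) x)"
  proof (rule integral_dominated_convergence[where w = "\<lambda>x. \<bar>G x\<bar>"])
    show "integrable lebesgue (\<lambda>x. \<bar>G x\<bar>)" using G by (simp add: G_def)
    show "AE x in lebesgue. (\<lambda>m. G x * \<psi> m x) \<longlonglongrightarrow> G x * indicator (box a b) x"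
      using lim by simp
    show "AE x in lebesgue. norm (G x * \<psi> m x) \<le> \<bar>G x\<bar>" for m
      using bnd[of m] by (intro AE_I2) (simp add: abs_mult mult_left_le)
    show "(\<lambda>x. G x * indicator (box a b) x) \<in> borel_measurable lebesgue"
      by (intro borel_measurable_times borel_measurable_indicator Gm) auto
    show "(\<lambda>x. G x * \<psi> m x) \<in> borel_measurable lebesgue" for m
      by (intro borel_measurable_times Gm \<psi>m)
  qed
  moreover have "(LINT x|lebesgue. G x * \<psi> m x) = 0" for m
  proof -
    have "(LINT x|lebesgue. G x * \<psi> m x) = l2_inner U g (\<psi> m)"
      unfolding l2_inner_def integral_lebesgue_on[OF U] by (simp add: G_def mult.assoc)
    then show ?thesis using 0[OF \<psi>] by simp
  qed
  ultimately have "(LINT x|lebesgue. G x * indicator (box a b) x) = 0"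
    by (simp add: LIMSEQ_const_iff)
  moreover have "integrable lebesgue (\<lambda>x. indicator (box a b) x *\<^sub>R G x)"
    using G by (intro integrable_mult_indicator) (auto simp: G_def)
  then have "integral (box a b) G = (LINT x|lebesgue. indicator (box a b) x *\<^sub>R G x)"
    using set_lebesgue_integral_eq_integral(2)[of "box a b" G]
    by (simp add: set_integrable_def set_lebesgue_integral_def)
  ultimately have "integral (box a b) G = 0" by (simp add: mult.commute)
  then show ?thesis by (simp add: integral_open_interval G_def)
qed

text \<open>The fundamental lemma of the calculus of variations: integrals over boxes inside
  \<open>U\<close> vanish, and by Lebesgue differentiation almost every value of \<open>g\<close> is
  a limit of averages over cubes with a corner at the point.\<close>

lemma test_functions_separate:
  fixes g :: "real^'n::finite \<Rightarrow> real"
  assumes g: "g \<in> L2 U" and U: "open U" "bounded U"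
    and 0: "\<And>\<phi>. \<phi> \<in> test_functions U \<Longrightarrow> l2_inner U g \<phi> = 0"
  shows "AE x in lebesgue_on U. g x = 0"
proof -
  have Us: "U \<in> sets lebesgue" using U by simp
  define G where "G = (\<lambda>x. indicator U x * g x)"
  have "(\<lambda>x. 1::real) \<in> L2 U" using U by (intro L2_continuous) auto
  from L2_inner_integrable[OF g this] have "integrable (lebesgue_on U) g" by simp
  then have G: "integrable lebesgue G"
    using Us by (subst (asm) integrable_restrict_space) (auto simp: G_def)
  then have "G integrable_on cbox a b" for a b
    using integrable_on_lebesgue[of G] integrable_on_subcbox by blast
  then obtain N where N: "negligible N"
    "\<And>x e. \<lbrakk>x \<notin> N; 0 < e\<rbrakk> \<Longrightarrow> \<exists>d>0. \<forall>h. 0 < h \<and> h < d \<longrightarrow>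
        norm (integral (cbox x (x + h *\<^sub>R One)) G /\<^sub>R h ^ DIM(real^'n) - G x) < e"
    using integrable_ccontinuous_explicit by metis
  have zero: "g x = 0" if x: "x \<in> U" "x \<notin> N" for x
  proof (rule ccontr)
    assume "g x \<noteq> 0"
    with x have "0 < \<bar>G x\<bar>" by (simp add: G_def)
    with N(2)[OF x(2)] obtain d where d: "d > 0" "\<And>h. 0 < h \<Longrightarrow> h < d \<Longrightarrow>
        norm (integral (cbox x (x + h *\<^sub>R One)) G /\<^sub>R h ^ DIM(real^'n) - G x) < \<bar>G x\<bar>" by metis
    from U(1) x(1) obtain e where e: "e > 0" "cball x e \<subseteq> U" by (auto simp: open_contains_cball)
    \<comment> \<open>Below the threshold \<open>d\<close> of the differentiation theorem, and so
      small that the cube fits into the ball of radius \<open>e\<close>: the l1 norm bounds the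
      distance from its corner by h times the dimension.\<close>
    define h where "h = min (d / 2) (e / real CARD('n))"
    have h: "0 < h" "h < d" "h * real CARD('n) \<le> e"
      using d e by (auto simp: h_def min_def field_simps)
    have "cbox x (x + h *\<^sub>R One) \<subseteq> cball x e"
    proof
      fix y assume y: "y \<in> cbox x (x + h *\<^sub>R One)"
      have "\<bar>(y - x) $ i\<bar> \<le> h" for i
      proof -
        have "x $ i \<le> y $ i \<and> y $ i \<le> x $ i + h * (One :: real^'n) $ i"
          using y by (simp add: mem_box_cart)
        moreover have "(One :: real^'n) $ i = 1"
          using inner_sum_left_Basis[of "axis i 1" "\<lambda>_. 1"] by (simp add: cart_eq_inner_axis)
        ultimately show ?thesis by simp
      qed
      then have "(\<Sum>i\<in>UNIV. \<bar>(y - x) $ i\<bar>) \<le> h * real CARD('n)"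
        using sum_bounded_above[of "UNIV :: 'n set" "\<lambda>i. \<bar>(y - x) $ i\<bar>" h] by (simp add: mult.commute)
      then show "y \<in> cball x e"
        using norm_le_l1_cart[of "y - x"] h by (simp add: dist_norm norm_minus_commute)
    qed
    with e have "integral (cbox x (x + h *\<^sub>R One)) G = 0"
      unfolding G_def using G 0 Us by (intro integral_cbox_eq_0) (auto simp: G_def)
    with d(2)[OF h(1,2)] show False by simp
  qed
  have "AE x in lebesgue. x \<notin> N"
    using N(1) AE_not_in[of N lebesgue] by (simp add: negligible_iff_null_sets)
  then show ?thesis
    using zero Us by (subst AE_restrict_space_iff) auto
qed

lemma test_functions_L2:
  assumes "\<phi> \<in> test_functions V" "U \<in> sets lebesgue" "bounded U"
  shows "\<phi> \<in> L2 U" "partial i \<phi> \<in> L2 U" "gradient \<phi> \<in> L2 U"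
  using smooth_continuous continuous_on_partial continuous_on_gradient test_functions_smooth[OF assms(1)]
  by (blast intro: L2_continuous assms)+

lemma L2_component:
  fixes g :: "'a::euclidean_space \<Rightarrow> real^'n::finite"
  shows "g \<in> L2 U \<Longrightarrow> (\<lambda>x. g x $ i) \<in> L2 U"
  using L2_inner_const[of g U "axis i 1"] by (simp add: inner_axis)

lemma weak_gradient_unique:
  assumes U: "open U" "bounded U" and g: "g \<in> L2 U" "has_weak_gradient v g U"
    and h: "h \<in> L2 U" "has_weak_gradient v h U"
  shows "AE x in lebesgue_on U. g x = h x"
proof -
  have "AE x in lebesgue_on U. g x $ i - h x $ i = 0" for i
  proof (rule test_functions_separate[OF _ U])
    show "(\<lambda>x. g x $ i - h x $ i) \<in> L2 U" by (intro L2_diff L2_component g h)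
    fix \<phi> assume \<phi>: "\<phi> \<in> test_functions U"
    have "\<phi> \<in> L2 U" using test_functions_L2(1)[OF \<phi>] U by auto
    then have "l2_inner U (\<lambda>x. g x $ i - h x $ i) \<phi> = l2_inner U (\<lambda>x. g x $ i) \<phi> - l2_inner U (\<lambda>x. h x $ i) \<phi>"
      by (intro l2_inner_diff_left L2_component g h)
    then show "l2_inner U (\<lambda>x. g x $ i - h x $ i) \<phi> = 0"
      using g(2) h(2) \<phi> unfolding has_weak_gradient_def by force
  qed
  then have "AE x in lebesgue_on U. \<forall>i\<in>UNIV. g x $ i - h x $ i = 0"
    by (intro AE_finite_allI) auto
  then show ?thesis by eventually_elim (simp add: vec_eq_iff)
qed

lemma weak_divergence_unique:
  assumes U: "open U" "bounded U" and g: "g \<in> L2 U" "has_weak_divergence \<tau> g U"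
    and h: "h \<in> L2 U" "has_weak_divergence \<tau> h U"
  shows "AE x in lebesgue_on U. g x = h x"
proof -
  have "AE x in lebesgue_on U. g x - h x = 0"
  proof (rule test_functions_separate[OF _ U])
    show "(\<lambda>x. g x - h x) \<in> L2 U" by (intro L2_diff g h)
    fix \<phi> assume \<phi>: "\<phi> \<in> test_functions U"
    have "\<phi> \<in> L2 U" using test_functions_L2(1)[OF \<phi>] U by auto
    then have "l2_inner U (\<lambda>x. g x - h x) \<phi> = l2_inner U g \<phi> - l2_inner U h \<phi>"
      by (intro l2_inner_diff_left g h)
    then show "l2_inner U (\<lambda>x. g x - h x) \<phi> = 0"
      using g(2) h(2) \<phi> unfolding has_weak_divergence_def by force
  qed
  then show ?thesis by eventually_elim simp
qed

lemma weak_grad_AE: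
  assumes U: "open U" "bounded U" and g: "g \<in> L2 U" "has_weak_gradient v g U"
  shows "weak_grad U v \<in> L2 U" "AE x in lebesgue_on U. weak_grad U v x = g x"
proof -
  have *: "weak_grad U v \<in> L2 U \<and> has_weak_gradient v (weak_grad U v) U"
    unfolding weak_grad_def by (rule someI[of _ g]) (simp add: g)
  then show "weak_grad U v \<in> L2 U" by blast
  show "AE x in lebesgue_on U. weak_grad U v x = g x"
    using * g by (intro weak_gradient_unique[OF U]) auto
qed

lemma weak_div_in_Hdiv:
  assumes "\<tau> \<in> Hdiv U"
  shows "weak_div U \<tau> \<in> L2 U" "has_weak_divergence \<tau> (weak_div U \<tau>) U"
proof -
  obtain g where g: "g \<in> L2 U" "has_weak_divergence \<tau> g U" using assms by (auto simp: Hdiv_def)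
  have "weak_div U \<tau> \<in> L2 U \<and> has_weak_divergence \<tau> (weak_div U \<tau>) U"
    unfolding weak_div_def by (rule someI[of _ g]) (simp add: g)
  then show "weak_div U \<tau> \<in> L2 U" "has_weak_divergence \<tau> (weak_div U \<tau>) U" by auto
qed

text \<open>Two functions appear because a glued piecewise function agrees with the smooth formula
  of an element only inside that element.\<close>

lemma weak_div_smooth:
  assumes U: "open U" "bounded U" and s: "\<And>i. smooth (\<lambda>x. \<tau> x $ i)"
    and eq: "\<And>x. x \<in> U \<Longrightarrow> \<tau>' x = \<tau> x"
  shows "weak_div U \<tau>' \<in> L2 U" "AE x in lebesgue_on U. weak_div U \<tau>' x = divergence \<tau> x"
proof -
  have g: "divergence \<tau> \<in> L2 U"
    using U s by (intro L2_continuous continuous_on_divergence) auto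
  have w: "has_weak_divergence \<tau>' (divergence \<tau>) U"
    using has_weak_divergence_smooth[OF s, of U] U has_weak_divergence_cong[OF eq] by simp
  have *: "weak_div U \<tau>' \<in> L2 U \<and> has_weak_divergence \<tau>' (weak_div U \<tau>') U"
    unfolding weak_div_def by (rule someI[of _ "divergence \<tau>"]) (simp add: g w)
  then show "weak_div U \<tau>' \<in> L2 U" by blast
  show "AE x in lebesgue_on U. weak_div U \<tau>' x = divergence \<tau> x"
    using * g w by (intro weak_divergence_unique[OF U]) auto
qed

lemma weak_grad_test_function:
  assumes U: "open U" "bounded U" and \<phi>: "\<phi> \<in> test_functions U"
  shows "weak_grad U \<phi> \<in> L2 U" "AE x in lebesgue_on U. weak_grad U \<phi> x = gradient \<phi> x"
proof -
  have "U \<in> sets lebesgue" using U by simp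
  note g = test_functions_L2(3)[OF \<phi> this U(2)] has_weak_gradient_smooth[OF test_functions_smooth[OF \<phi>] this]
  show "weak_grad U \<phi> \<in> L2 U" "AE x in lebesgue_on U. weak_grad U \<phi> x = gradient \<phi> x"
    by (rule weak_grad_AE[OF U g])+
qed

lemma test_functions_subset_H10:
  assumes U: "open U" "bounded U"
  shows "test_functions U \<subseteq> H10 U"
proof
  fix \<phi> assume \<phi>: "\<phi> \<in> test_functions U"
  have "\<phi> \<in> H1 U"
  proof -
    have "U \<in> sets lebesgue" using U by simp
    then show ?thesis
      unfolding H1_def using has_weak_gradient_smooth[OF test_functions_smooth[OF \<phi>]] test_functions_L2(1,3)[OF \<phi>] U
      by blast
  qed
  \<comment> \<open>The approximating test function is \<phi> itself. The difference is zero, but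
    \<open>weak_grad\<close> of zero is a chosen representative and vanishes only almost
    everywhere.\<close>
  moreover have "h1_norm U (\<lambda>x. \<phi> x - \<phi> x) = 0"
  proof -
    have z: "(\<lambda>x. 0) \<in> test_functions U"
      by (rule test_functionsI[where K = "{}"]) (auto simp: smooth_const)
    have "AE x in lebesgue_on U. weak_grad U (\<lambda>x. 0) x = 0"
      using weak_grad_test_function(2)[OF U z] has_derivative_const
      by (auto simp: vec_eq_iff partial_eq[OF has_derivative_const])
    then have "l2_inner U (weak_grad U (\<lambda>x. 0)) (weak_grad U (\<lambda>x. 0)) = l2_inner U (\<lambda>x. 0 :: real^'a) (\<lambda>x. 0)"
      using L2_measurable[OF weak_grad_test_function(1)[OF U z]]
      by (intro l2_inner_cong_AE) auto
    then show ?thesis by (simp add: h1_norm_def l2_norm_def l2_inner_def)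
  qed
  ultimately show "\<phi> \<in> H10 U"
    using \<phi> unfolding H10_def by force
qed

section \<open>Geometry of simplices, facets and meshes\<close>

section \<open>Barycentric coordinates and facets\<close>

lemma simplex_vertices:
  fixes T :: "(real^'n::finite) set"
  assumes "int CARD('n) simplex T"
  shows "\<not> affine_dependent (vertices T)" "card (vertices T) = CARD('n) + 1"
    "finite (vertices T)" "T = convex hull (vertices T)"
proof -
  obtain C where C: "\<not> affine_dependent C" "int (card C) = int CARD('n) + 1" "T = convex hull C"
    using assms unfolding simplex_def by blast
  then have V: "vertices T = C"
    by (auto simp: vertices_def extreme_point_of_convex_hull_affine_independent)
  show "\<not> affine_dependent (vertices T)" "T = convex hull (vertices T)" using C V by auto
  show "card (vertices T) = CARD('n) + 1" using C(2) V by simp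
  show "finite (vertices T)" using C V aff_independent_finite by auto
qed

definition bary_grad :: "(real^'n::finite) set \<Rightarrow> real^'n \<Rightarrow> real^'n" where
  "bary_grad T z = (\<chi> i. bary T z (axis i 1) - bary T z 0)"

context
  fixes T :: "(real^'n::finite) set"
  assumes T: "int CARD('n) simplex T"
begin

text \<open>Two coefficient families with sum one and the same barycentre would differ by an affine
  dependence of the vertices.\<close>

lemma bary_eqI:
  assumes "sum u (vertices T) = 1" "(\<Sum>v\<in>vertices T. u v *\<^sub>R v) = x" "z \<in> vertices T"
  shows "bary T z x = u z"
  unfolding bary_def
proof (rule the_equality)
  show "\<exists>u'. sum u' (vertices T) = 1 \<and> (\<Sum>v\<in>vertices T. u' v *\<^sub>R v) = x \<and> u z = u' z"
    using assms by blast
  fix c assume "\<exists>u. sum u (vertices T) = 1 \<and> (\<Sum>v\<in>vertices T. u v *\<^sub>R v) = x \<and> c = u z"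
  then obtain u' where u': "sum u' (vertices T) = 1" "(\<Sum>v\<in>vertices T. u' v *\<^sub>R v) = x" "c = u' z"
    by blast
  show "c = u z"
  proof (rule ccontr)
    assume "c \<noteq> u z"
    then have "\<exists>v\<in>vertices T. u' v - u v \<noteq> 0" using assms u' by auto
    moreover have "(\<Sum>v\<in>vertices T. u' v - u v) = 0" using assms u' by (simp add: sum_subtractf)
    moreover have "(\<Sum>v\<in>vertices T. (u' v - u v) *\<^sub>R v) = 0"
      using assms u' by (simp add: scaleR_left_diff_distrib sum_subtractf)
    ultimately have "affine_dependent (vertices T)"
      unfolding affine_dependent_explicit_finite[OF simplex_vertices(3)[OF T]] by blast
    with simplex_vertices(1)[OF T] show False by blast
  qed
qed

lemma bary_sum: "(\<Sum>v\<in>vertices T. bary T v x) = 1" "(\<Sum>v\<in>vertices T. bary T v x *\<^sub>R v) = x"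
proof -
  have "affine hull (vertices T) = UNIV"
    using simplex_vertices[OF T] by (intro affine_independent_span_eq) auto
  then obtain u where u: "sum u (vertices T) = 1" "(\<Sum>v\<in>vertices T. u v *\<^sub>R v) = x"
    using affine_hull_finite[OF simplex_vertices(3)[OF T]] by blast
  then have "bary T v x = u v" if "v \<in> vertices T" for v
    using bary_eqI that by blast
  with u show "(\<Sum>v\<in>vertices T. bary T v x) = 1" "(\<Sum>v\<in>vertices T. bary T v x *\<^sub>R v) = x"
    by simp_all
qed

lemma bary_vertex: "z \<in> vertices T \<Longrightarrow> v \<in> vertices T \<Longrightarrow> bary T z v = (if z = v then 1 else 0)"
proof -
  assume z: "z \<in> vertices T" and v: "v \<in> vertices T"
  have "(\<Sum>w\<in>vertices T. (if w = v then 1 else 0) *\<^sub>R w) = (\<Sum>w\<in>vertices T. if w = v then w else 0)"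
    by (rule sum.cong) auto
  then show ?thesis
    using z v simplex_vertices(3)[OF T] by (intro bary_eqI[where u = "\<lambda>w. if w = v then 1 else 0"]) auto
qed

text \<open>Uniqueness of the coordinates does the work: affine combinations of the coordinates of
  two points have the right sum and the right barycentre, so they are the coordinates of the
  combined point.\<close>

lemma bary_affine:
  assumes z: "z \<in> vertices T"
  shows "bary T z x = bary_grad T z \<bullet> x + bary T z 0"
proof -
  define L where "L x = bary T z x - bary T z 0" for x
  have "linear L"
  proof (rule linearI)
    fix x y
    have "bary T z (x + y) = bary T z x + bary T z y - bary T z 0"
      by (rule bary_eqI[OF _ _ z])
         (simp_all add: sum_subtractf sum.distrib bary_sum scaleR_left_diff_distrib scaleR_left_distrib)
    then show "L (x + y) = L x + L y" by (simp add: L_def)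
  next
    fix c x
    have "bary T z (c *\<^sub>R x) = c * bary T z x + (1 - c) * bary T z 0"
    proof (rule bary_eqI[OF _ _ z])
      show "(\<Sum>v\<in>vertices T. c * bary T v x + (1 - c) * bary T v 0) = 1"
        by (simp add: sum.distrib sum_distrib_left[symmetric] bary_sum)
      have "(\<Sum>v\<in>vertices T. (c * bary T v x + (1 - c) * bary T v 0) *\<^sub>R v)
        = c *\<^sub>R (\<Sum>v\<in>vertices T. bary T v x *\<^sub>R v) + (1 - c) *\<^sub>R (\<Sum>v\<in>vertices T. bary T v 0 *\<^sub>R v)"
        by (simp add: scaleR_left_distrib sum.distrib scaleR_sum_right)
      also have "\<dots> = c *\<^sub>R x" by (simp only: bary_sum) simp
      finally show "(\<Sum>v\<in>vertices T. (c * bary T v x + (1 - c) * bary T v 0) *\<^sub>R v) = c *\<^sub>R x" .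
    qed
    then show "L (c *\<^sub>R x) = c *\<^sub>R L x" by (simp add: L_def algebra_simps)
  qed
  then interpret linear L .
  have "L x = L (\<Sum>i\<in>UNIV. x $ i *\<^sub>R axis i 1)"
    by (rule arg_cong[OF basis_expansion[of x, unfolded scalar_mult_eq_scaleR, symmetric]])
  also have "\<dots> = (\<Sum>i\<in>UNIV. x $ i * L (axis i 1))"
    by (simp only: sum scaleR real_scaleR_def)
  also have "\<dots> = bary_grad T z \<bullet> x"
    by (simp add: inner_vec_def bary_grad_def L_def mult.commute)
  finally show ?thesis by (simp add: L_def)
qed

lemma bary_diff: "z \<in> vertices T \<Longrightarrow> bary T z x - bary T z y = bary_grad T z \<bullet> (x - y)"
  using bary_affine[of z x] bary_affine[of z y] by (simp add: inner_diff_right)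

lemma mem_simplex_iff: "x \<in> T \<longleftrightarrow> (\<forall>z\<in>vertices T. 0 \<le> bary T z x)"
proof
  assume "x \<in> T"
  then have "x \<in> convex hull (vertices T)" by (subst (asm) simplex_vertices(4)[OF T])
  then obtain u where u: "\<forall>v\<in>vertices T. 0 \<le> u v" "sum u (vertices T) = 1" "(\<Sum>v\<in>vertices T. u v *\<^sub>R v) = x"
    unfolding convex_hull_finite[OF simplex_vertices(3)[OF T]] mem_Collect_eq by metis
  then show "\<forall>z\<in>vertices T. 0 \<le> bary T z x" using bary_eqI[OF u(2,3)] by simp
next
  assume "\<forall>z\<in>vertices T. 0 \<le> bary T z x"
  then have "x \<in> convex hull (vertices T)"
    unfolding convex_hull_finite[OF simplex_vertices(3)[OF T]]
    by (intro CollectI exI[of _ "\<lambda>v. bary T v x"] conjI bary_sum)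
  then show "x \<in> T" by (subst simplex_vertices(4)[OF T])
qed

lemma mem_interior_simplex_iff: "x \<in> interior T \<longleftrightarrow> (\<forall>z\<in>vertices T. 0 < bary T z x)"
proof -
  have "interior T = {y. \<exists>u. (\<forall>x\<in>vertices T. 0 < u x) \<and> sum u (vertices T) = 1 \<and> (\<Sum>x\<in>vertices T. u x *\<^sub>R x) = y}"
    by (subst simplex_vertices(4)[OF T]) (simp add: interior_convex_hull_explicit_minimal[OF simplex_vertices(1)[OF T]] simplex_vertices(2)[OF T])
  then have "x \<in> interior T \<longleftrightarrow> (\<exists>u. (\<forall>v\<in>vertices T. 0 < u v) \<and> sum u (vertices T) = 1 \<and> (\<Sum>v\<in>vertices T. u v *\<^sub>R v) = x)"
    by simp
  also have "\<dots> \<longleftrightarrow> (\<forall>z\<in>vertices T. 0 < bary T z x)"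
  proof
    assume "\<exists>u. (\<forall>v\<in>vertices T. 0 < u v) \<and> sum u (vertices T) = 1 \<and> (\<Sum>v\<in>vertices T. u v *\<^sub>R v) = x"
    then obtain u where u: "\<forall>v\<in>vertices T. 0 < u v" "sum u (vertices T) = 1" "(\<Sum>v\<in>vertices T. u v *\<^sub>R v) = x"
      by blast
    then show "\<forall>z\<in>vertices T. 0 < bary T z x" using bary_eqI[OF u(2,3)] by simp
  next
    assume "\<forall>z\<in>vertices T. 0 < bary T z x"
    then show "\<exists>u. (\<forall>v\<in>vertices T. 0 < u v) \<and> sum u (vertices T) = 1 \<and> (\<Sum>v\<in>vertices T. u v *\<^sub>R v) = x"
      using bary_sum[of x] by (intro exI[of _ "\<lambda>v. bary T v x"]) simp
  qed
  finally show ?thesis .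
qed

lemma compact_simplex: "compact T" and convex_simplex: "convex T"
  by (subst simplex_vertices(4)[OF T], simp add: finite_imp_compact_convex_hull simplex_vertices(3)[OF T] convex_convex_hull)+

lemma bary_le_1: "x \<in> T \<Longrightarrow> z \<in> vertices T \<Longrightarrow> bary T z x \<le> 1"
  using bary_sum(1)[of x] mem_simplex_iff[of x] simplex_vertices(3)[OF T] member_le_sum[of z "vertices T" "\<lambda>v. bary T v x"]
  by auto

lemma vertices_subset: "vertices T \<subseteq> T"
  unfolding vertices_def extreme_point_of_def by auto

lemma facets_iff: "F \<in> facets T \<longleftrightarrow> (\<exists>z\<in>vertices T. F = convex hull (vertices T - {z}))"
proof -
  \<comment> \<open>A facet has to be nonempty, which holds because a simplex of positive dimension
    has at least two vertices.\<close>
  have "vertices T - {z} \<noteq> {}" for z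
  proof
    assume "vertices T - {z} = {}"
    then have "vertices T \<subseteq> {z}" by blast
    then have "card (vertices T) \<le> 1" using card_mono[of "{z}" "vertices T"] by simp
    then show False using simplex_vertices(2)[OF T] zero_less_card_finite[where 'a='n] by linarith
  qed
  then have "{} \<noteq> convex hull (vertices T - {z})" for z
    by (metis convex_hull_eq_empty)
  then show ?thesis
    using facet_of_convex_hull_affine_independent[OF simplex_vertices(1)[OF T], of F]
    unfolding facets_def simplex_vertices(4)[OF T, symmetric] by auto
qed

end

context
  fixes T F :: "(real^'n::finite) set"
  assumes T: "int CARD('n) simplex T" and F: "F \<in> facets T"
begin

lemma facet_opp_vertex:
  "opp_vertex T F \<in> vertices T" "F = convex hull (vertices T - {opp_vertex T F})" "vertices F = vertices T - {opp_vertex T F}"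
proof -
  obtain z where z: "z \<in> vertices T" "F = convex hull (vertices T - {z})"
    using F facets_iff[OF T] by blast
  have ind: "\<not> affine_dependent (vertices T - {z})"
    using simplex_vertices(1)[OF T] affine_independent_subset by blast
  have "z \<notin> F"
  proof
    assume "z \<in> F"
    moreover have "F \<subseteq> T" using F unfolding facets_def by (simp add: facet_of_imp_subset)
    ultimately have "z extreme_point_of F"
      using z(1) unfolding vertices_def extreme_point_of_def by blast
    then show False using extreme_point_of_convex_hull_affine_independent[OF ind, of z] z(2) by simp
  qed
  moreover have "v \<in> F" if "v \<in> vertices T" "v \<noteq> z" for v
    unfolding z(2) by (rule hull_inc) (use that in simp)
  ultimately have "opp_vertex T F = z"
    unfolding opp_vertex_def using z(1) by (intro the_equality) blast+
  with z show "opp_vertex T F \<in> vertices T" "F = convex hull (vertices T - {opp_vertex T F})" by simp_all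
  show "vertices F = vertices T - {opp_vertex T F}"
    unfolding vertices_def[of F] using z(2) extreme_point_of_convex_hull_affine_independent[OF ind] \<open>opp_vertex T F = z\<close>
    by auto
qed

lemma sum_vertices_facet:
  fixes f :: "real^'n \<Rightarrow> 'b::comm_monoid_add"
  shows "sum f (vertices T) = f (opp_vertex T F) + sum f (vertices T - {opp_vertex T F})"
  using simplex_vertices(3)[OF T] facet_opp_vertex(1) by (rule sum.remove)

lemma affine_hull_facet: "x \<in> affine hull F \<longleftrightarrow> bary T (opp_vertex T F) x = 0"
proof -
  have fin: "finite (vertices T - {opp_vertex T F})" using simplex_vertices(3)[OF T] by simp
  have eq: "affine hull F = affine hull (vertices T - {opp_vertex T F})"
    by (subst facet_opp_vertex(2)) (simp add: affine_hull_convex_hull)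
  show ?thesis
  proof
    assume "x \<in> affine hull F"
    then have "\<exists>u. sum u (vertices T - {opp_vertex T F}) = 1 \<and> (\<Sum>v\<in>vertices T - {opp_vertex T F}. u v *\<^sub>R v) = x"
      unfolding eq affine_hull_finite[OF fin] mem_Collect_eq .
    then obtain u where u: "sum u (vertices T - {opp_vertex T F}) = 1 \<and> (\<Sum>v\<in>vertices T - {opp_vertex T F}. u v *\<^sub>R v) = x" ..
    define u' where "u' v = (if v = opp_vertex T F then 0 else u v)" for v
    have "sum u' (vertices T) = sum u (vertices T - {opp_vertex T F})"
      unfolding sum_vertices_facet by (simp add: u'_def)
    moreover have "(\<Sum>v\<in>vertices T. u' v *\<^sub>R v) = (\<Sum>v\<in>vertices T - {opp_vertex T F}. u v *\<^sub>R v)"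
      unfolding sum_vertices_facet by (simp add: u'_def)
    ultimately have "bary T (opp_vertex T F) x = u' (opp_vertex T F)"
      using u facet_opp_vertex(1) bary_eqI[OF T, of u' x "opp_vertex T F"] by simp
    then show "bary T (opp_vertex T F) x = 0" by (simp add: u'_def)
  next
    assume 0: "bary T (opp_vertex T F) x = 0"
    have "(\<Sum>v\<in>vertices T - {opp_vertex T F}. bary T v x) = 1" "(\<Sum>v\<in>vertices T - {opp_vertex T F}. bary T v x *\<^sub>R v) = x"
      using bary_sum(1)[OF T, of x, unfolded sum_vertices_facet] bary_sum(2)[OF T, of x, unfolded sum_vertices_facet]
      by (simp_all only: 0 add_0 scaleR_zero_left)
    then show "x \<in> affine hull F"
      unfolding eq affine_hull_finite[OF fin] by (intro CollectI exI[of _ "\<lambda>v. bary T v x"] conjI)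
  qed
qed

lemma mem_facet_iff: "x \<in> F \<longleftrightarrow> x \<in> T \<and> bary T (opp_vertex T F) x = 0"
proof
  assume x: "x \<in> F"
  have "F \<subseteq> T" using F unfolding facets_def by (simp add: facet_of_imp_subset)
  then show "x \<in> T \<and> bary T (opp_vertex T F) x = 0" using x affine_hull_facet[of x] hull_inc[OF x, of affine] by auto
next
  assume x: "x \<in> T \<and> bary T (opp_vertex T F) x = 0"
  have fin: "finite (vertices T - {opp_vertex T F})" using simplex_vertices(3)[OF T] by simp
  have "(\<Sum>v\<in>vertices T - {opp_vertex T F}. bary T v x) = 1" "(\<Sum>v\<in>vertices T - {opp_vertex T F}. bary T v x *\<^sub>R v) = x"
    using bary_sum(1)[OF T, of x, unfolded sum_vertices_facet] bary_sum(2)[OF T, of x, unfolded sum_vertices_facet]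
    by (simp_all only: conjunct2[OF x] add_0 scaleR_zero_left)
  moreover have "\<forall>v\<in>vertices T - {opp_vertex T F}. 0 \<le> bary T v x" using x mem_simplex_iff[OF T, of x] by simp
  ultimately have "x \<in> convex hull (vertices T - {opp_vertex T F})"
    unfolding convex_hull_finite[OF fin] by (intro CollectI exI[of _ "\<lambda>v. bary T v x"] conjI)
  then show "x \<in> F" by (subst facet_opp_vertex(2))
qed

lemma vertices_facet_nonempty: "vertices F \<noteq> {}"
proof
  assume "vertices F = {}"
  then have "F = {}" using facet_opp_vertex(2,3) convex_hull_empty by metis
  then show False using F by (simp add: facets_def facet_of_def)
qed

lemma bary_grad_opp_nonzero: "bary_grad T (opp_vertex T F) \<noteq> 0"
proof
  assume 0: "bary_grad T (opp_vertex T F) = 0"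
  obtain v where v: "v \<in> vertices T" "v \<noteq> (opp_vertex T F)"
    using vertices_facet_nonempty facet_opp_vertex(3) by blast
  have "bary T (opp_vertex T F) (opp_vertex T F) - bary T (opp_vertex T F) v = 0"
    using bary_diff[OF T facet_opp_vertex(1), of "opp_vertex T F" v] 0 by simp
  then show False using bary_vertex[OF T] v facet_opp_vertex(1) by simp
qed

text \<open>The coordinate of the opposite vertex vanishes on \<open>F\<close> and is nonnegative on
  \<open>T\<close>, so its gradient points inwards. Conversely a competing normal is orthogonal to
  the edges of \<open>F\<close>, which leaves only multiples of this gradient; sign and length are
  then forced.\<close>

lemma exterior_normal_eq: "exterior_normal T F = - (bary_grad T (opp_vertex T F) /\<^sub>R norm (bary_grad T (opp_vertex T F)))"
  unfolding exterior_normal_def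
proof (rule the_equality)
  let ?g = "bary_grad T (opp_vertex T F)"
  have "(y - x) \<bullet> (- (?g /\<^sub>R norm ?g)) \<le> 0" if "x \<in> F" "y \<in> T" for x y
  proof -
    have "bary T (opp_vertex T F) y - bary T (opp_vertex T F) x = ?g \<bullet> (y - x)" by (rule bary_diff[OF T facet_opp_vertex(1)])
    moreover have "bary T (opp_vertex T F) y \<ge> 0" using that mem_simplex_iff[OF T, of y] facet_opp_vertex(1) by simp
    moreover have "bary T (opp_vertex T F) x = 0" using that mem_facet_iff[of x] by simp
    ultimately have "0 \<le> ?g \<bullet> (y - x)" by simp
    then show ?thesis by (simp add: inner_commute)
  qed
  then show "norm (- (?g /\<^sub>R norm ?g)) = 1 \<and> (\<forall>x\<in>F. \<forall>y\<in>T. (y - x) \<bullet> (- (?g /\<^sub>R norm ?g)) \<le> 0)"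
    using bary_grad_opp_nonzero by simp
  fix \<nu> assume \<nu>: "norm \<nu> = 1 \<and> (\<forall>x\<in>F. \<forall>y\<in>T. (y - x) \<bullet> \<nu> \<le> 0)"
  obtain v0 where v0: "v0 \<in> vertices F" using vertices_facet_nonempty by blast
  then have v0T: "v0 \<in> vertices T" "v0 \<noteq> (opp_vertex T F)" using facet_opp_vertex(3) by auto
  have VF: "v \<in> F" if "v \<in> vertices F" for v
    using that by (auto simp: vertices_def extreme_point_of_def)
  have VT: "v \<in> T" if "v \<in> vertices T" for v
    using that vertices_subset[OF T] by blast
  \<comment> \<open>The coordinate grows by one from \<open>v0\<close> to the opposite vertex, so
    subtracting \<open>s\<close> times its gradient makes \<open>d\<close> orthogonal to that edge
    as well as to the edges within \<open>F\<close>.\<close>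
  define s where "s = \<nu> \<bullet> (opp_vertex T F - v0)"
  define d where "d = \<nu> - s *\<^sub>R ?g"
  have d0: "(v - v0) \<bullet> d = 0" if v: "v \<in> vertices T" for v
  proof (cases "v = opp_vertex T F")
    case True
    have "?g \<bullet> (opp_vertex T F - v0) = 1"
      using bary_diff[OF T facet_opp_vertex(1), of "opp_vertex T F" v0] bary_vertex[OF T] v0T facet_opp_vertex(1) by simp
    then show ?thesis using True by (simp add: d_def s_def inner_diff_right inner_commute)
  next
    case False
    then have vF: "v \<in> vertices F" using v facet_opp_vertex(3) by blast
    have "?g \<bullet> (v - v0) = 0"
      using bary_diff[OF T facet_opp_vertex(1), of v v0] bary_vertex[OF T] v0T facet_opp_vertex(1) v False by simp
    moreover have "(v - v0) \<bullet> \<nu> \<le> 0" "(v0 - v) \<bullet> \<nu> \<le> 0"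
      using \<nu> VF[OF vF] VF[OF v0] VT[OF v] VT[OF v0T(1)] by blast+
    ultimately show ?thesis by (simp add: d_def inner_diff_right inner_diff_left inner_commute)
  qed
  have "(x - v0) \<bullet> d = 0" for x
  proof -
    have "x - v0 = (\<Sum>v\<in>vertices T. bary T v x *\<^sub>R v) - (\<Sum>v\<in>vertices T. bary T v x) *\<^sub>R v0"
      by (simp only: bary_sum[OF T]) simp
    also have "\<dots> = (\<Sum>v\<in>vertices T. bary T v x *\<^sub>R (v - v0))"
      by (simp add: scaleR_left.sum sum_subtractf scaleR_diff_right)
    finally have eq: "x - v0 = (\<Sum>v\<in>vertices T. bary T v x *\<^sub>R (v - v0))" .
    show ?thesis
      by (subst eq) (simp add: inner_sum_left d0)
  qed
  \<comment> \<open>The vertices span the whole space affinely, so \<open>d\<close> is orthogonal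
    even to itself.\<close>
  from this[of "v0 + d"] have "d = 0" by simp
  then have \<nu>s: "\<nu> = s *\<^sub>R ?g" by (simp add: d_def)
  have "s \<le> 0" using \<nu> VF[OF v0] VT[OF facet_opp_vertex(1)] by (auto simp: s_def inner_commute)
  moreover have "\<bar>s\<bar> * norm ?g = 1" using \<nu> \<nu>s by (metis norm_scaleR)
  ultimately have "s = - inverse (norm ?g)"
    using bary_grad_opp_nonzero by (simp add: field_simps)
  then show "\<nu> = - (?g /\<^sub>R norm ?g)" using \<nu>s by simp
qed

text \<open>The outward normal coordinate of the hyperplane spanned by \<open>F\<close>.\<close>

definition facet_offset :: real where
  "facet_offset = bary T (opp_vertex T F) 0 / norm (bary_grad T (opp_vertex T F))"

lemma norm_exterior_normal: "norm (exterior_normal T F) = 1"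
  using bary_grad_opp_nonzero by (simp add: exterior_normal_eq)

lemma bary_opp: "bary T (opp_vertex T F) x = - norm (bary_grad T (opp_vertex T F)) * (x \<bullet> exterior_normal T F - facet_offset)"
  using bary_affine[OF T facet_opp_vertex(1), of x] bary_grad_opp_nonzero
  by (simp add: exterior_normal_eq facet_offset_def inner_commute field_simps)

lemma mem_affine_hull_facet: "x \<in> affine hull F \<longleftrightarrow> x \<bullet> exterior_normal T F = facet_offset"
  using bary_grad_opp_nonzero by (simp add: affine_hull_facet bary_opp)

lemma simplex_le_offset: "x \<in> T \<Longrightarrow> x \<bullet> exterior_normal T F \<le> facet_offset"
  using mem_simplex_iff[OF T, of x] facet_opp_vertex(1) bary_grad_opp_nonzero bary_opp[of x]
  by (auto simp: mult_le_0_iff)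

definition facet_proj :: "real^'n \<Rightarrow> real^'n" where
  "facet_proj x = x - (x \<bullet> exterior_normal T F - facet_offset) *\<^sub>R exterior_normal T F"

lemma facet_proj_inner: "facet_proj x \<bullet> exterior_normal T F = facet_offset"
  using norm_exterior_normal by (simp add: facet_proj_def inner_diff_left norm_eq_1)

lemma facet_proj_in_affine_hull: "facet_proj x \<in> affine hull F"
  by (simp add: mem_affine_hull_facet facet_proj_inner)

lemma facet_proj_id: "x \<bullet> exterior_normal T F = facet_offset \<Longrightarrow> facet_proj x = x"
  by (simp add: facet_proj_def)

lemma closest_point_facet: "closest_point (affine hull F) x = facet_proj x"
proof (rule closest_point_unique[symmetric])
  show "convex (affine hull F)" "closed (affine hull F)"
    by (auto simp: affine_imp_convex closed_affine_hull)
  show "facet_proj x \<in> affine hull F" by (rule facet_proj_in_affine_hull)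
  show "\<forall>z\<in>affine hull F. dist x (facet_proj x) \<le> dist x z"
  proof
    fix z assume "z \<in> affine hull F"
    then have z: "z \<bullet> exterior_normal T F = facet_offset" by (simp add: mem_affine_hull_facet)
    have "dist x (facet_proj x) = \<bar>(x - z) \<bullet> exterior_normal T F\<bar>"
      using norm_exterior_normal by (simp add: facet_proj_def dist_norm inner_diff_left z)
    also have "\<dots> \<le> norm (x - z) * norm (exterior_normal T F)" by (rule Cauchy_Schwarz_ineq2)
    finally show "dist x (facet_proj x) \<le> dist x z" by (simp add: norm_exterior_normal dist_norm)
  qed
qed

text \<open>The left side is the set in the definition of \<open>facet_measure\<close>; the right
  side, a slab condition together with a condition on the projection, is the form in which
  integration along normal lines produces boundary integrals.\<close>

lemma facet_prism_eq:
  "{y + t *\<^sub>R exterior_normal T F | y t. y \<in> F \<and> 0 \<le> t \<and> t \<le> 1}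
   = {x. facet_offset \<le> x \<bullet> exterior_normal T F \<and> x \<bullet> exterior_normal T F \<le> facet_offset + 1 \<and> facet_proj x \<in> F}"
  (is "?L = ?R")
proof (intro subset_antisym subsetI)
  fix x assume "x \<in> ?L"
  then obtain y t where yt: "x = y + t *\<^sub>R exterior_normal T F" "y \<in> F" "0 \<le> t" "t \<le> 1" by blast
  have "y \<bullet> exterior_normal T F = facet_offset"
    using yt(2) mem_affine_hull_facet[of y] hull_inc[of y F] by blast
  moreover have "exterior_normal T F \<bullet> exterior_normal T F = 1"
    using norm_exterior_normal by (simp add: norm_eq_1)
  ultimately show "x \<in> ?R"
    using yt by (simp add: facet_proj_def inner_add_left)
next
  fix x assume "x \<in> ?R"
  then show "x \<in> ?L"
    by (intro CollectI exI[of _ "facet_proj x"] exI[of _ "x \<bullet> exterior_normal T F - facet_offset"])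
       (auto simp: facet_proj_def)
qed

end

section \<open>Integrals over facets\<close>

context
  fixes T F :: "(real^'n::finite) set"
  assumes T: "int CARD('n) simplex T" and F: "F \<in> facets T"
begin

definition facet_prism :: "(real^'n) set" where
  "facet_prism = {x. facet_offset T F \<le> x \<bullet> exterior_normal T F \<and> x \<bullet> exterior_normal T F \<le> facet_offset T F + 1 \<and> facet_proj T F x \<in> F}"

lemma compact_facet: "compact F"
  by (subst facet_opp_vertex(2)[OF T F], rule finite_imp_compact_convex_hull)
     (simp add: simplex_vertices(3)[OF T])

lemma continuous_facet_proj: "continuous_on S (facet_proj T F)"
  unfolding facet_proj_def[OF T F] by (intro continuous_intros)

lemma facet_hyperplane: "y \<in> F \<Longrightarrow> y \<bullet> exterior_normal T F = facet_offset T F"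
  using mem_affine_hull_facet[OF T F, of y] hull_inc[of y F affine] by simp

lemma facet_proj_line:
  "y \<bullet> exterior_normal T F = facet_offset T F \<Longrightarrow> facet_proj T F (y + t *\<^sub>R exterior_normal T F) = y"
  using norm_exterior_normal[OF T F] by (simp add: facet_proj_def[OF T F] inner_add_left norm_eq_1)

lemma compact_facet_prism: "compact facet_prism"
proof -
  have "facet_prism = (\<lambda>(y, t). y + t *\<^sub>R exterior_normal T F) ` (F \<times> {0..1})"
    unfolding facet_prism_def facet_prism_eq[OF T F, symmetric] by force
  also have "compact \<dots>"
    by (intro compact_continuous_image compact_Times compact_facet compact_Icc)
       (auto simp: split_beta intro!: continuous_intros)
  finally show ?thesis .
qed

lemma facet_integral:
  fixes h :: "real^'n \<Rightarrow> real"
  assumes h: "h \<in> borel_measurable borel" and A: "A \<in> sets borel"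
  shows "(LINT y:A|facet_measure T F. h y)
    = (\<integral>x. indicator facet_prism x * (indicator A (facet_proj T F x) * h (facet_proj T F x)) \<partial>lborel)"
proof -
  have cp: "closest_point (affine hull F) = facet_proj T F"
    using closest_point_facet[OF T F] by auto
  have fm: "facet_measure T F = distr (lebesgue_on facet_prism) borel (facet_proj T F)"
    unfolding facet_measure_def cp facet_prism_def facet_prism_eq[OF T F] ..
  have Pm: "facet_prism \<in> sets borel" using compact_facet_prism by (rule borel_compact)
  have proj_measurable [measurable]: "facet_proj T F \<in> borel_measurable borel"
    by (rule borel_measurable_continuous_onI[OF continuous_facet_proj])
  have m: "(\<lambda>y. indicator A y * h y) \<in> borel_measurable borel" using h A by measurable
  have "(LINT y:A|facet_measure T F. h y) = (LINT y|distr (lebesgue_on facet_prism) borel (facet_proj T F). indicator A y * h y)"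
    by (simp add: fm set_lebesgue_integral_def)
  also have "\<dots> = (LINT x|lebesgue_on facet_prism. indicator A (facet_proj T F x) * h (facet_proj T F x))"
    by (rule integral_distr[OF borel_measurable_lebesgue_on_continuous[OF continuous_facet_proj] m])
  also have "\<dots> = (LINT x|lebesgue. indicator facet_prism x * (indicator A (facet_proj T F x) * h (facet_proj T F x)))"
    using Pm by (intro integral_lebesgue_on) auto
  also have "\<dots> = (\<integral>x. indicator facet_prism x * (indicator A (facet_proj T F x) * h (facet_proj T F x)) \<partial>lborel)"
    using Pm m by (intro integral_completion) (measurable, auto)
  finally show ?thesis .
qed

lemma facet_integral_full:
  fixes h :: "real^'n \<Rightarrow> real"
  assumes h: "continuous_on UNIV h"
  shows "(LINT y:F|facet_measure T F. h y) = (\<integral>x. indicator facet_prism x * h (facet_proj T F x) \<partial>lborel)"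
    and "integrable lborel (\<lambda>x. indicator facet_prism x * h (facet_proj T F x))"
proof -
  have "(LINT y:F|facet_measure T F. h y)
      = (\<integral>x. indicator facet_prism x * (indicator F (facet_proj T F x) * h (facet_proj T F x)) \<partial>lborel)"
    using compact_facet by (intro facet_integral borel_measurable_continuous_onI h borel_compact)
  also have "\<dots> = (\<integral>x. indicator facet_prism x * h (facet_proj T F x) \<partial>lborel)"
    by (rule Bochner_Integration.integral_cong) (auto simp: facet_prism_def indicator_def)
  finally show "(LINT y:F|facet_measure T F. h y) = (\<integral>x. indicator facet_prism x * h (facet_proj T F x) \<partial>lborel)" .
  have "integrable lborel (\<lambda>x. indicator facet_prism x *\<^sub>R h (facet_proj T F x))"
    by (rule borel_integrable_compact[OF compact_facet_prism continuous_on_compose2[OF h continuous_facet_proj]]) simp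
  then show "integrable lborel (\<lambda>x. indicator facet_prism x * h (facet_proj T F x))" by simp
qed

lemma facet_integral_minus_le:
  fixes h :: "real^'n \<Rightarrow> real"
  assumes h: "continuous_on UNIV h" "\<And>y. 0 \<le> h y" and C: "closed C"
  shows "(LINT y:(F - C)|facet_measure T F. h y) \<le> (LINT y:F|facet_measure T F. h y)"
proof -
  have A: "F - C \<in> sets borel" using compact_facet C by (auto intro: borel_compact)
  have "(LINT y:(F - C)|facet_measure T F. h y)
      = (\<integral>x. indicator facet_prism x * (indicator (F - C) (facet_proj T F x) * h (facet_proj T F x)) \<partial>lborel)"
    by (intro facet_integral borel_measurable_continuous_onI h A)
  also have "\<dots> \<le> (\<integral>x. indicator facet_prism x * h (facet_proj T F x) \<partial>lborel)"
  proof (rule integral_mono')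
    show "integrable lborel (\<lambda>x. indicator facet_prism x * h (facet_proj T F x))" by (rule facet_integral_full(2)[OF h(1)])
  qed (auto simp: indicator_def h(2))
  finally show ?thesis by (simp only: facet_integral_full(1)[OF h(1)])
qed

text \<open>A function with compact support \<open>K\<close> sees \<open>T\<close> only as the half-space behind \<open>F\<close>.\<close>

lemma gauss_facet:
  assumes \<tau>: "\<And>i. smooth (\<lambda>x. \<tau> x $ i)" and \<phi>: "smooth \<phi>" and K: "compact K" "\<And>x. x \<notin> K \<Longrightarrow> \<phi> x = 0"
    and KT: "\<And>x. x \<in> K \<Longrightarrow> x \<in> T \<longleftrightarrow> x \<bullet> exterior_normal T F \<le> facet_offset T F"
  shows "(\<integral>x. indicator T x * (divergence \<tau> x * \<phi> x + \<tau> x \<bullet> gradient \<phi> x) \<partial>lborel)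
       = (LINT y:F|facet_measure T F. (\<tau> y \<bullet> exterior_normal T F) * \<phi> y)"
proof -
  define \<psi> where "\<psi> i = (\<lambda>x. \<tau> x $ i * \<phi> x)" for i
  have s: "smooth (\<psi> i)" for i unfolding \<psi>_def by (intro smooth_mult \<tau> \<phi>)
  have \<psi>0: "\<psi> i x = 0" if "x \<notin> K" for i x using K(2)[OF that] by (simp add: \<psi>_def)
  have int: "integrable lborel (\<lambda>x. indicator {x. x \<bullet> exterior_normal T F \<le> facet_offset T F} x * (gradient (\<psi> i) x \<bullet> axis i 1))" for i
    using integrable_mult_indicator[OF _ integrable_gradient_inner[OF s K(1) \<psi>0], of "{x. x \<bullet> exterior_normal T F \<le> facet_offset T F}"]
    by simp
  have "indicator T x * (divergence \<tau> x * \<phi> x + \<tau> x \<bullet> gradient \<phi> x)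
      = (\<Sum>i\<in>UNIV. indicator {x. x \<bullet> exterior_normal T F \<le> facet_offset T F} x * (gradient (\<psi> i) x \<bullet> axis i 1))" for x
  proof (cases "x \<in> K")
    case True
    have "partial i (\<psi> i) x = partial i (\<lambda>x. \<tau> x $ i) x * \<phi> x + \<tau> x $ i * partial i \<phi> x" for i
      unfolding \<psi>_def by (rule partial_mult) (intro smooth_differentiable \<tau> \<phi>)+
    then have "divergence \<tau> x * \<phi> x + \<tau> x \<bullet> gradient \<phi> x = (\<Sum>i\<in>UNIV. partial i (\<psi> i) x)"
      by (simp add: divergence_def inner_vec_def sum.distrib sum_distrib_right)
    then show ?thesis
      using KT[OF True] by (simp add: inner_axis sum_distrib_left[symmetric]) (simp add: indicator_def)
  next
    case False
    have "gradient (\<psi> i) x = 0" for i using gradient_outside[OF s K(1) \<psi>0 False] .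
    moreover have "gradient \<phi> x = 0" using gradient_outside[OF \<phi> K(1) K(2) False] .
    ultimately show ?thesis using K(2)[OF False] by simp
  qed
  then have "(\<integral>x. indicator T x * (divergence \<tau> x * \<phi> x + \<tau> x \<bullet> gradient \<phi> x) \<partial>lborel)
     = (\<integral>x. (\<Sum>i\<in>UNIV. indicator {x. x \<bullet> exterior_normal T F \<le> facet_offset T F} x * (gradient (\<psi> i) x \<bullet> axis i 1)) \<partial>lborel)"
    by (rule Bochner_Integration.integral_cong[OF refl])
  also have "\<dots> = (\<Sum>i\<in>UNIV. \<integral>x. indicator {x. x \<bullet> exterior_normal T F \<le> facet_offset T F} x * (gradient (\<psi> i) x \<bullet> axis i 1) \<partial>lborel)"
    by (rule Bochner_Integration.integral_sum) (rule int)
  also have "\<dots> = (\<Sum>i\<in>UNIV. exterior_normal T F $ i * (\<integral>x. indicator facet_prism x * \<psi> i (facet_proj T F x) \<partial>lborel))"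
  proof (rule sum.cong[OF refl])
    fix i
    have "(\<integral>x. indicator {x. facet_offset T F \<le> x \<bullet> exterior_normal T F \<and> x \<bullet> exterior_normal T F \<le> facet_offset T F + 1} x * \<psi> i (x - (x \<bullet> exterior_normal T F - facet_offset T F) *\<^sub>R exterior_normal T F) \<partial>lborel)
       = (\<integral>x. indicator facet_prism x * \<psi> i (facet_proj T F x) \<partial>lborel)"
    proof (rule Bochner_Integration.integral_cong[OF refl])
      fix x
      \<comment> \<open>The half-space formula integrates over a whole slab. A projected point in
        \<open>K\<close> lies on the hyperplane, hence in \<open>T\<close> by the hypothesis on
        \<open>K\<close>, hence in \<open>F\<close>; so nothing is contributed off the
        prism.\<close>
      have "\<psi> i (facet_proj T F x) = 0" if "facet_proj T F x \<notin> F"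
      proof (rule \<psi>0, rule notI)
        assume "facet_proj T F x \<in> K"
        then have "facet_proj T F x \<in> T" using KT[of "facet_proj T F x"] facet_proj_inner[OF T F, of x] by simp
        moreover have "bary T (opp_vertex T F) (facet_proj T F x) = 0"
          by (simp add: bary_opp[OF T F] facet_proj_inner[OF T F])
        ultimately show False using that mem_facet_iff[OF T F, of "facet_proj T F x"] by simp
      qed
      then show "indicator {x. facet_offset T F \<le> x \<bullet> exterior_normal T F \<and> x \<bullet> exterior_normal T F \<le> facet_offset T F + 1} x * \<psi> i (x - (x \<bullet> exterior_normal T F - facet_offset T F) *\<^sub>R exterior_normal T F)
          = indicator facet_prism x * \<psi> i (facet_proj T F x)"
        unfolding facet_proj_def[OF T F, symmetric] by (auto simp: facet_prism_def indicator_def)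
    qed
    then show "(\<integral>x. indicator {x. x \<bullet> exterior_normal T F \<le> facet_offset T F} x * (gradient (\<psi> i) x \<bullet> axis i 1) \<partial>lborel)
       = exterior_normal T F $ i * (\<integral>x. indicator facet_prism x * \<psi> i (facet_proj T F x) \<partial>lborel)"
      using integral_halfspace_gradient[of "\<psi> i" K "exterior_normal T F" "facet_offset T F" "axis i 1", OF s K(1) \<psi>0 norm_exterior_normal[OF T F]]
      by (simp add: inner_axis)
  qed
  also have "\<dots> = (\<integral>x. (\<Sum>i\<in>UNIV. exterior_normal T F $ i * (indicator facet_prism x * \<psi> i (facet_proj T F x))) \<partial>lborel)"
    using facet_integral_full(2)[OF smooth_continuous[OF s]] by simp
  also have "\<dots> = (\<integral>x. indicator facet_prism x * ((\<tau> (facet_proj T F x) \<bullet> exterior_normal T F) * \<phi> (facet_proj T F x)) \<partial>lborel)"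
    by (rule Bochner_Integration.integral_cong)
       (auto simp: \<psi>_def inner_vec_def sum_distrib_left sum_distrib_right algebra_simps intro!: sum.cong)
  also have "\<dots> = (LINT y:F|facet_measure T F. (\<tau> y \<bullet> exterior_normal T F) * \<phi> y)"
    by (rule facet_integral_full(1)[symmetric])
       (intro continuous_intros continuous_on_smooth_vec[OF \<tau>] smooth_continuous[OF \<phi>])
  finally show ?thesis .
qed

end

section \<open>Shape regularity\<close>

lemma simplex_measure_pos:
  fixes T :: "(real^'n::finite) set"
  assumes T: "int CARD('n) simplex T"
  shows "interior T \<noteq> {}" "0 < measure lborel T" "emeasure lborel T = ennreal (measure lborel T)"
proof -
  note V = simplex_vertices[OF T]
  define p where "p = (\<Sum>v\<in>vertices T. (1 / real (card (vertices T))) *\<^sub>R v)"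
  have "bary T z p = 1 / real (card (vertices T))" if "z \<in> vertices T" for z
    using that V(2) by (intro bary_eqI[OF T, where u = "\<lambda>_. 1 / real (card (vertices T))"]) (auto simp: p_def)
  then have "p \<in> interior T"
    using V(2) by (simp add: mem_interior_simplex_iff[OF T])
  then show ne: "interior T \<noteq> {}" by blast
  have fin: "emeasure lborel T < \<infinity>" by (rule emeasure_compact_finite[OF compact_simplex[OF T]])
  then show eq: "emeasure lborel T = ennreal (measure lborel T)"
    by (intro emeasure_eq_ennreal_measure) auto
  have Tb: "T \<in> sets borel" by (rule borel_compact[OF compact_simplex[OF T]])
  have "\<not> negligible T" using negligible_convex_interior[OF convex_simplex[OF T]] ne by simp
  then have "emeasure lborel T \<noteq> 0"
    using Tb by (simp add: negligible_iff_null_sets null_sets_def)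
  then show "0 < measure lborel T"
    using eq measure_nonneg[of lborel T] by (cases "measure lborel T = 0") (auto simp: less_le)
qed

text \<open>A line along the gradient meets \<open>T\<close> in parameters from an interval of
  length at most the inverse of the gradient norm, since the coordinate stays between 0 and 1 there.
  In the slab of width \<open>diameter T\<close> next to \<open>z\<close> only base points within
  three diameters of \<open>z\<close> have lines that meet \<open>T\<close>; the slab identity
  compares the volumes.\<close>

lemma bary_grad_width:
  fixes T :: "(real^'n::finite) set"
  assumes T: "int CARD('n) simplex T" and z: "z \<in> vertices T"
  shows "norm (bary_grad T z) * (diameter T * measure lborel T) \<le> measure lborel (cball (0::real^'n) (3 * diameter T))"
proof (cases "bary_grad T z = 0")
  case False
  define g where "g = norm (bary_grad T z)"
  define u where "u = bary_grad T z /\<^sub>R g"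
  define h where "h = diameter T"
  have g: "0 < g" using False by (simp add: g_def)
  have u: "norm u = 1" using False by (simp add: u_def g_def)
  have zT: "z \<in> T" using z vertices_subset[OF T] by blast
  have h0: "0 \<le> h" by (simp add: h_def diameter_ge_0 compact_imp_bounded compact_simplex[OF T])
  have Tb [measurable]: "T \<in> sets borel" by (rule borel_compact[OF compact_simplex[OF T]])
  define S where "S = {x. z \<bullet> u \<le> x \<bullet> u \<and> x \<bullet> u \<le> z \<bullet> u + h}"
  have line: "bary T z (x + t *\<^sub>R u) = bary T z x + t * g" for x t
  proof -
    have "bary_grad T z \<bullet> u = g"
      using g by (simp add: u_def g_def dot_square_norm power2_eq_square)
    then show ?thesis
      using bary_diff[OF T z, of "x + t *\<^sub>R u" x] by simp
  qed
  have inner: "indicator S x * (\<integral>\<^sup>+t. indicator T (x + t *\<^sub>R u) \<partial>lborel) \<le> ennreal (1 / g) * indicator (cball z (3 * h)) x" for x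
  proof (cases "x \<in> S \<and> (\<exists>t. x + t *\<^sub>R u \<in> T)")
    case True
    then obtain t where t: "x + t *\<^sub>R u \<in> T" and xS: "x \<in> S" by blast
    have d: "norm (x + t *\<^sub>R u - z) \<le> h"
      using diameter_bounded_bound[OF compact_imp_bounded[OF compact_simplex[OF T]] t zT] by (simp add: h_def dist_norm)
    have uu: "u \<bullet> u = 1" using u by (simp add: norm_eq_1)
    have "(x + t *\<^sub>R u - z) \<bullet> u = x \<bullet> u - z \<bullet> u + t"
      by (simp add: inner_add_left inner_diff_left uu)
    moreover have "\<bar>(x + t *\<^sub>R u - z) \<bullet> u\<bar> \<le> h"
      using Cauchy_Schwarz_ineq2[of "x + t *\<^sub>R u - z" u] u d by simp
    \<comment> \<open>The normal coordinates of \<open>x\<close> and of the point in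
      \<open>T\<close> both lie within h of that of \<open>z\<close>, so they differ by at most 2 h.
      The distance of the point in \<open>T\<close> from \<open>z\<close> adds another h, whence the
      radius 3 h.\<close>
    ultimately have "\<bar>t\<bar> \<le> 2 * h" using xS by (auto simp: S_def abs_le_iff)
    then have "norm (t *\<^sub>R u) \<le> 2 * h" using u by simp
    then have "norm (x - z) \<le> 3 * h"
      using norm_triangle_ineq4[of "x + t *\<^sub>R u - z" "t *\<^sub>R u"] d by (simp add: algebra_simps)
    then have xb: "x \<in> cball z (3 * h)" by (simp add: dist_norm norm_minus_commute)
    have "(\<integral>\<^sup>+t. indicator T (x + t *\<^sub>R u) \<partial>lborel) \<le> (\<integral>\<^sup>+t. indicator {- bary T z x / g..(1 - bary T z x) / g} t \<partial>lborel)"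
    proof (rule nn_integral_mono)
      fix t
      have "t \<in> {- bary T z x / g..(1 - bary T z x) / g}" if "x + t *\<^sub>R u \<in> T"
      proof -
        have "0 \<le> bary T z (x + t *\<^sub>R u)" "bary T z (x + t *\<^sub>R u) \<le> 1"
          using mem_simplex_iff[OF T, of "x + t *\<^sub>R u"] z that bary_le_1[OF T that z] by simp_all
        then show ?thesis using g by (simp add: line field_simps)
      qed
      then show "(indicator T (x + t *\<^sub>R u) :: ennreal) \<le> indicator {- bary T z x / g..(1 - bary T z x) / g} t"
        by (simp add: indicator_def)
    qed
    also have "\<dots> = ennreal ((1 - bary T z x) / g - - bary T z x / g)"
    proof -
      have "(\<integral>\<^sup>+t. indicator {a..b} t \<partial>lborel) = ennreal (b - a)" if "a \<le> b" for a b :: real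
        using that by simp
      from this[of "- bary T z x / g" "(1 - bary T z x) / g"] show ?thesis
        using g by (simp only: divide_right_mono[of "- bary T z x" "1 - bary T z x" g])
    qed
    also have "(1 - bary T z x) / g - - bary T z x / g = 1 / g"
      by (simp add: diff_divide_distrib)
    finally show ?thesis using xS xb by simp
  next
    case False
    have "indicator S x * (\<integral>\<^sup>+t. indicator T (x + t *\<^sub>R u) \<partial>lborel) = (0::ennreal)"
    proof (cases "x \<in> S")
      case True
      then have "indicator T (x + t *\<^sub>R u) = (0::ennreal)" for t using False by simp
      then show ?thesis by simp
    qed simp
    then show ?thesis by (simp only: zero_le)
  qed
  have "ennreal h * emeasure lborel T = (\<integral>\<^sup>+x. indicator S x * (\<integral>\<^sup>+t. indicator T (x + t *\<^sub>R u) \<partial>lborel) \<partial>lborel)"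
    using nn_integral_slab[of "indicator T" u "z \<bullet> u" "z \<bullet> u + h", OF _ u] h0 by (simp add: S_def)
  also have "\<dots> \<le> (\<integral>\<^sup>+x. ennreal (1 / g) * indicator (cball z (3 * h)) x \<partial>lborel)"
    by (rule nn_integral_mono) (rule inner)
  also have "\<dots> = ennreal (1 / g) * emeasure lborel (cball z (3 * h))"
    by (rule nn_integral_cmult_indicator) simp
  also have "emeasure lborel (cball z (3 * h)) = emeasure lborel (cball (0::real^'n) (3 * h))"
    using h0 by (simp add: emeasure_cball)
  also have "\<dots> = ennreal (measure lborel (cball (0::real^'n) (3 * h)))"
    using emeasure_compact_finite[of "cball (0::real^'n) (3 * h)"] by (intro emeasure_eq_ennreal_measure) auto
  finally have "ennreal (h * measure lborel T) \<le> ennreal (1 / g * measure lborel (cball (0::real^'n) (3 * h)))"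
    using simplex_measure_pos(3)[OF T] h0 g by (simp add: ennreal_mult'[of "1 / g"] ennreal_mult' del: times_divide_eq_left mult_1)
  then have "h * measure lborel T \<le> 1 / g * measure lborel (cball (0::real^'n) (3 * h))"
    using g by (subst (asm) ennreal_le_iff) auto
  then show ?thesis using g by (simp add: g_def h_def field_simps)
qed simp

text \<open>Comes from the volume of a ball of radius 3 h divided by the volume of \<open>T\<close>,
  after bounding h^d by \<kappa> times that volume.\<close>

definition shape_const :: "'n::finite itself \<Rightarrow> real \<Rightarrow> real" where
  "shape_const _ \<kappa> = unit_ball_vol (real CARD('n)) * 3 ^ CARD('n) * \<kappa>"

lemma bary_grad_bound:
  fixes T :: "(real^'n::finite) set"
  assumes T: "int CARD('n) simplex T" and z: "z \<in> vertices T"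
    and \<kappa>: "diameter T ^ CARD('n) / measure lebesgue T \<le> \<kappa>"
  shows "norm (bary_grad T z) * diameter T \<le> shape_const TYPE('n) \<kappa>"
proof -
  let ?m = "measure lborel T"
  have h0: "0 \<le> diameter T" by (simp add: diameter_ge_0 compact_imp_bounded compact_simplex[OF T])
  have m: "0 < ?m" by (rule simplex_measure_pos(2)[OF T])
  have "measure lebesgue T = ?m"
    using borel_compact[OF compact_simplex[OF T]] by (simp add: measure_completion)
  with \<kappa> m have "diameter T ^ CARD('n) \<le> \<kappa> * ?m" by (simp add: pos_divide_le_eq)
  then have le: "unit_ball_vol (real CARD('n)) * 3 ^ CARD('n) * diameter T ^ CARD('n) \<le> unit_ball_vol (real CARD('n)) * 3 ^ CARD('n) * (\<kappa> * ?m)"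
    by (intro mult_left_mono) auto
  have "measure lborel (cball (0::real^'n) (3 * diameter T)) = unit_ball_vol (real CARD('n)) * 3 ^ CARD('n) * diameter T ^ CARD('n)"
    using h0 by (simp add: content_cball power_mult_distrib)
  with bary_grad_width[OF T z] have "norm (bary_grad T z) * (diameter T * ?m) \<le> unit_ball_vol (real CARD('n)) * 3 ^ CARD('n) * diameter T ^ CARD('n)"
    by (simp only:)
  from order_trans[OF this le] have "(norm (bary_grad T z) * diameter T) * ?m \<le> shape_const TYPE('n) \<kappa> * ?m"
    by (simp only: shape_const_def mult.assoc)
  with m show ?thesis by simp
qed

text \<open>The coordinate of \<open>z\<close> falls from one to zero between the two vertices. This
  bounds edge lengths from below and later compares the sizes of neighbouring elements.\<close>

lemma vertex_distance:
  fixes T :: "(real^'n::finite) set"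
  assumes T: "int CARD('n) simplex T" and z: "z \<in> vertices T" "w \<in> vertices T" "z \<noteq> w"
  shows "1 \<le> norm (bary_grad T z) * dist z w"
proof -
  have "bary_grad T z \<bullet> (z - w) = 1"
    using bary_diff[OF T z(1), of z w] z by (simp add: bary_vertex[OF T])
  then show ?thesis using norm_cauchy_schwarz[of "bary_grad T z" "z - w"] by (simp add: dist_norm)
qed

section \<open>Mesh topology\<close>

text \<open>The set strictly below a boundary graph is, locally, open and disjoint from \<Omega>, so
  it misses the closure. It contains points arbitrarily close to a boundary point, which therefore
  is not interior to the closure. This places element interiors and patches inside \<Omega>.\<close>

lemma lipschitz_domain_interior_closure:
  fixes \<Omega> :: "(real^'n::finite) set"
  assumes \<Omega>: "lipschitz_domain \<Omega>"
  shows "interior (closure \<Omega>) = \<Omega>"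
proof
  have op: "open \<Omega>" using \<Omega> by (simp add: lipschitz_domain_def)
  show "\<Omega> \<subseteq> interior (closure \<Omega>)" by (rule interior_maximal[OF closure_subset op])
  show "interior (closure \<Omega>) \<subseteq> \<Omega>"
  proof
    fix x assume x: "x \<in> interior (closure \<Omega>)"
    show "x \<in> \<Omega>"
    proof (rule ccontr)
      assume xn: "x \<notin> \<Omega>"
      have "x \<in> frontier \<Omega>"
        using subsetD[OF interior_subset x] xn by (simp only: frontier_def interior_open[OF op] Diff_iff not_False_eq_True)
      then obtain \<nu> r L \<gamma> where nu: "norm \<nu> = 1" and r: "0 < r" and lip: "L-lipschitz_on {z. z \<bullet> \<nu> = 0} \<gamma>"
        and gr: "\<forall>y\<in>ball x r. y \<in> \<Omega> \<longleftrightarrow> \<gamma> (y - (y \<bullet> \<nu>) *\<^sub>R \<nu>) < y \<bullet> \<nu>"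
        using \<Omega> unfolding lipschitz_domain_def
        by (elim conjE) (drule (1) bspec, elim exE conjE, rule that)
      have nn: "\<nu> \<bullet> \<nu> = 1" using nu by (simp add: norm_eq_1)
      define p where "p y = y - (y \<bullet> \<nu>) *\<^sub>R \<nu>" for y
      have "continuous_on UNIV (\<lambda>y. \<gamma> (p y) - y \<bullet> \<nu>)"
      proof (intro continuous_intros continuous_on_compose2[OF lipschitz_on_continuous_on[OF lip]])
        show "continuous_on UNIV p" unfolding p_def by (intro continuous_intros)
        show "p ` UNIV \<subseteq> {z. z \<bullet> \<nu> = 0}" by (auto simp: p_def inner_diff_left nn)
      qed
      then have below: "open {y. 0 < \<gamma> (p y) - y \<bullet> \<nu>}"
        by (rule open_Collect_less[OF continuous_on_const])
      obtain e where e: "0 < e" "ball x e \<subseteq> closure \<Omega>"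
        using x unfolding mem_interior by (elim exE conjE)
      define s where "s = min e r / 2"
      define y where "y = x - s *\<^sub>R \<nu>"
      have s: "0 < s" "s < e" "s < r" using e r by (auto simp: s_def)
      have "dist x y = s" using s nu by (simp add: y_def dist_norm)
      then have yb: "y \<in> ball x r" "y \<in> closure \<Omega>" using s e by (auto simp: subset_iff)
      have py: "p y = p x" by (simp add: p_def y_def inner_diff_left nn algebra_simps)
      have "\<not> \<gamma> (p x) < x \<bullet> \<nu>" using gr r xn unfolding p_def by (metis centre_in_ball)
      then have y0: "y \<in> {y. 0 < \<gamma> (p y) - y \<bullet> \<nu>} \<inter> ball x r"
        using s yb py by (simp add: y_def inner_diff_left nn)
      have "open ({y. 0 < \<gamma> (p y) - y \<bullet> \<nu>} \<inter> ball x r)" by (intro open_Int below open_ball)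
      from open_Int_closure_eq_empty[OF this, of \<Omega>] obtain z where
        "z \<in> \<Omega>" "z \<in> ball x r" "0 < \<gamma> (p z) - z \<bullet> \<nu>" using y0 yb(2) by blast
      then show False using gr unfolding p_def by force
    qed
  qed
qed

context
  fixes T F :: "(real^'n::finite) set"
  assumes T: "int CARD('n) simplex T" and F: "F \<in> facets T"
begin

lemma finite_facet_vertices: "finite (vertices F)"
  using simplex_vertices(3)[OF T] by (simp add: facet_opp_vertex(3)[OF T F])

lemma facet_vertex: "v \<in> vertices F \<Longrightarrow> v \<in> vertices T"
  by (simp add: facet_opp_vertex(3)[OF T F])

lemma bary_facet_eqI:
  assumes u: "sum u (vertices F) = 1" "(\<Sum>v\<in>vertices F. u v *\<^sub>R v) = x" and v: "v \<in> vertices F"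
  shows "bary T v x = u v"
proof -
  define u' where "u' v = (if v = opp_vertex T F then 0 else u v)" for v
  have "sum u' (vertices T) = sum u (vertices F)"
    unfolding sum_vertices_facet[OF T F] facet_opp_vertex(3)[OF T F] by (simp add: u'_def)
  moreover have "(\<Sum>v\<in>vertices T. u' v *\<^sub>R v) = (\<Sum>v\<in>vertices F. u v *\<^sub>R v)"
    unfolding sum_vertices_facet[OF T F] facet_opp_vertex(3)[OF T F] by (simp add: u'_def)
  ultimately have "bary T v x = u' v"
    using u facet_vertex[OF v] bary_eqI[OF T, of u' x v] by simp
  also have "u' v = u v" using v by (simp add: u'_def facet_opp_vertex(3)[OF T F])
  finally show ?thesis .
qed

lemma bary_facet_sum:
  assumes "x \<in> affine hull F"
  shows "(\<Sum>v\<in>vertices F. bary T v x) = 1" "(\<Sum>v\<in>vertices F. bary T v x *\<^sub>R v) = x"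
proof -
  have 0: "bary T (opp_vertex T F) x = 0" using assms by (simp add: affine_hull_facet[OF T F])
  show "(\<Sum>v\<in>vertices F. bary T v x) = 1" "(\<Sum>v\<in>vertices F. bary T v x *\<^sub>R v) = x"
    using bary_sum(1)[OF T, of x, unfolded sum_vertices_facet[OF T F]]
      bary_sum(2)[OF T, of x, unfolded sum_vertices_facet[OF T F]]
    unfolding facet_opp_vertex(3)[OF T F] by (simp_all only: 0 add_0 scaleR_zero_left)
qed

lemma bary_rel_interior_facet:
  assumes y: "y \<in> rel_interior F" and v: "v \<in> vertices F"
  shows "0 < bary T v y"
proof -
  have "\<not> affine_dependent (vertices F)"
    unfolding facet_opp_vertex(3)[OF T F]
    using affine_independent_subset[OF simplex_vertices(1)[OF T]] by blast
  from rel_interior_convex_hull_explicit[OF this]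
  have "rel_interior F = {y. \<exists>u. (\<forall>x\<in>vertices F. 0 < u x) \<and> sum u (vertices F) = 1 \<and> (\<Sum>x\<in>vertices F. u x *\<^sub>R x) = y}"
    unfolding facet_opp_vertex(3)[OF T F] facet_opp_vertex(2)[OF T F, symmetric] .
  with y obtain u where u: "\<forall>x\<in>vertices F. 0 < u x" "sum u (vertices F) = 1" "(\<Sum>x\<in>vertices F. u x *\<^sub>R x) = y"
    by blast
  then show ?thesis using bary_facet_eqI[OF u(2,3) v] v by simp
qed

text \<open>Moving inwards raises the coordinate of the opposite vertex at a positive rate; the
  other coordinates are positive at a relative interior point and vary continuously.\<close>

lemma behind_rel_interior_facet:
  assumes y: "y \<in> rel_interior F"
  shows "\<forall>\<^sub>F t in at_right 0. y - t *\<^sub>R exterior_normal T F \<in> interior T"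
proof -
  let ?n = "exterior_normal T F"
  have yF: "y \<in> affine hull F"
    by (rule hull_inc[OF subsetD[OF rel_interior_subset y]])
  have "\<forall>\<^sub>F t in at_right 0. 0 < bary T v (y - t *\<^sub>R ?n)" if v: "v \<in> vertices T" for v
  proof (cases "v = opp_vertex T F")
    case True
    have "bary T v (y - t *\<^sub>R ?n) = norm (bary_grad T v) * t" for t
      using yF norm_exterior_normal[OF T F] unfolding True bary_opp[OF T F]
      by (simp add: mem_affine_hull_facet[OF T F] inner_diff_left norm_eq_1)
    then show ?thesis
      using bary_grad_opp_nonzero[OF T F] True
      by (intro eventually_mono[OF eventually_at_right_less[of "0::real"]]) simp
  next
    case False
    then have pos: "0 < bary T v y" using v by (intro bary_rel_interior_facet y) (simp add: facet_opp_vertex(3)[OF T F])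
    have lim: "((\<lambda>t. bary T v y - t * (bary_grad T v \<bullet> ?n)) \<longlongrightarrow> bary T v y - 0 * (bary_grad T v \<bullet> ?n)) (at_right 0)"
      by (intro tendsto_intros)
    have eq: "bary T v (y - t *\<^sub>R ?n) = bary T v y - t * (bary_grad T v \<bullet> ?n)" for t
      using bary_diff[OF T v, of "y - t *\<^sub>R ?n" y] by simp
    show ?thesis unfolding eq by (rule order_tendstoD(1)[OF lim]) (simp add: pos)
  qed
  then have "\<forall>\<^sub>F t in at_right 0. \<forall>v\<in>vertices T. 0 < bary T v (y - t *\<^sub>R ?n)"
    using simplex_vertices(3)[OF T] by (simp add: eventually_ball_finite_distrib)
  then show ?thesis by (simp add: mem_interior_simplex_iff[OF T])
qed

end

text \<open>On the hyperplane of \<open>F\<close> both values are the affine coordinates with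
  respect to the vertices of \<open>F\<close>, which do not involve the element. Hence the normal
  traces from the two sides are polynomials in the same variables.\<close>

lemma bary_facet_agree:
  fixes T T' F :: "(real^'n::finite) set"
  assumes "int CARD('n) simplex T" "F \<in> facets T" "int CARD('n) simplex T'" "F \<in> facets T'"
    and "x \<in> affine hull F" "v \<in> vertices F"
  shows "bary T' v x = bary T v x"
  using bary_facet_sum[OF assms(1,2,5)] assms(6) by (intro bary_facet_eqI[OF assms(3,4), where u = "\<lambda>v. bary T v x"])

context
  fixes \<Omega> :: "(real^'n::finite) set" and \<T> :: "(real^'n) set set"
  assumes \<Omega>: "lipschitz_domain \<Omega>" and mesh: "mesh_of \<Omega> \<T>"
begin

lemma mesh_finite: "finite \<T>"
  and mesh_simplex: "T \<in> \<T> \<Longrightarrow> int CARD('n) simplex T"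
  and mesh_Union: "\<Union>\<T> = closure \<Omega>"
  and mesh_face: "T \<in> \<T> \<Longrightarrow> T' \<in> \<T> \<Longrightarrow> T \<inter> T' face_of T"
  using mesh by (simp_all add: mesh_of_def triangulation_def)

lemma mesh_interior: "T \<in> \<T> \<Longrightarrow> interior T \<subseteq> \<Omega>"
  using interior_mono[of T "closure \<Omega>"] mesh_Union lipschitz_domain_interior_closure[OF \<Omega>] by blast

lemma patch_subset: "patch \<T> T \<subseteq> \<Omega>"
proof -
  have "patch \<T> T \<subseteq> interior (closure \<Omega>)"
    unfolding patch_def mesh_Union[symmetric] by (rule interior_mono) blast
  then show ?thesis using lipschitz_domain_interior_closure[OF \<Omega>] by simp
qed

lemma aff_dim_mesh: "T \<in> \<T> \<Longrightarrow> aff_dim T = int CARD('n)"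
  using aff_dim_simplex mesh_simplex by blast

lemma mesh_Int_proper:
  assumes "T \<in> \<T>" "T' \<in> \<T>" "T \<noteq> T'"
  shows "T \<inter> T' \<noteq> T"
proof
  assume eq: "T \<inter> T' = T"
  have "T face_of T'" using mesh_face[OF assms(2,1)] eq by (simp add: Int_commute)
  from face_of_aff_dim_lt[OF convex_simplex[OF mesh_simplex[OF assms(2)]] this assms(3)]
  show False using aff_dim_mesh assms by simp
qed

lemma mesh_interior_disjoint:
  assumes "T \<in> \<T>" "T' \<in> \<T>" "T \<noteq> T'"
  shows "interior T \<inter> T' = {}"
  using face_of_disjoint_interior[OF mesh_face[OF assms(1,2)] mesh_Int_proper[OF assms]] interior_subset[of T] by blast

text \<open>Both vectors are unit normals of the same hyperplane, so they agree up to sign. Equal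
  signs would put the points just behind a relative interior point of \<open>F\<close> into the
  interiors of both elements.\<close>

lemma mesh_normals_opposite:
  assumes T: "T \<in> \<T>" "F \<in> facets T" and T': "T' \<in> \<T>" "F \<in> facets T'" and ne: "T \<noteq> T'"
  shows "exterior_normal T' F = - exterior_normal T F" "facet_offset T' F = - facet_offset T F"
proof -
  let ?n = "exterior_normal T F" and ?n' = "exterior_normal T' F"
  note s = mesh_simplex[OF T(1)] and s' = mesh_simplex[OF T'(1)]
  have nn: "?n \<bullet> ?n = 1" "?n' \<bullet> ?n' = 1"
    using norm_exterior_normal[OF s T(2)] norm_exterior_normal[OF s' T'(2)] by (simp_all add: norm_eq_1)
  have "F \<noteq> {}" "convex F"
    using T(2) by (auto simp: facets_def facet_of_def face_of_imp_convex)
  then obtain y where y: "y \<in> rel_interior F" using rel_interior_eq_empty by blast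
  have yF: "y \<in> affine hull F"
    by (rule hull_inc[OF subsetD[OF rel_interior_subset y]])
  \<comment> \<open>The part of the second normal tangential to \<open>F\<close>. Adding it to
    \<open>y\<close> stays in the hyperplane, so it is orthogonal to both normals and thus to
    itself.\<close>
  define d where "d = ?n' - (?n' \<bullet> ?n) *\<^sub>R ?n"
  have "y + d \<in> affine hull F"
    using yF by (simp add: mem_affine_hull_facet[OF s T(2)] inner_add_left d_def inner_diff_left nn)
  then have "d \<bullet> ?n' = 0"
    using yF by (simp add: mem_affine_hull_facet[OF s' T'(2)] inner_add_left)
  moreover have "d \<bullet> ?n = 0" by (simp add: d_def inner_diff_left nn)
  moreover have "d \<bullet> d = d \<bullet> ?n' - (?n' \<bullet> ?n) * (d \<bullet> ?n)"
    by (subst (2) d_def) (simp add: inner_diff_right)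
  ultimately have "d = 0" by simp
  then have n': "?n' = (?n' \<bullet> ?n) *\<^sub>R ?n" by (simp add: d_def)
  then have "\<bar>?n' \<bullet> ?n\<bar> = 1"
    using norm_exterior_normal[OF s T(2)] norm_exterior_normal[OF s' T'(2)]
    by (metis mult.right_neutral norm_scaleR)
  moreover have "?n' \<bullet> ?n \<noteq> 1"
  proof
    assume "?n' \<bullet> ?n = 1"
    then have eq: "?n' = ?n" using n' by simp
    have "\<forall>\<^sub>F t in at_right 0. y - t *\<^sub>R ?n \<in> interior T \<and> y - t *\<^sub>R ?n \<in> interior T'"
      using behind_rel_interior_facet[OF s T(2) y] behind_rel_interior_facet[OF s' T'(2) y]
      unfolding eq by (rule eventually_conj)
    then obtain t where "y - t *\<^sub>R ?n \<in> interior T" "y - t *\<^sub>R ?n \<in> interior T'"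
      using eventually_happens'[OF trivial_limit_at_right_real] by blast
    then show False
      using mesh_interior_disjoint[OF T(1) T'(1) ne] interior_subset[of T'] by blast
  qed
  ultimately have "?n' \<bullet> ?n = - 1" by linarith
  then show eq: "?n' = - ?n" using n' by simp
  show "facet_offset T' F = - facet_offset T F"
    using yF eq unfolding mem_affine_hull_facet[OF s' T'(2)] by (simp add: mem_affine_hull_facet[OF s T(2), symmetric] )
      (use yF in \<open>simp add: mem_affine_hull_facet[OF s T(2)]\<close>)
qed

text \<open>A point slightly beyond a relative interior point of \<open>F\<close> lies in some
  element other than \<open>T\<close>. The intersection of the two is a face of \<open>T\<close>
  that contains \<open>F\<close>, and dimension leaves no other face than \<open>F\<close>.\<close>

lemma mesh_neighbour:
  assumes T: "T \<in> \<T>" and F: "F \<in> facets T" and int: "\<not> F \<subseteq> frontier \<Omega>"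
  obtains T' where "T' \<in> \<T>" "T' \<noteq> T" "F \<in> facets T'" "{T'' \<in> \<T>. F facet_of T''} = {T, T'}"
proof -
  let ?n = "exterior_normal T F"
  note s = mesh_simplex[OF T]
  have op: "open \<Omega>" using \<Omega> by (simp add: lipschitz_domain_def)
  have FT: "F \<subseteq> T" "F face_of T" "convex F" "aff_dim F = int CARD('n) - 1"
    using F aff_dim_mesh[OF T] by (auto simp: facets_def facet_of_def face_of_imp_convex dest: face_of_imp_subset)
  have "F \<subseteq> closure \<Omega>" using FT(1) T mesh_Union by blast
  then obtain y0 where y0: "y0 \<in> F" "y0 \<in> \<Omega>"
    using int unfolding frontier_def interior_open[OF op] by fast
  have "closure (rel_interior F) = F"
    using convex_closure_rel_interior[OF FT(3)] compact_facet[OF s F] by (simp add: compact_imp_closed)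
  with y0 open_Int_closure_eq_empty[OF op, of "rel_interior F"]
  obtain y where y: "y \<in> rel_interior F" "y \<in> \<Omega>" by blast
  have yF: "y \<in> F" by (rule subsetD[OF rel_interior_subset y(1)])
  have yo: "y \<bullet> ?n = facet_offset T F" by (rule facet_hyperplane[OF s F yF])
  have nn: "?n \<bullet> ?n = 1" using norm_exterior_normal[OF s F] by (simp add: norm_eq_1)
  \<comment> \<open>Staying away from this closed set forces every element met near \<open>y\<close>
    to contain \<open>y\<close>.\<close>
  define C where "C = \<Union>{T' \<in> \<T>. y \<notin> T'}"
  have "closed C"
    unfolding C_def using mesh_finite compact_simplex[OF mesh_simplex] by (intro closed_Union) (auto intro: compact_imp_closed)
  then have "open (\<Omega> - C)" by (rule open_Diff[OF op])
  moreover have "y \<in> \<Omega> - C" using y by (auto simp: C_def)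
  ultimately obtain r where r: "0 < r" "ball y r \<subseteq> \<Omega> - C" by (meson open_contains_ball)
  define q where "q = y + (r / 2) *\<^sub>R ?n"
  have "dist y q = r / 2" using r norm_exterior_normal[OF s F] by (simp add: q_def dist_norm)
  then have q: "q \<in> \<Omega>" "q \<notin> C" using r by (auto simp: subset_iff)
  have "\<Omega> \<subseteq> \<Union>\<T>" unfolding mesh_Union by (rule closure_subset)
  then obtain T' where T': "T' \<in> \<T>" "q \<in> T'" using q(1) by blast
  have yT': "y \<in> T'" using q(2) T' unfolding C_def by blast
  have "q \<bullet> ?n > facet_offset T F" using r yo nn by (simp add: q_def inner_add_left)
  then have "q \<notin> T" using simplex_le_offset[OF s F, of q] by auto
  then have ne: "T \<noteq> T'" using T' by blast
  have face: "T \<inter> T' face_of T" by (rule mesh_face[OF T T'(1)])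
  have "F \<subseteq> T \<inter> T'"
  proof (rule subset_of_face_of[OF face FT(1)])
    show "T \<inter> T' \<inter> rel_interior F \<noteq> {}" using y(1) yT' FT(1) yF by blast
  qed
  then have Fface: "F face_of (T \<inter> T')" by (rule face_of_subset[OF FT(2)]) simp
  have "F = T \<inter> T'"
  proof (rule ccontr)
    assume "F \<noteq> T \<inter> T'"
    have "convex (T \<inter> T')" using face face_of_imp_convex by blast
    from face_of_aff_dim_lt[OF this Fface \<open>F \<noteq> T \<inter> T'\<close>]
    have "aff_dim F < aff_dim (T \<inter> T')" .
    moreover have "aff_dim (T \<inter> T') < aff_dim T"
      by (rule face_of_aff_dim_lt[OF convex_simplex[OF s] face mesh_Int_proper[OF T T'(1) ne]])
    ultimately show False using FT(4) aff_dim_mesh[OF T] by simp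
  qed
  then have "F face_of T'" using mesh_face[OF T'(1) T] by (simp add: Int_commute)
  then have F': "F \<in> facets T'"
    using FT(4) aff_dim_mesh[OF T'(1)] yF by (auto simp: facets_def facet_of_def)
  have "T'' = T \<or> T'' = T'" if T'': "T'' \<in> \<T>" "F \<in> facets T''" for T''
  proof (rule ccontr)
    assume "\<not> (T'' = T \<or> T'' = T')"
    \<comment> \<open>Three distinct elements at \<open>F\<close> would have pairwise opposite
      normals, which is impossible for unit vectors.\<close>
    then have "exterior_normal T'' F = - ?n" "exterior_normal T'' F = - exterior_normal T' F"
      using mesh_normals_opposite(1)[OF T F T''] mesh_normals_opposite(1)[OF T'(1) F' T''] by auto
    moreover have "exterior_normal T' F = - ?n"
      by (rule mesh_normals_opposite(1)[OF T F T'(1) F' ne])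
    ultimately have "?n = - ?n" by simp
    then have "?n = 0" by (simp add: eq_neg_iff_add_eq_0 scaleR_2[symmetric])
    with nn show False by simp
  qed
  then have "{T'' \<in> \<T>. F facet_of T''} = {T, T'}"
    using T T'(1) F F' unfolding facets_def by blast
  with T'(1) ne F' show thesis by (intro that) auto
qed

end

section \<open>Jumps as multi-affine polynomials and their norm on a reference facet\<close>

section \<open>Normal traces of the discrete space\<close>

lemma smooth_bary:
  fixes T :: "(real^'n::finite) set"
  assumes T: "int CARD('n) simplex T" and z: "z \<in> vertices T"
  shows "smooth (bary T z)"
proof -
  have "bary T z = (\<lambda>x. bary_grad T z \<bullet> x + bary T z 0)"
    by (rule ext) (rule bary_affine[OF T z])
  then show ?thesis using smooth_affine[of "bary_grad T z" "bary T z 0"] by simp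
qed

lemma edge_vertices_subset: "E edge_of T \<Longrightarrow> {z. z extreme_point_of E} \<subseteq> vertices T"
  by (auto simp: edge_of_def vertices_def extreme_point_of_face)

lemma smooth_local_space:
  fixes T :: "(real^'n::finite) set"
  assumes T: "int CARD('n) simplex T" and \<tau>: "\<tau> \<in> local_space \<epsilon> zv tv T"
  shows "smooth (\<lambda>x. \<tau> x $ i)"
proof -
  from \<tau> obtain a c \<alpha> \<beta> where eq: "\<tau> = (\<lambda>x. a + c *\<^sub>R x
        + (\<Sum>F\<in>facets T. (\<alpha> F * (if \<epsilon> < diameter T then facet_bubble_eps \<epsilon> T F x
                                else facet_bubble T F x)) *\<^sub>R exterior_normal T F)
        + (\<Sum>E\<in>edges_at T (zv T). (\<beta> E * edge_bubble T E x) *\<^sub>R tv T E))"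
    unfolding local_space_def mem_Collect_eq by (elim exE) (rule that)
  have b: "smooth (facet_bubble T F)" for F
    unfolding facet_bubble_def by (intro smooth_prod smooth_bary[OF T]) simp
  have be: "smooth (facet_bubble_eps \<epsilon> T F)" if F: "F \<in> facets T" for F
  proof -
    let ?z = "opp_vertex T F" and ?k = "- (diameter T / \<epsilon>)"
    have k: "?k * bary T ?z x = (?k *\<^sub>R bary_grad T ?z) \<bullet> x + ?k * bary T ?z 0" for x
      by (subst bary_affine[OF T facet_opp_vertex(1)[OF T F], of x]) (simp add: algebra_simps)
    have "smooth (\<lambda>x. exp (?k * bary T ?z x))"
      by (rule ssubst[where P = smooth, OF _ smooth_exp_affine[of "?k *\<^sub>R bary_grad T ?z" "?k * bary T ?z 0"]])
         (rule ext, rule arg_cong[where f = exp], rule k)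
    then show ?thesis unfolding facet_bubble_eps_def by (intro smooth_mult b)
  qed
  have e: "smooth (edge_bubble T E)" if "E \<in> edges_at T (zv T)" for E
    unfolding edge_bubble_def using that edge_vertices_subset[of E T]
    by (intro smooth_prod smooth_bary[OF T]) (auto simp: edges_at_def)
  have id: "smooth (\<lambda>x. c * x $ i)"
    using smooth_affine[of "c *\<^sub>R axis i 1" 0] by (simp add: inner_axis')
  have eqi: "(\<lambda>x. \<tau> x $ i) = (\<lambda>x. a $ i + c * x $ i
      + (\<Sum>F\<in>facets T. (\<alpha> F * (if \<epsilon> < diameter T then facet_bubble_eps \<epsilon> T F x
                                else facet_bubble T F x)) * exterior_normal T F $ i)
        + (\<Sum>E\<in>edges_at T (zv T). (\<beta> E * edge_bubble T E x) * tv T E $ i))"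
    by (simp add: eq fun_eq_iff)
  show ?thesis
  proof (cases "\<epsilon> < diameter T")
    case True
    show ?thesis
      unfolding eqi if_P[OF True] by (intro smooth_add smooth_sum smooth_mult smooth_const id be e; assumption)
  next
    case False
    show ?thesis
      unfolding eqi if_not_P[OF False] by (intro smooth_add smooth_sum smooth_mult smooth_const id b e; assumption)
  qed
qed

text \<open>Monomials are indexed by sets of vertices of \<open>F\<close>, so no coordinate occurs
  twice in a product; this leaves a space of fixed finite dimension. The identity is required on
  \<open>F\<close> only, which is where the exponential factors disappear.\<close>

definition facet_poly :: "(real^'n::finite) set \<Rightarrow> (real^'n) set \<Rightarrow> (real^'n \<Rightarrow> real) \<Rightarrow> bool" where
  "facet_poly T F q \<longleftrightarrow> (\<exists>c. \<forall>y\<in>F. q y = (\<Sum>S\<in>Pow (vertices F). c S * (\<Prod>v\<in>S. bary T v y)))"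

lemma facet_poly_cong: "facet_poly T F q \<Longrightarrow> (\<And>y. y \<in> F \<Longrightarrow> q' y = q y) \<Longrightarrow> facet_poly T F q'"
  by (simp add: facet_poly_def)

lemma facet_poly_add:
  assumes "facet_poly T F q" "facet_poly T F q'"
  shows "facet_poly T F (\<lambda>y. q y + q' y)"
proof -
  obtain c where c: "\<forall>y\<in>F. q y = (\<Sum>S\<in>Pow (vertices F). c S * (\<Prod>v\<in>S. bary T v y))"
    using assms(1) unfolding facet_poly_def ..
  obtain c' where c': "\<forall>y\<in>F. q' y = (\<Sum>S\<in>Pow (vertices F). c' S * (\<Prod>v\<in>S. bary T v y))"
    using assms(2) unfolding facet_poly_def ..
  show ?thesis
    unfolding facet_poly_def
    by (rule exI[of _ "\<lambda>S. c S + c' S"]) (simp add: c c' distrib_right sum.distrib)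
qed

lemma facet_poly_cmult:
  assumes "facet_poly T F q"
  shows "facet_poly T F (\<lambda>y. k * q y)"
proof -
  obtain c where c: "\<forall>y\<in>F. q y = (\<Sum>S\<in>Pow (vertices F). c S * (\<Prod>v\<in>S. bary T v y))"
    using assms(1) unfolding facet_poly_def ..
  show ?thesis
    unfolding facet_poly_def
    by (rule exI[of _ "\<lambda>S. k * c S"]) (simp add: c sum_distrib_left mult.assoc)
qed

lemma facet_poly_zero: "facet_poly T F (\<lambda>y. 0)"
  unfolding facet_poly_def by (rule exI[of _ "\<lambda>_. 0"]) simp

lemma facet_poly_sum: "(\<And>i. i \<in> I \<Longrightarrow> facet_poly T F (q i)) \<Longrightarrow> facet_poly T F (\<lambda>y. \<Sum>i\<in>I. q i y)"
  by (induction I rule: infinite_finite_induct) (auto simp: facet_poly_zero facet_poly_add)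

lemma facet_poly_monomial:
  assumes "finite (vertices F)" "S \<subseteq> vertices F"
  shows "facet_poly T F (\<lambda>y. \<Prod>v\<in>S. bary T v y)"
  unfolding facet_poly_def
proof (rule exI[of _ "\<lambda>S'. if S' = S then 1 else 0"], rule ballI)
  fix y
  have "(\<Sum>S'\<in>Pow (vertices F). (if S' = S then 1 else 0) * (\<Prod>v\<in>S'. bary T v y))
      = (\<Sum>S'\<in>Pow (vertices F). if S' = S then \<Prod>v\<in>S'. bary T v y else 0)"
    by (rule sum.cong) auto
  then show "(\<Prod>v\<in>S. bary T v y) = (\<Sum>S'\<in>Pow (vertices F). (if S' = S then 1 else 0) * (\<Prod>v\<in>S'. bary T v y))"
    using assms by simp
qed

lemma facet_poly_const: "finite (vertices F) \<Longrightarrow> facet_poly T F (\<lambda>y. k)"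
  using facet_poly_cmult[OF facet_poly_monomial[of F "{}" T], of k] by simp

text \<open>A factor for the opposite vertex makes the product vanish on \<open>F\<close>; without
  it the product is already one of the monomials. This covers facet and edge bubbles alike.\<close>

lemma facet_poly_bary_prod:
  fixes T F :: "(real^'n::finite) set"
  assumes T: "int CARD('n) simplex T" and F: "F \<in> facets T" and S: "S \<subseteq> vertices T"
  shows "facet_poly T F (\<lambda>y. \<Prod>v\<in>S. bary T v y)"
proof (cases "opp_vertex T F \<in> S")
  case True
  have "finite S" using S simplex_vertices(3)[OF T] finite_subset by blast
  then have "(\<Prod>v\<in>S. bary T v y) = 0" if "y \<in> F" for y
    using True that mem_facet_iff[OF T F, of y] by (intro prod_zero) auto
  then show ?thesis by (rule facet_poly_cong[OF facet_poly_zero])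
next
  case False
  then have "S \<subseteq> vertices F" using S by (auto simp: facet_opp_vertex(3)[OF T F])
  then show ?thesis by (rule facet_poly_monomial[OF finite_facet_vertices[OF T F]])
qed

text \<open>The exponential layers are invisible on facets: \<open>facet_bubble_eps\<close> agrees with
  \<open>facet_bubble\<close> on its own facet and both vanish on the other ones.\<close>

lemma facet_poly_normal_trace:
  fixes T F :: "(real^'n::finite) set"
  assumes T: "int CARD('n) simplex T" and F: "F \<in> facets T" and \<tau>: "\<tau> \<in> local_space \<epsilon> zv tv T"
  shows "facet_poly T F (\<lambda>y. \<tau> y \<bullet> exterior_normal T F)"
proof -
  let ?n = "exterior_normal T F"
  from \<tau> obtain a c \<alpha> \<beta> where eq: "\<tau> = (\<lambda>x. a + c *\<^sub>R x
        + (\<Sum>F\<in>facets T. (\<alpha> F * (if \<epsilon> < diameter T then facet_bubble_eps \<epsilon> T F x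
                                else facet_bubble T F x)) *\<^sub>R exterior_normal T F)
        + (\<Sum>E\<in>edges_at T (zv T). (\<beta> E * edge_bubble T E x) *\<^sub>R tv T E))"
    unfolding local_space_def mem_Collect_eq by (elim exE) (rule that)
  have b: "facet_poly T F (facet_bubble T F')" for F'
    unfolding facet_bubble_def by (rule facet_poly_bary_prod[OF T F]) blast
  have be: "facet_poly T F (facet_bubble_eps \<epsilon> T F')" if F': "F' \<in> facets T" for F'
  proof (rule facet_poly_cong[OF b[of F']])
    fix y assume y: "y \<in> F"
    have 0: "bary T (opp_vertex T F) y = 0" using y mem_facet_iff[OF T F] by blast
    show "facet_bubble_eps \<epsilon> T F' y = facet_bubble T F' y"
    proof (cases "opp_vertex T F' = opp_vertex T F")
      case True
      then show ?thesis by (simp add: facet_bubble_eps_def 0)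
    next
      case False
      then have "facet_bubble T F' y = 0"
        unfolding facet_bubble_def using simplex_vertices(3)[OF T] facet_opp_vertex(1)[OF T F] 0
        by (intro prod_zero) auto
      then show ?thesis by (simp add: facet_bubble_eps_def)
    qed
  qed
  have e: "facet_poly T F (edge_bubble T E)" if "E \<in> edges_at T (zv T)" for E
    unfolding edge_bubble_def using that edge_vertices_subset[of E T]
    by (intro facet_poly_bary_prod[OF T F]) (simp add: edges_at_def)
  have bb: "facet_poly T F (\<lambda>y. if \<epsilon> < diameter T then facet_bubble_eps \<epsilon> T F' y else facet_bubble T F' y)"
    if "F' \<in> facets T" for F'
    by (cases "\<epsilon> < diameter T") (simp_all only: if_True if_False b be[OF that])
  \<comment> \<open>The Raviart-Thomas part has constant normal trace, since the normal component of
    the position vector equals the offset on \<open>F\<close>.\<close>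
  have "facet_poly T F (\<lambda>y. (a \<bullet> ?n + c * facet_offset T F)
      + (\<Sum>F'\<in>facets T. (\<alpha> F' * (exterior_normal T F' \<bullet> ?n)) * (if \<epsilon> < diameter T then facet_bubble_eps \<epsilon> T F' y
                                else facet_bubble T F' y))
      + (\<Sum>E\<in>edges_at T (zv T). (\<beta> E * (tv T E \<bullet> ?n)) * edge_bubble T E y))"
    by (intro facet_poly_add facet_poly_sum facet_poly_cmult facet_poly_const finite_facet_vertices[OF T F] bb e)
  then show ?thesis
  proof (rule facet_poly_cong)
    fix y assume y: "y \<in> F"
    show "\<tau> y \<bullet> ?n = (a \<bullet> ?n + c * facet_offset T F)
      + (\<Sum>F'\<in>facets T. (\<alpha> F' * (exterior_normal T F' \<bullet> ?n)) * (if \<epsilon> < diameter T then facet_bubble_eps \<epsilon> T F' y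
                                else facet_bubble T F' y))
      + (\<Sum>E\<in>edges_at T (zv T). (\<beta> E * (tv T E \<bullet> ?n)) * edge_bubble T E y)"
      unfolding eq by (simp add: inner_add_left inner_sum_left facet_hyperplane[OF T F y] mult_ac)
  qed
qed

lemma facet_poly_transfer:
  fixes T T' F :: "(real^'n::finite) set"
  assumes T: "int CARD('n) simplex T" "F \<in> facets T" and T': "int CARD('n) simplex T'" "F \<in> facets T'"
    and q: "facet_poly T' F q"
  shows "facet_poly T F q"
proof -
  obtain c where c: "\<forall>y\<in>F. q y = (\<Sum>S\<in>Pow (vertices F). c S * (\<Prod>v\<in>S. bary T' v y))"
    using q unfolding facet_poly_def ..
  show ?thesis
    unfolding facet_poly_def
  proof (rule exI[of _ c], rule ballI)
    fix y assume y: "y \<in> F"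
    have "bary T' v y = bary T v y" if "v \<in> vertices F" for v
      by (rule bary_facet_agree[OF T T' hull_inc[OF y] that])
    then have "(\<Prod>v\<in>S. bary T' v y) = (\<Prod>v\<in>S. bary T v y)" if "S \<in> Pow (vertices F)" for S
      using that by (intro prod.cong) auto
    then show "q y = (\<Sum>S\<in>Pow (vertices F). c S * (\<Prod>v\<in>S. bary T v y))"
      using bspec[OF c y] by simp
  qed
qed

section \<open>Multi-affine polynomials on a reference facet\<close>

text \<open>A facet has as many vertices as the space has dimensions, so the index type of the space
  can also enumerate the vertices. Coefficients indexed by its subsets form a Euclidean space, in
  which compactness and orthogonal projection are at hand.\<close>

definition mpoly :: "real^('n::finite set) \<Rightarrow> ('n \<Rightarrow> real) \<Rightarrow> real" where
  "mpoly c \<mu> = (\<Sum>S\<in>UNIV. c $ S * (\<Prod>i\<in>S. \<mu> i))"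

definition layer_weight :: "real \<Rightarrow> ('n::finite \<Rightarrow> real) \<Rightarrow> real" where
  "layer_weight \<beta> \<mu> = (\<Prod>i\<in>UNIV. bump (\<mu> i - \<beta>))"

text \<open>The coordinates \<open>x $ i\<close> with \<open>i \<noteq> k\<close> parametrize the reference facet; \<open>x $ k\<close> is the
  height in the prism over it.\<close>

definition ref_coord :: "'n \<Rightarrow> real^'n \<Rightarrow> 'n::finite \<Rightarrow> real" where
  "ref_coord k x i = (if i = k then 1 - (\<Sum>j\<in>UNIV - {k}. x $ j) else x $ i)"

definition ref_prism :: "'n::finite \<Rightarrow> (real^'n) set" where
  "ref_prism k = {x. (\<forall>i. 0 \<le> ref_coord k x i) \<and> 0 \<le> x $ k \<and> x $ k \<le> 1}"

definition ref_form :: "'n::finite \<Rightarrow> real \<Rightarrow> real^('n set) \<Rightarrow> real" where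
  "ref_form k \<beta> c = (\<integral>x. indicator (ref_prism k) x * ((mpoly c (ref_coord k x))\<^sup>2 * layer_weight \<beta> (ref_coord k x)) \<partial>lborel)"

lemma mpoly_add: "mpoly (a + b) \<mu> = mpoly a \<mu> + mpoly b \<mu>"
  by (simp add: mpoly_def distrib_right sum.distrib)

lemma mpoly_scaleR: "mpoly (r *\<^sub>R a) \<mu> = r * mpoly a \<mu>"
  by (simp add: mpoly_def sum_distrib_left mult.assoc)

lemma layer_weight_bounds: "0 \<le> layer_weight \<beta> \<mu>" "layer_weight \<beta> \<mu> \<le> 1"
  unfolding layer_weight_def by (auto intro!: prod_nonneg prod_le_1 bump_bounds)

lemma continuous_bump: "continuous_on S bump"
  unfolding bump_def
  by (intro continuous_at_imp_continuous_on ballI) (rule DERIV_isCont[OF flat_has_derivative])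

lemma continuous_ref_coord: "continuous_on S (\<lambda>x. ref_coord k x i)"
  unfolding ref_coord_def by (cases "i = k") (auto intro!: continuous_intros)

lemma continuous_mpoly_ref: "continuous_on S (\<lambda>x. mpoly c (ref_coord k x))"
  unfolding mpoly_def by (intro continuous_intros continuous_ref_coord)

lemma continuous_layer_ref: "continuous_on S (\<lambda>x. layer_weight \<beta> (ref_coord k x))"
  unfolding layer_weight_def
  by (intro continuous_on_prod continuous_on_compose2[OF continuous_bump[of UNIV]] continuous_intros continuous_ref_coord) auto

lemma sum_ref_coord: "(\<Sum>i\<in>UNIV. ref_coord k x i) = 1"
proof -
  have "(\<Sum>i\<in>UNIV. ref_coord k x i) = ref_coord k x k + (\<Sum>i\<in>UNIV - {k}. ref_coord k x i)"
    by (rule sum.remove) auto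
  also have "(\<Sum>i\<in>UNIV - {k}. ref_coord k x i) = (\<Sum>i\<in>UNIV - {k}. x $ i)"
    by (rule sum.cong) (auto simp: ref_coord_def)
  finally show ?thesis by (simp add: ref_coord_def)
qed

lemma simplex_coord_le_1:
  fixes \<mu> :: "'n::finite \<Rightarrow> real"
  assumes "\<And>i. 0 \<le> \<mu> i" "sum \<mu> UNIV = 1"
  shows "\<mu> i \<le> 1"
  using member_le_sum[of i UNIV \<mu>] assms by simp

lemma mpoly_bound:
  assumes "\<And>i. 0 \<le> \<mu> i" "\<And>i. \<mu> i \<le> 1"
  shows "\<bar>mpoly c \<mu>\<bar> \<le> (\<Sum>S\<in>UNIV. \<bar>c $ S\<bar>)"
proof -
  have "\<bar>mpoly c \<mu>\<bar> \<le> (\<Sum>S\<in>UNIV. \<bar>c $ S * (\<Prod>i\<in>S. \<mu> i)\<bar>)"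
    unfolding mpoly_def by (rule sum_abs)
  also have "\<dots> \<le> (\<Sum>S\<in>UNIV. \<bar>c $ S\<bar>)"
  proof (rule sum_mono)
    fix S
    have "0 \<le> (\<Prod>i\<in>S. \<mu> i)" "(\<Prod>i\<in>S. \<mu> i) \<le> 1"
      using assms by (auto intro!: prod_nonneg prod_le_1)
    then show "\<bar>c $ S * (\<Prod>i\<in>S. \<mu> i)\<bar> \<le> \<bar>c $ S\<bar>"
      by (simp add: abs_mult mult_left_le)
  qed
  finally show ?thesis .
qed

lemma compact_ref_prism: "compact (ref_prism k)"
proof -
  have "closed (ref_prism k)"
    unfolding ref_prism_def
    by (intro closed_Collect_conj closed_Collect_all closed_Collect_le continuous_ref_coord continuous_intros)
  moreover have "bounded (ref_prism k)"
  proof (rule bounded_subset[OF bounded_cbox])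
    show "ref_prism k \<subseteq> cbox 0 (\<chi> i. 1)"
    proof
      fix x assume x: "x \<in> ref_prism k"
      have "0 \<le> x $ i \<and> x $ i \<le> 1" for i
      proof (cases "i = k")
        case False
        then have "ref_coord k x i = x $ i" by (simp add: ref_coord_def)
        moreover have "\<And>j. 0 \<le> ref_coord k x j" using x by (simp add: ref_prism_def)
        ultimately show ?thesis
          using simplex_coord_le_1[of "ref_coord k x" i] sum_ref_coord[of k x] by metis
      qed (use x in \<open>simp add: ref_prism_def\<close>)
      then show "x \<in> cbox 0 (\<chi> i. 1)" by (simp add: mem_box_cart)
    qed
  qed
  ultimately show ?thesis by (simp only: compact_eq_bounded_closed)
qed

lemma integrable_ref:
  fixes f :: "real^'n::finite \<Rightarrow> real"
  assumes "continuous_on UNIV f"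
  shows "integrable lborel (\<lambda>x. indicator (ref_prism k) x * f x)"
  using borel_integrable_compact[OF compact_ref_prism continuous_on_subset[OF assms subset_UNIV], of k] by simp

text \<open>Expanding the square exhibits the form as a quadratic polynomial in finitely many
  coefficients, with fixed integrals as its entries.\<close>

lemma continuous_ref_form: "continuous_on UNIV (ref_form k \<beta>)"
proof -
  define p where "p S x = (\<Prod>i\<in>S. ref_coord k x i)" for S x
  define w where "w x = layer_weight \<beta> (ref_coord k x)" for x
  define q where "q S S' = (\<integral>x. indicator (ref_prism k) x * (p S x * p S' x * w x) \<partial>lborel)" for S S'
  have int: "integrable lborel (\<lambda>x. indicator (ref_prism k) x * (p S x * p S' x * w x))" for S S'
    unfolding p_def w_def
    by (intro integrable_ref continuous_intros continuous_ref_coord continuous_layer_ref)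
  have "ref_form k \<beta> c = (\<Sum>S\<in>UNIV. \<Sum>S'\<in>UNIV. c $ S * c $ S' * q S S')" for c
  proof -
    have "indicator (ref_prism k) x * ((mpoly c (ref_coord k x))\<^sup>2 * w x)
      = (\<Sum>S\<in>UNIV. \<Sum>S'\<in>UNIV. c $ S * c $ S' * (indicator (ref_prism k) x * (p S x * p S' x * w x)))" for x
    proof -
      have "(mpoly c (ref_coord k x))\<^sup>2 = (\<Sum>S\<in>UNIV. \<Sum>S'\<in>UNIV. c $ S * p S x * (c $ S' * p S' x))"
        unfolding mpoly_def power2_eq_square p_def by (rule sum_product)
      then show ?thesis
        by (simp only: sum_distrib_left sum_distrib_right) (intro sum.cong refl, simp only: mult_ac)
    qed
    then have "ref_form k \<beta> c = (\<integral>x. (\<Sum>S\<in>UNIV. \<Sum>S'\<in>UNIV. c $ S * c $ S' * (indicator (ref_prism k) x * (p S x * p S' x * w x))) \<partial>lborel)"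
      unfolding ref_form_def w_def[symmetric] by (rule Bochner_Integration.integral_cong[OF refl])
    also have "\<dots> = (\<Sum>S\<in>UNIV. \<integral>x. (\<Sum>S'\<in>UNIV. c $ S * c $ S' * (indicator (ref_prism k) x * (p S x * p S' x * w x))) \<partial>lborel)"
      by (intro Bochner_Integration.integral_sum Bochner_Integration.integrable_sum integrable_mult_right int)
    also have "\<dots> = (\<Sum>S\<in>UNIV. \<Sum>S'\<in>UNIV. \<integral>x. c $ S * c $ S' * (indicator (ref_prism k) x * (p S x * p S' x * w x)) \<partial>lborel)"
      by (intro sum.cong refl Bochner_Integration.integral_sum integrable_mult_right int)
    also have "\<dots> = (\<Sum>S\<in>UNIV. \<Sum>S'\<in>UNIV. c $ S * c $ S' * q S S')"
      unfolding q_def by (intro sum.cong refl Bochner_Integration.integral_mult_right_zero)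
    finally show ?thesis .
  qed
  then have eq: "ref_form k \<beta> = (\<lambda>c. \<Sum>S\<in>UNIV. \<Sum>S'\<in>UNIV. c $ S * c $ S' * q S S')" by (rule ext)
  show ?thesis unfolding eq by (intro continuous_intros)
qed

lemma ref_form_nonneg: "0 \<le> ref_form k \<beta> c"
  unfolding ref_form_def
  by (intro Bochner_Integration.integral_nonneg mult_nonneg_nonneg layer_weight_bounds) auto

lemma ref_form_scaleR: "ref_form k \<beta> (r *\<^sub>R c) = r\<^sup>2 * ref_form k \<beta> c"
proof -
  have "indicator (ref_prism k) x * ((mpoly (r *\<^sub>R c) (ref_coord k x))\<^sup>2 * layer_weight \<beta> (ref_coord k x))
    = r\<^sup>2 * (indicator (ref_prism k) x * ((mpoly c (ref_coord k x))\<^sup>2 * layer_weight \<beta> (ref_coord k x)))" for x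
    unfolding mpoly_scaleR power_mult_distrib by (simp only: mult_ac)
  then have "ref_form k \<beta> (r *\<^sub>R c)
    = (\<integral>x. r\<^sup>2 * (indicator (ref_prism k) x * ((mpoly c (ref_coord k x))\<^sup>2 * layer_weight \<beta> (ref_coord k x))) \<partial>lborel)"
    unfolding ref_form_def by (rule Bochner_Integration.integral_cong[OF refl])
  then show ?thesis
    unfolding ref_form_def by (simp only: Bochner_Integration.integral_mult_right_zero)
qed

text \<open>Reduces the spreading of zeros to one variable: a polynomial that vanishes on part of a
  segment vanishes at its end point too.\<close>

lemma mpoly_segment:
  obtains P where "\<And>s. poly P s = mpoly c (\<lambda>i. u i + s * d i)"
proof
  fix s show "poly (\<Sum>S\<in>UNIV. smult (c $ S) (\<Prod>i\<in>S. [:u i, d i:])) s = mpoly c (\<lambda>i. u i + s * d i)"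
    by (simp add: mpoly_def poly_sum poly_prod)
qed

text \<open>A vanishing weighted integral kills the polynomial only where all coordinates exceed
  \<beta>. A point \<mu> of the simplex is joined to the barycentre; the part of the segment close
  to the barycentre lies in that region and provides infinitely many zeros of a univariate
  polynomial.\<close>

lemma mpoly_eq_0_of_ref_form:
  fixes c :: "real^('n::finite set)"
  assumes 0: "ref_form k \<beta> c = 0" and \<beta>: "0 < \<beta>" "\<beta> * real CARD('n) \<le> 1 / 2"
    and \<mu>: "\<And>i. 0 \<le> \<mu> i" "sum \<mu> UNIV = 1"
  shows "mpoly c \<mu> = 0"
proof -
  define f where "f x = indicator (ref_prism k) x * ((mpoly c (ref_coord k x))\<^sup>2 * layer_weight \<beta> (ref_coord k x))" for x
  have int: "integrable lborel f"
    unfolding f_def by (intro integrable_ref continuous_intros continuous_mpoly_ref continuous_layer_ref)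
  have fn: "0 \<le> f x" for x unfolding f_def by (intro mult_nonneg_nonneg layer_weight_bounds) auto
  have "(\<integral>x. f x \<partial>lborel) = 0" using 0 by (simp add: ref_form_def f_def)
  then have ae: "AE x in lborel. f x = 0"
    using integral_nonneg_eq_0_iff_AE[OF int] fn by simp
  define O' where "O' = {x. (\<forall>i. \<beta> < ref_coord k x i) \<and> 0 < x $ k \<and> x $ k < 1}"
  define N where "N = O' \<inter> {x. mpoly c (ref_coord k x) \<noteq> 0}"
  have "O' = (\<Inter>i\<in>UNIV. {x. \<beta> < ref_coord k x i}) \<inter> {x. 0 < x $ k} \<inter> {x. x $ k < 1}"
    by (auto simp: O'_def)
  also have "open \<dots>"
    by (intro open_Int open_INT ballI open_Collect_less continuous_ref_coord continuous_intros finite)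
  finally have "open O'" .
  moreover have "open {x. mpoly c (ref_coord k x) \<noteq> 0}"
    by (intro open_Collect_neq continuous_mpoly_ref continuous_intros)
  ultimately have "open N" unfolding N_def by (rule open_Int)
  have "f x \<noteq> 0" if "x \<in> N" for x
  proof -
    have x: "\<forall>i. \<beta> < ref_coord k x i" "0 < x $ k" "x $ k < 1" "mpoly c (ref_coord k x) \<noteq> 0"
      using that by (auto simp: N_def O'_def)
    have "x \<in> ref_prism k" unfolding ref_prism_def using x(1-3) \<beta>(1) by (auto intro: less_imp_le order_less_trans)
    moreover have "0 < layer_weight \<beta> (ref_coord k x)"
      unfolding layer_weight_def using x(1) by (intro prod_pos) (simp add: bump_pos_iff)
    ultimately show ?thesis using x(4) by (simp add: f_def)
  qed
  then have "AE x in lborel. x \<notin> N" using ae by (auto elim!: eventually_mono)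
  then have "N \<in> null_sets lborel"
    using \<open>open N\<close> AE_iff_null_sets[of N lborel] by simp
  then have "negligible N"
    by (simp add: negligible_iff_null_sets null_sets_completionI)
  \<comment> \<open>An open null set is empty, so the polynomial vanishes everywhere on
    \<open>O'\<close>, not merely almost everywhere.\<close>
  then have N: "N = {}" using open_not_negligible[OF \<open>open N\<close>] by blast
  let ?u = "\<lambda>i::'n. 1 / real CARD('n)"
  obtain P where P: "\<And>s. poly P s = mpoly c (\<lambda>i. ?u i + s * (\<mu> i - ?u i))"
    by (rule mpoly_segment[where c = c and u = ?u and d = "\<lambda>i. \<mu> i - ?u i"]) (rule that)
  have "poly P s = 0" if s: "0 < s" "s < 1 / 2" for s
  proof -
    define m where "m i = ?u i + s * (\<mu> i - ?u i)" for i
    \<comment> \<open>A point of the prism over the coordinates \<open>m\<close>; its height 1/2 is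
      strictly between 0 and 1, as \<open>O'\<close> demands.\<close>
    define x where "x = (\<chi> i. if i = k then 1 / 2 else m i)"
    have sum: "sum m UNIV = 1"
    proof -
      have "sum m UNIV = (\<Sum>i\<in>UNIV. ?u i) + s * (sum \<mu> UNIV - (\<Sum>i\<in>UNIV. ?u i))"
        by (simp only: m_def[abs_def] sum.distrib sum_subtractf sum_distrib_left[symmetric])
      also have "(\<Sum>i\<in>UNIV. ?u i) = 1" by simp
      finally show ?thesis using \<mu>(2) by simp
    qed
    have rc: "ref_coord k x i = m i" for i
    proof (cases "i = k")
      case True
      have "sum m UNIV = m k + sum m (UNIV - {k})" by (rule sum.remove) auto
      moreover have "(\<Sum>j\<in>UNIV - {k}. x $ j) = sum m (UNIV - {k})"
        by (rule sum.cong) (auto simp: x_def)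
      ultimately show ?thesis using sum True by (simp add: ref_coord_def)
    qed (simp add: ref_coord_def x_def)
    have "\<beta> < m i" for i
    proof -
      \<comment> \<open>On the half of the segment next to the barycentre a coordinate keeps at
        least the fraction 1 - s > 1/2 of the value 1/d; the upper bound on \<beta> is made for this
        comparison.\<close>
      have "\<beta> \<le> 1 / 2 * (1 / real CARD('n))" using \<beta>(2) by (simp add: field_simps)
      also have "\<dots> < (1 - s) * (1 / real CARD('n))" using s by (intro mult_strict_right_mono) auto
      also have "\<dots> \<le> (1 - s) * (1 / real CARD('n)) + s * \<mu> i" using s \<mu>(1) by simp
      also have "(1 - s) * a + s * b = a + s * (b - a)" for a b by (simp add: algebra_simps)
      finally show ?thesis by (simp only: m_def)
    qed
    then have "x \<in> O'" by (simp add: O'_def rc) (simp add: x_def)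
    with N have "mpoly c (ref_coord k x) = 0" unfolding N_def by blast
    moreover have "ref_coord k x = m" using rc by (rule ext)
    ultimately have "mpoly c m = 0" by simp
    then show ?thesis unfolding P m_def[abs_def] .
  qed
  then have "{0<..<1/2} \<subseteq> {s. poly P s = 0}" by auto
  moreover have "infinite {0<..<1/2::real}" by (simp add: infinite_Ioo)
  ultimately have "P = 0" using poly_roots_finite[of P] finite_subset by blast
  then have "mpoly c (\<lambda>i. ?u i + 1 * (\<mu> i - ?u i)) = 0" using P[of 1] by simp
  then show ?thesis by simp
qed

text \<open>Coefficients are not determined by the polynomial on the simplex, so they are first
  projected onto the orthogonal complement of the kernel.\<close>

lemma ref_form_coercive:
  fixes k :: "'n::finite"
  assumes \<beta>: "0 < \<beta>" "\<beta> * real CARD('n) \<le> 1 / 2"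
  obtains C where "0 < C" "\<And>c. \<exists>c'. (\<forall>\<mu>. (\<forall>i. 0 \<le> \<mu> i) \<longrightarrow> sum \<mu> UNIV = 1 \<longrightarrow> mpoly c' \<mu> = mpoly c \<mu>)
      \<and> (\<Sum>S\<in>UNIV. \<bar>c' $ S\<bar>)\<^sup>2 \<le> C * ref_form k \<beta> c'"
proof -
  define N :: "(real^('n set)) set" where "N = {c. \<forall>\<mu>. (\<forall>i. 0 \<le> \<mu> i) \<longrightarrow> sum \<mu> UNIV = 1 \<longrightarrow> mpoly c \<mu> = 0}"
  have N0: "mpoly 0 \<mu> = 0" for \<mu> :: "'n \<Rightarrow> real" by (simp add: mpoly_def)
  have subN: "subspace N"
    unfolding subspace_def N_def by (simp add: N0 mpoly_add mpoly_scaleR)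
  \<comment> \<open>Unit vectors orthogonal to the kernel. The form is continuous and positive on
    this compact set, hence bounded below there by a positive constant.\<close>
  define U where "U = sphere 0 1 \<inter> {b. \<forall>a\<in>N. orthogonal b a}"
  have "closed {b. \<forall>a\<in>N. orthogonal b a}"
  proof -
    have "{b. \<forall>a\<in>N. orthogonal b a} = (\<Inter>a\<in>N. {b. b \<bullet> a = 0})"
      by (auto simp: orthogonal_def)
    also have "closed \<dots>" by (intro closed_INT ballI closed_Collect_eq continuous_intros)
    finally show ?thesis .
  qed
  then have "compact U" unfolding U_def by (intro compact_Int_closed compact_sphere)
  have pos: "0 < ref_form k \<beta> b" if "b \<in> U" for b
  proof (rule ccontr)
    assume "\<not> 0 < ref_form k \<beta> b"
    then have "ref_form k \<beta> b = 0" using ref_form_nonneg[of k \<beta> b] by simp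
    then have "b \<in> N" using mpoly_eq_0_of_ref_form[OF _ \<beta>] unfolding N_def by simp
    with that show False by (auto simp: U_def orthogonal_def)
  qed
  obtain m where m: "0 < m" "\<And>b. b \<in> U \<Longrightarrow> m \<le> ref_form k \<beta> b"
  proof (cases "U = {}")
    case True then show ?thesis by (intro that[of 1]) auto
  next
    case False
    from continuous_attains_inf[OF \<open>compact U\<close> False continuous_on_subset[OF continuous_ref_form subset_UNIV]]
    obtain b where "b \<in> U" "\<forall>y\<in>U. ref_form k \<beta> b \<le> ref_form k \<beta> y" by blast
    then show ?thesis using pos by (intro that[of "ref_form k \<beta> b"]) auto
  qed
  \<comment> \<open>The number of coefficients, which compares the sum of their absolute values with
    the Euclidean norm.\<close>
  define M where "M = real CARD('n set)"
  show thesis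
  proof (rule that[of "M\<^sup>2 / m"])
    show "0 < M\<^sup>2 / m" using m by (simp add: M_def)
    fix c :: "real^('n set)"
    obtain a b where ab: "a \<in> span N" "\<And>w. w \<in> span N \<Longrightarrow> orthogonal b w" "c = a + b"
      using orthogonal_subspace_decomp_exists[of N c] by metis
    have sp: "span N = N" using subN by (simp add: span_eq_iff)
    have "mpoly b \<mu> = mpoly c \<mu>" if "\<forall>i. 0 \<le> \<mu> i" "sum \<mu> UNIV = 1" for \<mu>
      using ab(1,3) that unfolding sp by (simp add: N_def mpoly_add)
    moreover have "(\<Sum>S\<in>UNIV. \<bar>b $ S\<bar>)\<^sup>2 \<le> M\<^sup>2 / m * ref_form k \<beta> b"
    proof (cases "b = 0")
      case True
      then show ?thesis by (simp add: ref_form_nonneg M_def m less_imp_le zero_le_mult_iff)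
    next
      case False
      have "(\<Sum>S\<in>UNIV. \<bar>b $ S\<bar>) \<le> M * norm b"
        using sum_bounded_above[of "UNIV :: 'n set set" "\<lambda>S. \<bar>b $ S\<bar>" "norm b"] component_le_norm_cart[of b]
        by (simp add: M_def)
      then have "(\<Sum>S\<in>UNIV. \<bar>b $ S\<bar>)\<^sup>2 \<le> (M * norm b)\<^sup>2"
        by (intro power_mono) (auto intro: sum_nonneg)
      moreover have "m * (norm b)\<^sup>2 \<le> ref_form k \<beta> b"
      proof -
        have "(1 / norm b) *\<^sub>R b \<in> U" using False ab(2) unfolding sp U_def by (auto simp: orthogonal_def)
        from m(2)[OF this] have "m \<le> ref_form k \<beta> b / (norm b)\<^sup>2"
          by (simp add: ref_form_scaleR power_divide)
        then show ?thesis using False by (simp add: field_simps)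
      qed
      then have "M\<^sup>2 / m * (m * (norm b)\<^sup>2) \<le> M\<^sup>2 / m * ref_form k \<beta> b"
        using m by (intro mult_left_mono) auto
      moreover have "M\<^sup>2 / m * (m * (norm b)\<^sup>2) = (M * norm b)\<^sup>2"
        using m by (simp add: power_mult_distrib)
      ultimately show ?thesis by linarith
    qed
    ultimately show "\<exists>c'. (\<forall>\<mu>. (\<forall>i. 0 \<le> \<mu> i) \<longrightarrow> sum \<mu> UNIV = 1 \<longrightarrow> mpoly c' \<mu> = mpoly c \<mu>)
      \<and> (\<Sum>S\<in>UNIV. \<bar>c' $ S\<bar>)\<^sup>2 \<le> M\<^sup>2 / m * ref_form k \<beta> c'" by blast
  qed
qed

section \<open>Integrals over facets in barycentric coordinates\<close>

text \<open>Continuity is phrased through composition with continuous coordinates, because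
  \<open>f\<close> is only ever evaluated after \<open>facet_coord\<close> and
  \<open>ref_coord\<close>, and there it has to be measurable.\<close>

definition coord_continuous :: "(('n::finite \<Rightarrow> real) \<Rightarrow> real) \<Rightarrow> bool" where
  "coord_continuous f \<longleftrightarrow> (\<forall>\<mu> :: real^'n \<Rightarrow> 'n \<Rightarrow> real.
     (\<forall>i. continuous_on UNIV (\<lambda>x. \<mu> x i)) \<longrightarrow> continuous_on UNIV (\<lambda>x. f (\<mu> x)))"

context
  fixes T F :: "(real^'n::finite) set" and w :: "'n \<Rightarrow> real^'n" and k :: 'n
  assumes T: "int CARD('n) simplex T" and F: "F \<in> facets T" and w: "bij_betw w UNIV (vertices F)"
begin

definition facet_coord :: "real^'n \<Rightarrow> 'n \<Rightarrow> real" where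
  "facet_coord x i = bary T (w i) (facet_proj T F x)"

lemma facet_enum_vertex: "w i \<in> vertices F" "w i \<in> vertices T" "w i \<in> F" "w i \<bullet> exterior_normal T F = facet_offset T F"
proof -
  show 1: "w i \<in> vertices F" using w by (auto simp: bij_betw_def)
  then show "w i \<in> vertices T" by (rule facet_vertex[OF T F])
  show "w i \<in> F" using 1 by (simp add: vertices_def extreme_point_of_def)
  then show "w i \<bullet> exterior_normal T F = facet_offset T F" by (rule facet_hyperplane[OF T F])
qed

lemma facet_enum_surj: "v \<in> vertices F \<Longrightarrow> \<exists>i. v = w i"
  using w by (auto simp: bij_betw_def)

lemma sum_facet_enum: "(\<Sum>v\<in>vertices F. f v) = (\<Sum>i\<in>UNIV. f (w i))"
  using sum.reindex_bij_betw[OF w, of f] by simp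

lemma sum_facet_coord: "(\<Sum>i\<in>UNIV. facet_coord x i) = 1" "(\<Sum>i\<in>UNIV. facet_coord x i *\<^sub>R w i) = facet_proj T F x"
  using bary_facet_sum[OF T F facet_proj_in_affine_hull[OF T F, of x]]
  by (simp_all add: facet_coord_def sum_facet_enum)

lemma facet_proj_in_facet_iff: "facet_proj T F x \<in> F \<longleftrightarrow> (\<forall>i. 0 \<le> facet_coord x i)"
proof -
  have opp: "bary T (opp_vertex T F) (facet_proj T F x) = 0"
    using facet_proj_in_affine_hull[OF T F, of x] by (simp add: affine_hull_facet[OF T F])
  have "facet_proj T F x \<in> F \<longleftrightarrow> (\<forall>v\<in>vertices T. 0 \<le> bary T v (facet_proj T F x))"
    by (simp add: mem_facet_iff[OF T F] opp mem_simplex_iff[OF T])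
  also have "\<dots> \<longleftrightarrow> (\<forall>v\<in>vertices F. 0 \<le> bary T v (facet_proj T F x))"
    using opp unfolding facet_opp_vertex(3)[OF T F] by auto
  also have "\<dots> \<longleftrightarrow> (\<forall>i. 0 \<le> facet_coord x i)"
    unfolding facet_coord_def using facet_enum_vertex(1) facet_enum_surj by metis
  finally show ?thesis .
qed

text \<open>The linear part of the map from the reference prism to the prism over \<open>F\<close>:
  the coordinates other than \<open>k\<close> run along the edges that leave \<open>w k\<close>, and
  the coordinate \<open>k\<close> is the height along the unit normal.\<close>

definition facet_lin :: "real^'n \<Rightarrow> real^'n" where
  "facet_lin y = (\<Sum>i\<in>UNIV - {k}. y $ i *\<^sub>R (w i - w k)) + y $ k *\<^sub>R exterior_normal T F"

lemma normal_unit: "exterior_normal T F \<bullet> exterior_normal T F = 1"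
  using norm_exterior_normal[OF T F] by (simp add: norm_eq_1)

lemma linear_facet_lin: "linear facet_lin"
  by (rule linearI) (simp_all add: facet_lin_def scaleR_left_distrib sum.distrib scaleR_right_distrib scaleR_sum_right add_ac)

lemma
  shows facet_proj_lin: "facet_proj T F (w k + facet_lin y) = w k + (\<Sum>i\<in>UNIV - {k}. y $ i *\<^sub>R (w i - w k))"
    and inner_facet_lin: "(w k + facet_lin y) \<bullet> exterior_normal T F = facet_offset T F + y $ k"
proof -
  let ?p = "w k + (\<Sum>i\<in>UNIV - {k}. y $ i *\<^sub>R (w i - w k))"
  have p: "?p \<bullet> exterior_normal T F = facet_offset T F"
    by (simp add: inner_add_left inner_sum_left inner_diff_left facet_enum_vertex(4))
  have eq: "w k + facet_lin y = ?p + y $ k *\<^sub>R exterior_normal T F" by (simp add: facet_lin_def)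
  show "facet_proj T F (w k + facet_lin y) = ?p"
    unfolding eq by (rule facet_proj_line[OF T F p])
  show "(w k + facet_lin y) \<bullet> exterior_normal T F = facet_offset T F + y $ k"
    unfolding eq inner_add_left[of ?p] p by (simp add: normal_unit)
qed

lemma facet_coord_lin: "facet_coord (w k + facet_lin y) i = ref_coord k y i"
proof -
  define u where "u v = ref_coord k y (the_inv w v)" for v
  have inj: "inj w" using w by (simp add: bij_betw_def)
  have uw: "u (w j) = ref_coord k y j" for j by (simp add: u_def the_inv_f_f[OF inj])
  have "bary T (w i) (facet_proj T F (w k + facet_lin y)) = u (w i)"
  proof (rule bary_facet_eqI[OF T F _ _ facet_enum_vertex(1)])
    show "sum u (vertices F) = 1" by (simp add: sum_facet_enum uw sum_ref_coord)
    have "(\<Sum>v\<in>vertices F. u v *\<^sub>R v) = (\<Sum>j\<in>UNIV. ref_coord k y j *\<^sub>R w j)"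
      by (simp add: sum_facet_enum uw)
    also have "\<dots> = ref_coord k y k *\<^sub>R w k + (\<Sum>j\<in>UNIV - {k}. ref_coord k y j *\<^sub>R w j)"
      by (rule sum.remove) auto
    also have "(\<Sum>j\<in>UNIV - {k}. ref_coord k y j *\<^sub>R w j) = (\<Sum>j\<in>UNIV - {k}. y $ j *\<^sub>R w j)"
      by (rule sum.cong) (auto simp: ref_coord_def)
    also have "ref_coord k y k *\<^sub>R w k + \<dots> = w k + (\<Sum>i\<in>UNIV - {k}. y $ i *\<^sub>R (w i - w k))"
      by (simp add: ref_coord_def scaleR_left_diff_distrib scaleR_diff_right sum_subtractf scaleR_left.sum)
    finally show "(\<Sum>v\<in>vertices F. u v *\<^sub>R v) = facet_proj T F (w k + facet_lin y)"
      by (simp only: facet_proj_lin)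
  qed
  then show ?thesis by (simp add: facet_coord_def uw)
qed

lemma facet_prism_lin: "w k + facet_lin y \<in> facet_prism T F \<longleftrightarrow> y \<in> ref_prism k"
  by (auto simp: facet_prism_def[OF T F] inner_facet_lin facet_proj_in_facet_iff facet_coord_lin ref_prism_def)

text \<open>Exhibits the right inverse that the linear change of variables asks for: facet
  coordinates in the entries other than \<open>k\<close>, the height in entry
  \<open>k\<close>.\<close>

lemma facet_lin_surj:
  "facet_lin (\<chi> i. if i = k then (w k + y) \<bullet> exterior_normal T F - facet_offset T F else facet_coord (w k + y) i) = y"
proof -
  let ?z = "w k + y"
  have "facet_proj T F ?z = (\<Sum>i\<in>UNIV. facet_coord ?z i *\<^sub>R w i)" by (rule sum_facet_coord(2)[symmetric])
  moreover have "w k = (\<Sum>i\<in>UNIV. facet_coord ?z i) *\<^sub>R w k" by (simp only: sum_facet_coord(1)) simp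
  ultimately have "facet_proj T F ?z - w k = (\<Sum>i\<in>UNIV. facet_coord ?z i *\<^sub>R w i) - (\<Sum>i\<in>UNIV. facet_coord ?z i) *\<^sub>R w k"
    by simp
  also have "\<dots> = (\<Sum>i\<in>UNIV. facet_coord ?z i *\<^sub>R (w i - w k))"
    by (simp add: scaleR_diff_right sum_subtractf scaleR_left.sum)
  also have "\<dots> = facet_coord ?z k *\<^sub>R (w k - w k) + (\<Sum>i\<in>UNIV - {k}. facet_coord ?z i *\<^sub>R (w i - w k))"
    by (rule sum.remove) auto
  finally have "(\<Sum>i\<in>UNIV - {k}. facet_coord ?z i *\<^sub>R (w i - w k)) = facet_proj T F ?z - w k" by simp
  moreover have "(?z \<bullet> exterior_normal T F - facet_offset T F) *\<^sub>R exterior_normal T F = ?z - facet_proj T F ?z"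
    by (simp add: facet_proj_def[OF T F])
  moreover have "facet_lin (\<chi> i. if i = k then ?z \<bullet> exterior_normal T F - facet_offset T F else facet_coord ?z i)
      = (\<Sum>i\<in>UNIV - {k}. facet_coord ?z i *\<^sub>R (w i - w k)) + (?z \<bullet> exterior_normal T F - facet_offset T F) *\<^sub>R exterior_normal T F"
    unfolding facet_lin_def by (intro arg_cong2[where f = "(+)"] sum.cong) auto
  ultimately show ?thesis by simp
qed

lemma continuous_facet_coord: "continuous_on S (\<lambda>x. facet_coord x i)"
  unfolding facet_coord_def
  by (rule continuous_on_compose2[OF smooth_continuous[OF smooth_bary[OF T facet_enum_vertex(2)], of UNIV] continuous_facet_proj[OF T F]]) simp

text \<open>The factor \<open>D\<close> depends on the facet but not on \<open>f\<close>. Two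
  integrals over the same facet can therefore be compared without knowing it.\<close>

lemma facet_integral_transform:
  obtains D where "0 \<le> D"
    "\<And>f. coord_continuous f \<Longrightarrow> \<forall>\<mu>. 0 \<le> f \<mu> \<Longrightarrow>
      (\<integral>x. indicator (facet_prism T F) x * f (facet_coord x) \<partial>lborel) = D * (\<integral>x. indicator (ref_prism k) x * f (ref_coord k x) \<partial>lborel)"
proof -
  obtain D where D: "0 \<le> D" "\<And>h::real^'n \<Rightarrow> ennreal. h \<in> borel_measurable borel \<Longrightarrow>
      (\<integral>\<^sup>+x. h x \<partial>lborel) = ennreal D * (\<integral>\<^sup>+y. h (facet_lin y) \<partial>lborel)"
    by (rule nn_integral_lborel_linear[OF linear_facet_lin facet_lin_surj]) (rule that)
  show thesis
  proof (rule that[OF D(1)])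
    fix f :: "('n \<Rightarrow> real) \<Rightarrow> real"
    assume "coord_continuous f" and "\<forall>\<mu>. 0 \<le> f \<mu>"
    then have cont: "\<And>\<mu> :: real^'n \<Rightarrow> 'n \<Rightarrow> real. (\<And>i. continuous_on UNIV (\<lambda>x. \<mu> x i)) \<Longrightarrow> continuous_on UNIV (\<lambda>x. f (\<mu> x))"
      and f0: "\<And>\<mu>. 0 \<le> f \<mu>"
      by (simp_all add: coord_continuous_def)
    define g where "g x = indicator (facet_prism T F) x * f (facet_coord x)" for x
    define h where "h x = indicator (ref_prism k) x * f (ref_coord k x)" for x
    have gm [measurable]: "g \<in> borel_measurable borel"
      unfolding g_def using compact_facet_prism[OF T F]
      by (intro borel_measurable_times borel_measurable_indicator borel_compact borel_measurable_continuous_onI cont continuous_facet_coord)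
    have hm: "h \<in> borel_measurable borel"
      unfolding h_def using compact_ref_prism
      by (intro borel_measurable_times borel_measurable_indicator borel_compact borel_measurable_continuous_onI cont continuous_ref_coord)
    have gh: "g (w k + facet_lin y) = h y" for y
    proof -
      have "facet_coord (w k + facet_lin y) = ref_coord k y" by (rule ext) (rule facet_coord_lin)
      then show ?thesis by (simp add: g_def h_def indicator_def facet_prism_lin)
    qed
    have pos: "0 \<le> g x" "0 \<le> h x" for x by (simp_all add: g_def h_def f0)
    have "(\<integral>\<^sup>+x. ennreal (g x) \<partial>lborel) = (\<integral>\<^sup>+x. ennreal (g (x + w k)) \<partial>lborel)"
      by (rule nn_integral_lborel_translate[where h = "\<lambda>x. ennreal (g x)", symmetric]) measurable
    also have "\<dots> = ennreal D * (\<integral>\<^sup>+y. ennreal (g (facet_lin y + w k)) \<partial>lborel)"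
      by (rule D(2)) measurable
    also have "(\<lambda>y. ennreal (g (facet_lin y + w k))) = (\<lambda>y. ennreal (h y))"
      by (rule ext) (simp add: gh[symmetric] add.commute)
    finally have nn: "(\<integral>\<^sup>+x. ennreal (g x) \<partial>lborel) = ennreal D * (\<integral>\<^sup>+y. ennreal (h y) \<partial>lborel)" .
    have "(\<integral>x. g x \<partial>lborel) = enn2real (\<integral>\<^sup>+x. ennreal (g x) \<partial>lborel)"
      by (rule integral_eq_nn_integral) (use gm pos in auto)
    also have "\<dots> = D * enn2real (\<integral>\<^sup>+x. ennreal (h x) \<partial>lborel)"
      unfolding nn by (simp add: enn2real_mult D(1))
    also have "enn2real (\<integral>\<^sup>+x. ennreal (h x) \<partial>lborel) = (\<integral>x. h x \<partial>lborel)"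
      by (rule integral_eq_nn_integral[symmetric]) (use hm pos in auto)
    finally show "(\<integral>x. indicator (facet_prism T F) x * f (facet_coord x) \<partial>lborel) = D * (\<integral>x. indicator (ref_prism k) x * f (ref_coord k x) \<partial>lborel)"
      unfolding g_def h_def .
  qed
qed

text \<open>The surface measure of \<open>F\<close>, since the prism has height one.\<close>

definition facet_area :: real where
  "facet_area = measure lborel (facet_prism T F)"

lemma facet_area_eq: "facet_area = (\<integral>x. indicator (facet_prism T F) x \<partial>lborel)"
  using compact_facet_prism[OF T F] by (simp add: facet_area_def borel_compact)

text \<open>The area is the transformed integral of 1 and the right side that of the weighted
  square; both carry the same factor \<open>D\<close>, so the estimate on the reference facet scales
  to \<open>F\<close> with a constant independent of its size and shape.\<close>

lemma facet_form_ge: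
  assumes c: "(\<Sum>S\<in>UNIV. \<bar>c $ S\<bar>)\<^sup>2 \<le> C * ref_form k \<beta> c"
  shows "facet_area * (\<Sum>S\<in>UNIV. \<bar>c $ S\<bar>)\<^sup>2 \<le> C * measure lborel (ref_prism k) *
    (\<integral>x. indicator (facet_prism T F) x * ((mpoly c (facet_coord x))\<^sup>2 * layer_weight \<beta> (facet_coord x)) \<partial>lborel)"
proof -
  obtain D where D: "0 \<le> D" and tr: "\<And>f. coord_continuous f \<Longrightarrow> \<forall>\<mu>. 0 \<le> f \<mu> \<Longrightarrow>
      (\<integral>x. indicator (facet_prism T F) x * f (facet_coord x) \<partial>lborel) = D * (\<integral>x. indicator (ref_prism k) x * f (ref_coord k x) \<partial>lborel)"
    by (rule facet_integral_transform) (rule that)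
  have "(\<integral>x. indicator (facet_prism T F) x * (1::real) \<partial>lborel) = D * (\<integral>x. indicator (ref_prism k) x * 1 \<partial>lborel)"
    by (rule tr[where f = "\<lambda>_. 1"]) (auto simp: coord_continuous_def)
  then have area: "facet_area = D * measure lborel (ref_prism k)"
    using compact_ref_prism by (simp add: facet_area_eq borel_compact)
  have form: "(\<integral>x. indicator (facet_prism T F) x * ((mpoly c (facet_coord x))\<^sup>2 * layer_weight \<beta> (facet_coord x)) \<partial>lborel) = D * ref_form k \<beta> c"
    unfolding ref_form_def
  proof (rule tr[where f = "\<lambda>\<mu>. (mpoly c \<mu>)\<^sup>2 * layer_weight \<beta> \<mu>"])
    show "coord_continuous (\<lambda>\<mu>. (mpoly c \<mu>)\<^sup>2 * layer_weight \<beta> \<mu>)"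
      unfolding coord_continuous_def mpoly_def layer_weight_def
      by (intro allI impI continuous_on_mult continuous_on_power continuous_on_sum continuous_on_const continuous_on_prod
            continuous_on_compose2[OF continuous_bump[of UNIV]] continuous_on_diff; simp)
  qed (simp add: layer_weight_bounds)
  have "D * measure lborel (ref_prism k) * (\<Sum>S\<in>UNIV. \<bar>c $ S\<bar>)\<^sup>2 \<le> D * measure lborel (ref_prism k) * (C * ref_form k \<beta> c)"
    using c D by (intro mult_left_mono) auto
  then show ?thesis unfolding area form by (simp only: mult_ac)
qed

end

section \<open>The test function attached to a facet\<close>

section \<open>Bounds for products of smooth functions\<close>

text \<open>Bounds at a single point, in a form that the sum and product rules propagate. They are
  pointwise because the affine factors are bounded by one only above and below the facet.\<close>

definition smooth_bound :: "(real^'n::finite \<Rightarrow> real) \<Rightarrow> real^'n \<Rightarrow> real \<Rightarrow> real \<Rightarrow> bool" where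
  "smooth_bound f x A D \<longleftrightarrow> smooth f \<and> \<bar>f x\<bar> \<le> A \<and> norm (gradient f x) \<le> D"

lemma smooth_bound_nonneg: "smooth_bound f x A D \<Longrightarrow> 0 \<le> A \<and> 0 \<le> D"
  unfolding smooth_bound_def using abs_ge_zero norm_ge_zero order_trans by blast

lemma smooth_bound_const: "smooth_bound (\<lambda>_. c) x \<bar>c\<bar> 0"
proof -
  have "gradient (\<lambda>_::real^'a. c) x = 0"
    by (rule gradient_eq) simp
  then show ?thesis by (simp add: smooth_bound_def smooth_const)
qed

lemma smooth_bound_mult:
  assumes f: "smooth_bound f x A D" and g: "smooth_bound g x B E"
  shows "smooth_bound (\<lambda>x. f x * g x) x (A * B) (D * B + A * E)"
proof -
  have s: "smooth f" "smooth g" using f g by (simp_all add: smooth_bound_def)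
  have eq: "gradient (\<lambda>x. f x * g x) x = g x *\<^sub>R gradient f x + f x *\<^sub>R gradient g x"
    by (simp add: vec_eq_iff partial_mult smooth_differentiable s)
  have "norm (gradient (\<lambda>x. f x * g x) x) \<le> \<bar>g x\<bar> * norm (gradient f x) + \<bar>f x\<bar> * norm (gradient g x)"
    unfolding eq using norm_triangle_ineq[of "g x *\<^sub>R gradient f x" "f x *\<^sub>R gradient g x"] by simp
  also have "\<dots> \<le> B * D + A * E"
    using f g smooth_bound_nonneg[OF f] smooth_bound_nonneg[OF g]
    by (intro add_mono mult_mono) (simp_all add: smooth_bound_def)
  finally have "norm (gradient (\<lambda>x. f x * g x) x) \<le> D * B + A * E" by (simp add: mult.commute)
  moreover have "\<bar>f x * g x\<bar> \<le> A * B"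
    unfolding abs_mult using f g smooth_bound_nonneg[OF f] by (intro mult_mono) (simp_all add: smooth_bound_def)
  ultimately show ?thesis by (simp add: smooth_bound_def smooth_mult s)
qed

lemma smooth_bound_add:
  assumes f: "smooth_bound f x A D" and g: "smooth_bound g x B E"
  shows "smooth_bound (\<lambda>x. f x + g x) x (A + B) (D + E)"
proof -
  have s: "smooth f" "smooth g" using f g by (simp_all add: smooth_bound_def)
  have "gradient (\<lambda>x. f x + g x) x = gradient f x + gradient g x"
    by (simp add: vec_eq_iff partial_add smooth_differentiable s)
  then have "norm (gradient (\<lambda>x. f x + g x) x) \<le> D + E"
    using norm_triangle_ineq[of "gradient f x" "gradient g x"] f g by (simp add: smooth_bound_def)
  moreover have "\<bar>f x + g x\<bar> \<le> A + B"
    using f g abs_triangle_ineq[of "f x" "g x"] unfolding smooth_bound_def by linarith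
  ultimately show ?thesis by (simp add: smooth_bound_def smooth_add s)
qed

lemma smooth_bound_prod:
  assumes "finite I" "\<And>i. i \<in> I \<Longrightarrow> smooth_bound (f i) x 1 D"
  shows "smooth_bound (\<lambda>x. \<Prod>i\<in>I. f i x) x 1 (real (card I) * D)"
  using assms
proof (induction I rule: finite_induct)
  case empty
  show ?case using smooth_bound_const[of 1 x] by simp
next
  case (insert i I)
  have "smooth_bound (\<lambda>x. f i x * (\<Prod>i\<in>I. f i x)) x (1 * 1) (D * 1 + 1 * (real (card I) * D))"
    using insert by (intro smooth_bound_mult) auto
  then show ?case using insert by (simp add: algebra_simps)
qed

lemma smooth_bound_sum:
  assumes "finite I" "\<And>i. i \<in> I \<Longrightarrow> smooth_bound (f i) x (A i) (D i)"
  shows "smooth_bound (\<lambda>x. \<Sum>i\<in>I. f i x) x (\<Sum>i\<in>I. A i) (\<Sum>i\<in>I. D i)"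
  using assms
proof (induction I rule: finite_induct)
  case empty
  show ?case using smooth_bound_const[of 0 x] by simp
next
  case (insert i I)
  then show ?case using smooth_bound_add[of "f i" x "A i" "D i" "\<lambda>x. \<Sum>i\<in>I. f i x"] by simp
qed

lemma smooth_bound_mono: "smooth_bound f x A D \<Longrightarrow> A \<le> A' \<Longrightarrow> D \<le> D' \<Longrightarrow> smooth_bound f x A' D'"
  by (simp add: smooth_bound_def)

lemma smooth_bound_affine:
  assumes "\<bar>g \<bullet> x + c\<bar> \<le> A"
  shows "smooth_bound (\<lambda>x. g \<bullet> x + c) x A (norm g)"
proof -
  have "gradient (\<lambda>x. g \<bullet> x + c) x = g"
    by (rule gradient_eq) (auto intro!: derivative_eq_intros)
  with assms show ?thesis by (simp add: smooth_bound_def smooth_affine)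
qed

lemma smooth_bound_bump: "smooth_bound (\<lambda>x. bump (g \<bullet> x + c)) x 1 (2 * norm g)"
  unfolding smooth_bound_def gradient_bump_affine
  using bump_bounds[of "g \<bullet> x + c"] mult_right_mono[OF bump_deriv_bound[of "g \<bullet> x + c"] norm_ge_zero[of g]]
  by (simp add: smooth_bump_affine)

section \<open>Test functions concentrated near a facet\<close>

context
  fixes m :: "'n::finite \<Rightarrow> real^'n" and e :: "'n \<Rightarrow> real" and n :: "real^'n" and off \<delta> G \<beta> :: real
    and c :: "real^('n set)"
  assumes n: "norm n = 1" and \<delta>: "0 < \<delta>" and G: "\<And>i. norm (m i) \<le> G"
begin

definition layer_function :: "real^'n \<Rightarrow> real" where
  "layer_function x = mpoly c (\<lambda>i. m i \<bullet> x + e i) * layer_weight \<beta> (\<lambda>i. m i \<bullet> x + e i)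
     * (bump (1 - (x \<bullet> n - off) / \<delta>) * bump (1 + (x \<bullet> n - off) / \<delta>))"

text \<open>With d factors of gradient at most G, the polynomial contributes d G and the tangential
  weight 2 d G, as \<open>bump\<close> has slope at most 2; each of the two normal cut-offs
  contributes 2 / \<delta>.\<close>

lemma layer_function_bound:
  assumes x: "\<And>i. 0 \<le> m i \<bullet> x + e i" "\<And>i. m i \<bullet> x + e i \<le> 1"
  shows "smooth_bound layer_function x (\<Sum>S\<in>UNIV. \<bar>c $ S\<bar>)
     ((\<Sum>S\<in>UNIV. \<bar>c $ S\<bar>) * (3 * real CARD('n) * G + 4 / \<delta>))"
proof -
  let ?N = "real CARD('n)" and ?L = "\<Sum>S\<in>UNIV. \<bar>c $ S\<bar>"
  have G0: "0 \<le> G" using G order_trans[OF norm_ge_zero] by blast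
  have coord: "smooth_bound (\<lambda>x. m i \<bullet> x + e i) x 1 G" for i
    using x[of i] G[of i] by (intro smooth_bound_mono[OF smooth_bound_affine[where A = 1]]) auto
  have mono: "smooth_bound (\<lambda>x. \<Prod>i\<in>S. m i \<bullet> x + e i) x 1 (?N * G)" for S
  proof (rule smooth_bound_mono[OF smooth_bound_prod])
    show "real (card S) * G \<le> ?N * G" using G0 by (intro mult_right_mono) (auto intro: card_mono)
  qed (use coord in auto)
  have "smooth_bound (\<lambda>x. c $ S * (\<Prod>i\<in>S. m i \<bullet> x + e i)) x (\<bar>c $ S\<bar> * 1) (0 * 1 + \<bar>c $ S\<bar> * (?N * G))" for S
    by (rule smooth_bound_mult[OF smooth_bound_const mono])
  from smooth_bound_sum[OF finite this]
  have p: "smooth_bound (\<lambda>x. mpoly c (\<lambda>i. m i \<bullet> x + e i)) x ?L (?L * (?N * G))"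
    unfolding mpoly_def by (simp add: sum_distrib_right)
  have "smooth_bound (\<lambda>x. bump (m i \<bullet> x + e i - \<beta>)) x 1 (2 * G)" for i
    using smooth_bound_mono[OF smooth_bound_bump[of "m i" "e i - \<beta>" x], of 1 "2 * G"] G[of i]
    by (simp add: add_diff_eq)
  then have w: "smooth_bound (\<lambda>x. layer_weight \<beta> (\<lambda>i. m i \<bullet> x + e i)) x 1 (?N * (2 * G))"
    unfolding layer_weight_def by (rule smooth_bound_prod[OF finite])
  have "(\<lambda>x. bump (1 - (x \<bullet> n - off) / \<delta>)) = (\<lambda>x. bump ((- (n /\<^sub>R \<delta>)) \<bullet> x + (1 + off / \<delta>)))"
    "(\<lambda>x. bump (1 + (x \<bullet> n - off) / \<delta>)) = (\<lambda>x. bump ((n /\<^sub>R \<delta>) \<bullet> x + (1 - off / \<delta>)))"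
    by (simp_all add: inner_commute[of n] diff_divide_distrib divide_inverse mult.commute algebra_simps)
  then have b: "smooth_bound (\<lambda>x. bump (1 - (x \<bullet> n - off) / \<delta>)) x 1 (2 / \<delta>)"
    "smooth_bound (\<lambda>x. bump (1 + (x \<bullet> n - off) / \<delta>)) x 1 (2 / \<delta>)"
    using smooth_bound_bump[of "- (n /\<^sub>R \<delta>)" "1 + off / \<delta>" x] smooth_bound_bump[of "n /\<^sub>R \<delta>" "1 - off / \<delta>" x] n \<delta>
    by (simp_all add: divide_inverse)
  have "smooth_bound layer_function x (?L * 1 * (1 * 1))
      ((?L * (?N * G) * 1 + ?L * (?N * (2 * G))) * (1 * 1) + ?L * 1 * (2 / \<delta> * 1 + 1 * (2 / \<delta>)))"
    unfolding layer_function_def[abs_def]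
    by (rule smooth_bound_mult[OF smooth_bound_mult[OF p w] smooth_bound_mult[OF b]])
  then show ?thesis by (simp add: algebra_simps)
qed

lemma layer_function_support:
  assumes "layer_function x \<noteq> 0"
  shows "\<And>i. \<beta> < m i \<bullet> x + e i" "\<bar>x \<bullet> n - off\<bar> < \<delta>"
proof -
  have "layer_weight \<beta> (\<lambda>i. m i \<bullet> x + e i) \<noteq> 0" using assms by (auto simp: layer_function_def)
  then have "bump (m i \<bullet> x + e i - \<beta>) \<noteq> 0" for i by (auto simp: layer_weight_def)
  then show "\<And>i. \<beta> < m i \<bullet> x + e i" using bump_pos_iff bump_bounds(1) by (smt (verit))
  have "bump (1 - (x \<bullet> n - off) / \<delta>) \<noteq> 0" "bump (1 + (x \<bullet> n - off) / \<delta>) \<noteq> 0"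
    using assms by (auto simp: layer_function_def)
  then have "0 < 1 - (x \<bullet> n - off) / \<delta>" "0 < 1 + (x \<bullet> n - off) / \<delta>"
    using bump_pos_iff bump_bounds(1) by (smt (verit))+
  then show "\<bar>x \<bullet> n - off\<bar> < \<delta>" using \<delta> by (auto simp: abs_less_iff field_simps)
qed

end

context
  fixes T F :: "(real^'n::finite) set" and w :: "'n \<Rightarrow> real^'n" and \<beta> \<delta> :: real
  assumes T: "int CARD('n) simplex T" and F: "F \<in> facets T" and w: "bij_betw w UNIV (vertices F)"
    and \<beta>: "0 < \<beta>" and \<delta>: "0 < \<delta>"
begin

text \<open>The gradient of a facet coordinate extended constantly along the normal, hence the
  tangential part of the gradient of the barycentric coordinate.\<close>

definition tangential_grad :: "'n \<Rightarrow> real^'n" where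
  "tangential_grad i = bary_grad T (w i) - (bary_grad T (w i) \<bullet> exterior_normal T F) *\<^sub>R exterior_normal T F"

lemma facet_coord_affine:
  "facet_coord T F w x i = tangential_grad i \<bullet> x + facet_coord T F w 0 i"
proof -
  have "facet_coord T F w x i - facet_coord T F w 0 i
      = bary_grad T (w i) \<bullet> (facet_proj T F x - facet_proj T F 0)"
    unfolding facet_coord_def[OF T F w] by (rule bary_diff[OF T facet_enum_vertex(2)[OF T F w]])
  also have "facet_proj T F x - facet_proj T F 0 = x - (x \<bullet> exterior_normal T F) *\<^sub>R exterior_normal T F"
    by (simp add: facet_proj_def[OF T F] algebra_simps)
  also have "bary_grad T (w i) \<bullet> \<dots> = tangential_grad i \<bullet> x"
    by (simp add: tangential_grad_def inner_diff_left inner_diff_right inner_commute[of x])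
  finally show ?thesis by simp
qed

lemma norm_tangential_grad: "norm (tangential_grad i) \<le> norm (bary_grad T (w i))"
proof -
  have "tangential_grad i \<bullet> tangential_grad i
    = bary_grad T (w i) \<bullet> bary_grad T (w i) - (bary_grad T (w i) \<bullet> exterior_normal T F)\<^sup>2"
    using normal_unit[OF T F w]
    by (simp add: tangential_grad_def inner_diff_left inner_diff_right inner_commute power2_eq_square)
  also have "\<dots> \<le> bary_grad T (w i) \<bullet> bary_grad T (w i)" by simp
  finally show ?thesis by (simp add: norm_le)
qed

definition facet_layer :: "(real^'n) set" where
  "facet_layer = {x. (\<forall>i. \<beta> \<le> facet_coord T F w x i) \<and> \<bar>x \<bullet> exterior_normal T F - facet_offset T F\<bar> \<le> \<delta>}"

lemma facet_layer_proj: "x \<in> facet_layer \<Longrightarrow> facet_proj T F x \<in> F"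
  using \<beta> facet_proj_in_facet_iff[OF T F w, of x]
  by (auto simp: facet_layer_def intro: order_trans[OF less_imp_le])

lemma facet_layer_coord: "x \<in> facet_layer \<Longrightarrow> 0 \<le> facet_coord T F w x i" "x \<in> facet_layer \<Longrightarrow> facet_coord T F w x i \<le> 1"
proof -
  assume x: "x \<in> facet_layer"
  have "facet_proj T F x \<in> T" using facet_layer_proj[OF x] mem_facet_iff[OF T F] by blast
  then show "facet_coord T F w x i \<le> 1"
    unfolding facet_coord_def[OF T F w] by (rule bary_le_1[OF T _ facet_enum_vertex(2)[OF T F w]])
  have "\<beta> \<le> facet_coord T F w x i" using x by (simp add: facet_layer_def)
  then show "0 \<le> facet_coord T F w x i" using \<beta> by linarith
qed

lemma compact_facet_layer: "compact facet_layer"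
proof -
  have "closed facet_layer"
    unfolding facet_layer_def
    by (intro closed_Collect_conj closed_Collect_all closed_Collect_le continuous_facet_coord[OF T F w] continuous_intros)
  moreover have "bounded facet_layer"
  proof -
    obtain B where B: "\<And>y. y \<in> F \<Longrightarrow> norm y \<le> B"
      using compact_imp_bounded[OF compact_facet[OF T F]] unfolding bounded_iff by metis
    have "norm x \<le> B + \<delta>" if x: "x \<in> facet_layer" for x
    proof -
      have eq: "x = facet_proj T F x + (x \<bullet> exterior_normal T F - facet_offset T F) *\<^sub>R exterior_normal T F"
        by (simp add: facet_proj_def[OF T F])
      have "norm x \<le> norm (facet_proj T F x) + norm ((x \<bullet> exterior_normal T F - facet_offset T F) *\<^sub>R exterior_normal T F)"
        by (subst eq) (rule norm_triangle_ineq)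
      also have "\<dots> \<le> B + \<delta>"
        using B[OF facet_layer_proj[OF x]] x norm_exterior_normal[OF T F] by (simp add: facet_layer_def)
      finally show ?thesis .
    qed
    then show ?thesis unfolding bounded_iff by blast
  qed
  ultimately show ?thesis by (simp only: compact_eq_bounded_closed)
qed

text \<open>Moving from the projection to \<open>x\<close> changes a coordinate of a vertex of
  \<open>F\<close> by at most G d, which the assumed margin absorbs. The coordinate of the opposite
  vertex is governed by the side of the hyperplane alone.\<close>

lemma facet_layer_in_simplex:
  assumes G: "\<And>v. v \<in> vertices F \<Longrightarrow> norm (bary_grad T v) \<le> G"
    and x: "\<And>i. G * d \<le> facet_coord T F w x i" and xn: "\<bar>x \<bullet> exterior_normal T F - facet_offset T F\<bar> \<le> d"
      "x \<bullet> exterior_normal T F \<le> facet_offset T F"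
  shows "x \<in> T"
  unfolding mem_simplex_iff[OF T]
proof
  fix v assume v: "v \<in> vertices T"
  show "0 \<le> bary T v x"
  proof (cases "v = opp_vertex T F")
    case True
    have "0 \<le> norm (bary_grad T v) * (facet_offset T F - x \<bullet> exterior_normal T F)"
      using xn(2) by (intro mult_nonneg_nonneg) auto
    then show ?thesis unfolding True bary_opp[OF T F] by (simp add: algebra_simps)
  next
    case False
    then have vF: "v \<in> vertices F" using v by (simp add: facet_opp_vertex(3)[OF T F])
    then obtain i where i: "v = w i" using facet_enum_surj[OF T F w] by blast
    have "bary T v (facet_proj T F x) - bary T v x = bary_grad T v \<bullet> (facet_proj T F x - x)"
      by (rule bary_diff[OF T v])
    also have "\<dots> \<le> norm (bary_grad T v) * norm (facet_proj T F x - x)" by (rule norm_cauchy_schwarz)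
    also have "norm (facet_proj T F x - x) = \<bar>x \<bullet> exterior_normal T F - facet_offset T F\<bar>"
      using norm_exterior_normal[OF T F] by (simp add: facet_proj_def[OF T F])
    also have "norm (bary_grad T v) * \<dots> \<le> G * d"
      using G[OF vF] xn(1) order_trans[OF norm_ge_zero G[OF vF]] by (intro mult_mono) auto
    finally have "bary T v (facet_proj T F x) - bary T v x \<le> G * d" .
    with x[of i] show ?thesis by (simp add: facet_coord_def[OF T F w] i)
  qed
qed

text \<open>Normal lines meet the layer only over \<open>F\<close>, and then in parameters from an
  interval of length 2 \<delta>. The slab of width one over the hyperplane turns this into the area
  of \<open>F\<close>.\<close>

lemma facet_layer_volume: "measure lborel facet_layer \<le> 2 * \<delta> * facet_area T F"
proof -
  let ?n = "exterior_normal T F" and ?c = "facet_offset T F"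
  have nn: "?n \<bullet> ?n = 1" by (rule normal_unit[OF T F w])
  have Lb [measurable]: "facet_layer \<in> sets borel" by (rule borel_compact[OF compact_facet_layer])
  have proj: "facet_proj T F (x + t *\<^sub>R ?n) = facet_proj T F x" for x t
    by (simp add: facet_proj_def[OF T F] inner_add_left nn algebra_simps)
  have inner: "indicator {x. ?c \<le> x \<bullet> ?n \<and> x \<bullet> ?n \<le> ?c + 1} x * (\<integral>\<^sup>+t. indicator facet_layer (x + t *\<^sub>R ?n) \<partial>lborel)
      \<le> ennreal (2 * \<delta>) * indicator (facet_prism T F) x" for x
  proof (cases "x \<in> facet_prism T F")
    case True
    have "(\<integral>\<^sup>+t. indicator facet_layer (x + t *\<^sub>R ?n) \<partial>lborel)
       \<le> (\<integral>\<^sup>+t. indicator {?c - x \<bullet> ?n - \<delta>..?c - x \<bullet> ?n + \<delta>} t \<partial>lborel)"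
    proof (rule nn_integral_mono)
      fix t
      have "t \<in> {?c - x \<bullet> ?n - \<delta>..?c - x \<bullet> ?n + \<delta>}" if "x + t *\<^sub>R ?n \<in> facet_layer"
        using that by (simp add: facet_layer_def inner_add_left nn abs_le_iff)
      then show "(indicator facet_layer (x + t *\<^sub>R ?n) :: ennreal) \<le> indicator {?c - x \<bullet> ?n - \<delta>..?c - x \<bullet> ?n + \<delta>} t"
        by (simp add: indicator_def)
    qed
    also have "\<dots> = ennreal (2 * \<delta>)" using \<delta> by simp
    finally show ?thesis using True by (simp add: indicator_def)
  next
    case False
    have "indicator {x. ?c \<le> x \<bullet> ?n \<and> x \<bullet> ?n \<le> ?c + 1} x * (\<integral>\<^sup>+t. indicator facet_layer (x + t *\<^sub>R ?n) \<partial>lborel) = (0::ennreal)"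
    proof (cases "?c \<le> x \<bullet> ?n \<and> x \<bullet> ?n \<le> ?c + 1")
      case True
      with False have "facet_proj T F x \<notin> F" by (simp add: facet_prism_def[OF T F])
      then have "indicator facet_layer (x + t *\<^sub>R ?n) = (0::ennreal)" for t
        using facet_layer_proj[of "x + t *\<^sub>R ?n"] proj[of x t] by (auto simp: indicator_def)
      then show ?thesis by simp
    qed simp
    then show ?thesis by (simp only: zero_le)
  qed
  have "emeasure lborel facet_layer = (\<integral>\<^sup>+x. indicator {x. ?c \<le> x \<bullet> ?n \<and> x \<bullet> ?n \<le> ?c + 1} x * (\<integral>\<^sup>+t. indicator facet_layer (x + t *\<^sub>R ?n) \<partial>lborel) \<partial>lborel)"
    using nn_integral_slab[of "indicator facet_layer" ?n ?c "?c + 1", OF _ norm_exterior_normal[OF T F]] by simp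
  also have "\<dots> \<le> (\<integral>\<^sup>+x. ennreal (2 * \<delta>) * indicator (facet_prism T F) x \<partial>lborel)"
    by (rule nn_integral_mono) (rule inner)
  also have "\<dots> = ennreal (2 * \<delta>) * emeasure lborel (facet_prism T F)"
    using compact_facet_prism[OF T F] by (intro nn_integral_cmult_indicator) (simp add: borel_compact)
  also have "emeasure lborel (facet_prism T F) = ennreal (facet_area T F)"
    using emeasure_compact_finite[OF compact_facet_prism[OF T F]] unfolding facet_area_def[OF T F w]
    by (intro emeasure_eq_ennreal_measure) auto
  also have "emeasure lborel facet_layer = ennreal (measure lborel facet_layer)"
    using emeasure_compact_finite[OF compact_facet_layer] by (intro emeasure_eq_ennreal_measure) auto
  finally have "ennreal (measure lborel facet_layer) \<le> ennreal (2 * \<delta> * facet_area T F)"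
    using \<delta> by (simp add: ennreal_mult facet_area_def[OF T F w])
  then show ?thesis
    using \<delta> by (subst (asm) ennreal_le_iff) (simp_all add: facet_area_def[OF T F w])
qed

end

lemma bij_vertices:
  fixes T F :: "(real^'n::finite) set"
  assumes T: "int CARD('n) simplex T" and F: "F \<in> facets T"
  obtains w :: "'n \<Rightarrow> real^'n" where "bij_betw w UNIV (vertices F)"
proof -
  have "card (vertices F) = CARD('n)"
    using simplex_vertices(2,3)[OF T] facet_opp_vertex(1,3)[OF T F] by simp
  then show thesis
    using finite_same_card_bij[of "UNIV :: 'n set" "vertices F"] finite_facet_vertices[OF T F] that by auto
qed

lemma facet_poly_mpoly:
  fixes T F :: "(real^'n::finite) set" and w :: "'n \<Rightarrow> real^'n"
  assumes w: "bij_betw w UNIV (vertices F)" and q: "facet_poly T F q"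
  obtains c where "\<And>y. y \<in> F \<Longrightarrow> q y = mpoly c (\<lambda>i. bary T (w i) y)"
proof -
  obtain c where c: "\<forall>y\<in>F. q y = (\<Sum>S\<in>Pow (vertices F). c S * (\<Prod>v\<in>S. bary T v y))"
    using q unfolding facet_poly_def ..
  have inj: "inj w" using w by (simp add: bij_betw_def)
  have bij: "bij_betw ((`) w) UNIV (Pow (vertices F))"
    using bij_betw_Pow[OF w] by simp
  have "q y = mpoly (\<chi> S. c (w ` S)) (\<lambda>i. bary T (w i) y)" if "y \<in> F" for y
  proof -
    have "q y = (\<Sum>S\<in>UNIV. c (w ` S) * (\<Prod>v\<in>w ` S. bary T v y))"
      unfolding bspec[OF c that] by (rule sum.reindex_bij_betw[OF bij, symmetric])
    also have "\<dots> = mpoly (\<chi> S. c (w ` S)) (\<lambda>i. bary T (w i) y)"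
      unfolding mpoly_def
      by (intro sum.cong refl) (simp add: prod.reindex[OF inj_on_subset[OF inj subset_UNIV]])
    finally show ?thesis .
  qed
  then show thesis by (rule that)
qed

lemma smooth_layer_function:
  fixes m :: "'n::finite \<Rightarrow> real^'n"
  assumes "norm n = 1" "0 < \<delta>" "\<And>i. norm (m i) \<le> G"
  shows "smooth (layer_function m e n off \<delta> \<beta> c)"
proof -
  have eq: "(\<lambda>x. bump (1 - (x \<bullet> n - off) / \<delta>)) = (\<lambda>x. bump ((- (n /\<^sub>R \<delta>)) \<bullet> x + (1 + off / \<delta>)))"
    "(\<lambda>x. bump (1 + (x \<bullet> n - off) / \<delta>)) = (\<lambda>x. bump ((n /\<^sub>R \<delta>) \<bullet> x + (1 - off / \<delta>)))"
    by (simp_all add: inner_commute[of n] diff_divide_distrib divide_inverse mult.commute algebra_simps)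
  have b: "smooth (\<lambda>x. bump (1 - (x \<bullet> n - off) / \<delta>))" "smooth (\<lambda>x. bump (1 + (x \<bullet> n - off) / \<delta>))"
    unfolding eq by (rule smooth_bump_affine)+
  have "smooth (\<lambda>x. bump (m i \<bullet> x + e i - \<beta>))" for i
    using smooth_bump_affine[of "m i" "e i - \<beta>"] by (simp add: add_diff_eq)
  then show ?thesis
    unfolding layer_function_def[OF assms, abs_def] mpoly_def layer_weight_def
    by (intro smooth_mult smooth_sum smooth_prod smooth_const smooth_affine b)
qed

context
  fixes T T' F :: "(real^'n::finite) set" and w :: "'n \<Rightarrow> real^'n" and \<beta> \<delta> G :: real and c :: "real^('n set)"
  assumes T: "int CARD('n) simplex T" and F: "F \<in> facets T"
    and T': "int CARD('n) simplex T'" and F': "F \<in> facets T'"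
    and opp: "exterior_normal T' F = - exterior_normal T F" "facet_offset T' F = - facet_offset T F"
    and w: "bij_betw w UNIV (vertices F)"
    and \<beta>: "0 < \<beta>" "\<beta> \<le> 1" and \<delta>: "0 < \<delta>" and small: "4 * G * \<delta> \<le> \<beta>"
    and grads: "\<forall>v\<in>vertices F. norm (bary_grad T v) \<le> G" "\<forall>v\<in>vertices F. norm (bary_grad T' v) \<le> G"
begin

lemma bary_grad_le: "v \<in> vertices F \<Longrightarrow> norm (bary_grad T v) \<le> G" "v \<in> vertices F \<Longrightarrow> norm (bary_grad T' v) \<le> G"
  using grads by auto

lemma facet_proj_opposite: "facet_proj T' F = facet_proj T F"
  by (rule ext) (simp add: facet_proj_def[OF T F] facet_proj_def[OF T' F'] opp algebra_simps)

lemma facet_coord_opposite: "facet_coord T' F w = facet_coord T F w"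
  unfolding facet_coord_def[OF T F w, abs_def] facet_coord_def[OF T' F' w, abs_def] facet_proj_opposite
  using bary_facet_agree[OF T F T' F' facet_proj_in_affine_hull[OF T F] facet_enum_vertex(1)[OF T F w]]
  by (intro ext) simp

text \<open>The two facet measures use prisms on opposite sides of \<open>F\<close>; a translation
  by the unit normal carries one prism onto the other and respects the projection.\<close>

lemma facet_integral_opposite:
  fixes h :: "real^'n \<Rightarrow> real"
  assumes h: "continuous_on UNIV h"
  shows "(LINT y:F|facet_measure T' F. h y) = (LINT y:F|facet_measure T F. h y)"
proof -
  let ?n = "exterior_normal T F"
  have nn: "?n \<bullet> ?n = 1" by (rule normal_unit[OF T F w])
  define g where "g x = indicator (facet_prism T F) x * h (facet_proj T F x)" for x
  have proj: "facet_proj T F (x + ?n) = facet_proj T F x" for x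
    by (simp add: facet_proj_def[OF T F] inner_add_left nn algebra_simps)
  have "x \<in> facet_prism T' F \<longleftrightarrow> x + ?n \<in> facet_prism T F" for x
    by (auto simp: facet_prism_def[OF T F] facet_prism_def[OF T' F'] facet_proj_opposite proj opp inner_add_left nn)
  then have eq: "indicator (facet_prism T' F) x * h (facet_proj T F x) = g (x + ?n)" for x
    by (simp add: g_def proj indicator_def)
  have "g \<in> borel_measurable borel"
    using borel_measurable_integrable[OF facet_integral_full(2)[OF T F h]] by (simp add: g_def[abs_def])
  then have "(\<integral>x. g (x + ?n) \<partial>lborel) = (\<integral>x. g x \<partial>lborel)" by (rule integral_lborel_translate)
  then show ?thesis
    unfolding facet_integral_full(1)[OF T F h] facet_integral_full(1)[OF T' F' h] facet_proj_opposite eq g_def[symmetric] .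
qed

abbreviation (input) "test_fun \<equiv> layer_function (tangential_grad T F w) (facet_coord T F w 0) (exterior_normal T F)
  (facet_offset T F) \<delta> \<beta> c"

lemma bary_grad_le_nonneg: "0 \<le> G"
  using bary_grad_le(1)[OF facet_enum_vertex(1)[OF T F w]] order_trans[OF norm_ge_zero] by blast

lemma tangential_grad_le: "norm (tangential_grad T F w i) \<le> G"
  using norm_tangential_grad[OF T F w \<beta>(1) \<delta>] bary_grad_le(1)[OF facet_enum_vertex(1)[OF T F w]] by (rule order_trans)

lemmas layer_setup = norm_exterior_normal[OF T F] \<delta> tangential_grad_le

text \<open>Treats a larger region than the layer, with half the tangential margin and twice the
  height, so that an open set fits between the layer and T \<union> T'. The condition 4 G \<delta>
  \<le> \<beta> says exactly that G times 2 \<delta> is at most \<beta> / 2.\<close>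

lemma facet_layer_side:
  assumes x: "\<And>i. \<beta> / 2 \<le> facet_coord T F w x i" "\<bar>x \<bullet> exterior_normal T F - facet_offset T F\<bar> \<le> 2 * \<delta>"
  shows "x \<in> T \<longleftrightarrow> x \<bullet> exterior_normal T F \<le> facet_offset T F"
    and "x \<in> T' \<longleftrightarrow> x \<bullet> exterior_normal T' F \<le> facet_offset T' F"
proof -
  have half: "G * (2 * \<delta>) \<le> \<beta> / 2" using small by simp
  have "G * (2 * \<delta>) \<le> facet_coord T F w x i" for i
    using x(1)[of i] half by linarith
  then show "x \<in> T \<longleftrightarrow> x \<bullet> exterior_normal T F \<le> facet_offset T F"
    using facet_layer_in_simplex[OF T F w \<beta>(1) \<delta> bary_grad_le(1) _ x(2)] simplex_le_offset[OF T F] by blast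
  have "G * (2 * \<delta>) \<le> facet_coord T' F w x i" for i
    using x(1)[of i] half unfolding facet_coord_opposite by linarith
  moreover have "\<bar>x \<bullet> exterior_normal T' F - facet_offset T' F\<bar> \<le> 2 * \<delta>" using x(2) by (simp add: opp)
  ultimately show "x \<in> T' \<longleftrightarrow> x \<bullet> exterior_normal T' F \<le> facet_offset T' F"
    using facet_layer_in_simplex[OF T' F' w \<beta>(1) \<delta> bary_grad_le(2), of "2 * \<delta>" x] simplex_le_offset[OF T' F', of x] by blast
qed

lemma facet_layer_side':
  assumes "x \<in> facet_layer T F w \<beta> \<delta>"
  shows "x \<in> T \<longleftrightarrow> x \<bullet> exterior_normal T F \<le> facet_offset T F"
    and "x \<in> T' \<longleftrightarrow> x \<bullet> exterior_normal T' F \<le> facet_offset T' F"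
proof -
  have "\<beta> / 2 \<le> facet_coord T F w x i" for i
  proof -
    have "\<beta> \<le> facet_coord T F w x i" using assms by (simp add: facet_layer_def[OF T F w \<beta>(1) \<delta>])
    then show ?thesis using \<beta> by linarith
  qed
  moreover have "\<bar>x \<bullet> exterior_normal T F - facet_offset T F\<bar> \<le> 2 * \<delta>"
    using assms \<delta> by (simp add: facet_layer_def[OF T F w \<beta>(1) \<delta>])
  ultimately show "x \<in> T \<longleftrightarrow> x \<bullet> exterior_normal T F \<le> facet_offset T F"
    "x \<in> T' \<longleftrightarrow> x \<bullet> exterior_normal T' F \<le> facet_offset T' F"
    by (rule facet_layer_side)+
qed

lemma facet_layer_interior: "facet_layer T F w \<beta> \<delta> \<subseteq> interior (T \<union> T')"
proof -
  let ?s = "\<lambda>x. x \<bullet> exterior_normal T F - facet_offset T F"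
  define U where "U = (\<Inter>i\<in>UNIV. {x. \<beta> / 2 < facet_coord T F w x i}) \<inter> {x. \<bar>?s x\<bar> < 2 * \<delta>}"
  have "open U"
    unfolding U_def
    by (intro open_Int open_INT ballI open_Collect_less continuous_facet_coord[OF T F w] continuous_intros finite)
  moreover have "U \<subseteq> T \<union> T'"
  proof
    fix x assume "x \<in> U"
    then have x: "\<And>i. \<beta> / 2 \<le> facet_coord T F w x i" "\<bar>?s x\<bar> \<le> 2 * \<delta>"
      by (auto simp: U_def intro: less_imp_le)
    show "x \<in> T \<union> T'" using facet_layer_side[OF x] by (auto simp: opp)
  qed
  ultimately have "U \<subseteq> interior (T \<union> T')" by (rule interior_maximal[rotated])
  moreover have "facet_layer T F w \<beta> \<delta> \<subseteq> U"
  proof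
    fix x assume "x \<in> facet_layer T F w \<beta> \<delta>"
    then have x: "\<And>i. \<beta> \<le> facet_coord T F w x i" "\<bar>?s x\<bar> \<le> \<delta>"
      by (simp_all add: facet_layer_def[OF T F w \<beta>(1) \<delta>])
    have "\<beta> / 2 < facet_coord T F w x i" for i using x(1)[of i] \<beta>(1) by linarith
    moreover have "\<bar>?s x\<bar> < 2 * \<delta>" using x(2) \<delta> by linarith
    ultimately show "x \<in> U" by (simp add: U_def)
  qed
  ultimately show ?thesis by (rule subset_trans[rotated])
qed

lemma coord_affine_eq: "(\<lambda>i. tangential_grad T F w i \<bullet> x + facet_coord T F w 0 i) = facet_coord T F w x"
  using facet_coord_affine[OF T F w \<beta>(1) \<delta>, of x] by (intro ext) simp

lemma test_fun_outside: "x \<notin> facet_layer T F w \<beta> \<delta> \<Longrightarrow> test_fun x = 0"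
proof (rule ccontr)
  assume x: "x \<notin> facet_layer T F w \<beta> \<delta>" and "test_fun x \<noteq> 0"
  from layer_function_support[OF layer_setup this(2)]
  have "\<And>i. \<beta> < facet_coord T F w x i" "\<bar>x \<bullet> exterior_normal T F - facet_offset T F\<bar> < \<delta>"
    using facet_coord_affine[OF T F w \<beta>(1) \<delta>, of x] by simp_all
  then have "x \<in> facet_layer T F w \<beta> \<delta>"
    by (simp add: facet_layer_def[OF T F w \<beta>(1) \<delta>] less_imp_le)
  with x show False by blast
qed

lemma test_fun_smooth: "smooth test_fun"
  by (rule smooth_layer_function[OF layer_setup])

lemma test_fun_test_function: "test_fun \<in> test_functions (interior (T \<union> T'))"
  by (rule test_functionsI[OF test_fun_smooth compact_facet_layer[OF T F w \<beta>(1) \<delta>] facet_layer_interior test_fun_outside])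

lemma test_fun_bound:
  assumes "x \<in> facet_layer T F w \<beta> \<delta>"
  shows "\<bar>test_fun x\<bar> \<le> (\<Sum>S\<in>UNIV. \<bar>c $ S\<bar>)"
    and "norm (gradient test_fun x) \<le> (\<Sum>S\<in>UNIV. \<bar>c $ S\<bar>) * ((3 * real CARD('n) + 4) / \<delta>)"
proof -
  let ?L = "\<Sum>S\<in>UNIV. \<bar>c $ S\<bar>"
  have "smooth_bound test_fun x ?L (?L * (3 * real CARD('n) * G + 4 / \<delta>))"
  proof (rule layer_function_bound[OF layer_setup])
    fix i
    show "0 \<le> tangential_grad T F w i \<bullet> x + facet_coord T F w 0 i" "tangential_grad T F w i \<bullet> x + facet_coord T F w 0 i \<le> 1"
      using facet_layer_coord[OF T F w \<beta>(1) \<delta> assms, of i] facet_coord_affine[OF T F w \<beta>(1) \<delta>, of x i] by simp_all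
  qed
  then have b: "\<bar>test_fun x\<bar> \<le> ?L" "norm (gradient test_fun x) \<le> ?L * (3 * real CARD('n) * G + 4 / \<delta>)"
    by (simp_all add: smooth_bound_def)
  show "\<bar>test_fun x\<bar> \<le> ?L" by (rule b(1))
  \<comment> \<open>The tangential gradients are thus dominated by 1 / \<delta>, which leaves a
    single scale in the gradient bound.\<close>
  have "G * \<delta> \<le> 1" using small \<beta>(2) mult_nonneg_nonneg[OF bary_grad_le_nonneg less_imp_le[OF \<delta>]] by linarith
  then have "G \<le> 1 / \<delta>" using \<delta> by (simp add: pos_le_divide_eq)
  then have "3 * real CARD('n) * G \<le> 3 * real CARD('n) * (1 / \<delta>)" by (intro mult_left_mono) auto
  then have "3 * real CARD('n) * G + 4 / \<delta> \<le> (3 * real CARD('n) + 4) / \<delta>"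
    by (simp add: add_divide_distrib)
  then have "?L * (3 * real CARD('n) * G + 4 / \<delta>) \<le> ?L * ((3 * real CARD('n) + 4) / \<delta>)"
    by (intro mult_left_mono sum_nonneg) auto
  with b(2) show "norm (gradient test_fun x) \<le> ?L * ((3 * real CARD('n) + 4) / \<delta>)" by linarith
qed

text \<open>On the hyperplane each normal cut-off equals \<open>bump 1\<close>, that is exp(-1). The
  factor exp 2 in the final constant undoes their product.\<close>

lemma test_fun_facet:
  "test_fun (facet_proj T F x) = mpoly c (facet_coord T F w x) * layer_weight \<beta> (facet_coord T F w x) * exp (- 2)"
proof -
  have "facet_coord T F w (facet_proj T F x) = facet_coord T F w x"
    unfolding facet_coord_def[OF T F w, abs_def] by (simp add: facet_proj_id[OF T F] facet_proj_inner[OF T F])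
  moreover have "bump 1 * bump 1 = exp (- 2)" by (simp add: bump_eq flip: exp_add)
  ultimately show ?thesis
    unfolding layer_function_def[OF layer_setup] coord_affine_eq by (simp add: facet_proj_inner[OF T F])
qed

end

section \<open>Piecewise functions on the mesh and the efficiency estimate\<close>

section \<open>Piecewise functions on a mesh\<close>

lemma L2_extend:
  fixes g :: "'a::euclidean_space \<Rightarrow> 'b::euclidean_space"
  assumes g: "g \<in> L2 V" and V: "V \<subseteq> U" "V \<in> sets lebesgue" "U \<in> sets lebesgue"
  shows "(\<lambda>x. indicator V x *\<^sub>R g x) \<in> L2 U"
proof -
  have "(\<lambda>x. indicator V x *\<^sub>R g x) \<in> borel_measurable lebesgue"
    using L2_measurable[OF g] V by (simp add: borel_measurable_restrict_space_iff)
  then have "(\<lambda>x. indicator V x *\<^sub>R g x) \<in> borel_measurable (lebesgue_on U)"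
    by (rule measurable_restrict_space1)
  moreover have "integrable lebesgue (\<lambda>x. indicator V x *\<^sub>R (norm (g x))\<^sup>2)"
    using L2_integrable[OF g] V by (subst (asm) integrable_restrict_space) auto
  then have "integrable lebesgue (\<lambda>x. indicator U x *\<^sub>R (norm (indicator V x *\<^sub>R g x))\<^sup>2)"
  proof (rule Bochner_Integration.integrable_cong[THEN iffD1, rotated 2])
    show "indicator V x *\<^sub>R (norm (g x))\<^sup>2 = indicator U x *\<^sub>R (norm (indicator V x *\<^sub>R g x))\<^sup>2" for x
      using V(1) by (auto simp: indicator_def)
  qed simp
  then have "integrable (lebesgue_on U) (\<lambda>x. (norm (indicator V x *\<^sub>R g x))\<^sup>2)"
    using V(3) by (subst integrable_restrict_space) auto
  ultimately show ?thesis by (simp add: L2_def)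
qed

lemma L2_zero: "(\<lambda>x. 0) \<in> L2 U"
  by (simp add: L2_def)

lemma L2_sum: "(\<And>i. i \<in> I \<Longrightarrow> f i \<in> L2 U) \<Longrightarrow> (\<lambda>x. \<Sum>i\<in>I. f i x) \<in> L2 U"
  by (induction I rule: infinite_finite_induct) (auto simp: L2_zero intro: L2_add)

lemma l2_inner_restrict:
  assumes "V \<subseteq> U" "U \<in> sets lebesgue" "V \<in> sets lebesgue" "\<And>x. x \<notin> V \<Longrightarrow> f x \<bullet> g x = 0"
  shows "l2_inner U f g = l2_inner V f g"
  unfolding l2_inner_def integral_lebesgue_on[OF assms(2)] integral_lebesgue_on[OF assms(3)]
proof (rule Bochner_Integration.integral_cong[OF refl])
  fix x show "indicator U x * (f x \<bullet> g x) = indicator V x * (f x \<bullet> g x)"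
    using assms(1) assms(4)[of x] by (auto simp: indicator_def)
qed

lemma l2_norm_diff_commute: "l2_norm U (\<lambda>x. f x - g x) = l2_norm U (\<lambda>x. g x - f x)"
proof -
  have "(f x - g x) \<bullet> (f x - g x) = (g x - f x) \<bullet> (g x - f x)" for x
    by (simp add: algebra_simps)
  then show ?thesis by (simp add: l2_norm_def l2_inner_def)
qed

lemma AE_on_interior:
  assumes "AE x in lebesgue_on U. P x" "U \<in> sets lebesgue"
  shows "AE x in lebesgue. x \<in> U \<longrightarrow> P x"
  using assms by (subst (asm) AE_restrict_space_iff) auto

lemma AE_not_frontier:
  fixes T :: "(real^'n::finite) set"
  assumes "int CARD('n) simplex T"
  shows "AE x in lebesgue. x \<notin> frontier T"
proof -
  have "frontier T \<in> null_sets lebesgue"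
    using negligible_convex_frontier[OF convex_simplex[OF assms]] by (simp add: negligible_iff_null_sets)
  then show ?thesis by (rule AE_not_in)
qed

context
  fixes \<Omega> :: "(real^'n::finite) set" and \<T> :: "(real^'n) set set"
  assumes \<Omega>: "lipschitz_domain \<Omega>" and mesh: "mesh_of \<Omega> \<T>" and bounded: "bounded \<Omega>"
begin

lemma domain_open: "open \<Omega>"
  using \<Omega> by (simp add: lipschitz_domain_def)

lemma domain_lebesgue: "\<Omega> \<in> sets lebesgue"
  using domain_open by simp

lemma sum_mesh_interior:
  fixes h :: "(real^'n) set \<Rightarrow> 'b::real_vector"
  assumes T: "T \<in> \<T>" and x: "x \<in> interior T"
  shows "(\<Sum>T'\<in>\<T>. indicator (interior T') x *\<^sub>R h T') = h T"
proof -
  have "(\<Sum>T'\<in>\<T>. indicator (interior T') x *\<^sub>R h T')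
    = indicator (interior T) x *\<^sub>R h T + (\<Sum>T'\<in>\<T> - {T}. indicator (interior T') x *\<^sub>R h T')"
    by (rule sum.remove[OF mesh_finite[OF \<Omega> mesh] T])
  also have "(\<Sum>T'\<in>\<T> - {T}. indicator (interior T') x *\<^sub>R h T') = 0"
  proof (rule sum.neutral, rule ballI)
    fix T' assume T': "T' \<in> \<T> - {T}"
    then have "interior T \<inter> T' = {}" using mesh_interior_disjoint[OF \<Omega> mesh T, of T'] by blast
    then have "x \<notin> interior T'" using x interior_subset[of T'] by blast
    then show "indicator (interior T') x *\<^sub>R h T' = 0" by simp
  qed
  finally show ?thesis using x by simp
qed

lemma div_mesh_interior:
  "T \<in> \<T> \<Longrightarrow> x \<in> interior T \<Longrightarrow> div_mesh \<T> \<tau> x = weak_div (interior T) \<tau> x"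
  using sum_mesh_interior[of T x "\<lambda>T. weak_div (interior T) \<tau> x"] by (simp add: div_mesh_def)

lemma glue_interior: "T \<in> \<T> \<Longrightarrow> x \<in> interior T \<Longrightarrow> glue \<T> \<tau> x = \<tau> T x"
  unfolding glue_def by (rule sum_mesh_interior)

lemma interior_lebesgue: "interior T \<in> sets lebesgue" "bounded (interior T)" if "T \<in> \<T>"
  using bounded_subset[OF bounded mesh_interior[OF \<Omega> mesh that]] by simp_all

lemma div_mesh_L2:
  assumes "\<And>T. T \<in> \<T> \<Longrightarrow> weak_div (interior T) \<tau> \<in> L2 (interior T)"
  shows "div_mesh \<T> \<tau> \<in> L2 \<Omega>"
proof -
  have "(\<lambda>x. indicator (interior T) x *\<^sub>R weak_div (interior T) \<tau> x) \<in> L2 \<Omega>" if "T \<in> \<T>" for T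
    by (rule L2_extend[OF assms[OF that] mesh_interior[OF \<Omega> mesh that] interior_lebesgue(1)[OF that] domain_lebesgue])
  then show ?thesis
    unfolding div_mesh_def[abs_def] using L2_sum[of \<T> "\<lambda>T x. indicator (interior T) x *\<^sub>R weak_div (interior T) \<tau> x" \<Omega>]
    by simp
qed

lemma glue_L2:
  assumes "\<And>T i. T \<in> \<T> \<Longrightarrow> smooth (\<lambda>x. \<tau> T x $ i)"
  shows "glue \<T> \<tau> \<in> L2 \<Omega>"
  unfolding glue_def[abs_def]
proof (rule L2_sum)
  fix T assume T: "T \<in> \<T>"
  have "\<tau> T \<in> L2 (interior T)"
    by (rule L2_continuous[OF continuous_on_smooth_vec[OF assms[OF T]] interior_lebesgue[OF T]])
  then show "(\<lambda>x. indicator (interior T) x *\<^sub>R \<tau> T x) \<in> L2 \<Omega>"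
    by (rule L2_extend[OF _ mesh_interior[OF \<Omega> mesh T] interior_lebesgue(1)[OF T] domain_lebesgue])
qed

text \<open>The elements cover \<Omega>, and a point outside all their interiors lies on the
  frontier of a convex set, which is a null set.\<close>

lemma l2_inner_mesh:
  fixes f g :: "real^'n \<Rightarrow> 'b::euclidean_space"
  assumes f: "f \<in> L2 \<Omega>" and g: "g \<in> L2 \<Omega>"
  shows "l2_inner \<Omega> f g = (\<Sum>T\<in>\<T>. l2_inner (interior T) f g)"
proof -
  define h where "h x = f x \<bullet> g x" for x
  have h: "integrable (lebesgue_on \<Omega>) h" unfolding h_def by (rule L2_inner_integrable[OF f g])
  have int: "integrable lebesgue (\<lambda>x. indicator \<Omega> x * h x)"
    using h domain_lebesgue by (subst (asm) integrable_restrict_space) auto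
  have intT: "integrable lebesgue (\<lambda>x. indicator (interior T) x * h x)" if "T \<in> \<T>" for T
  proof -
    have "integrable lebesgue (\<lambda>x. indicator (interior T) x *\<^sub>R (indicator \<Omega> x * h x))"
      by (rule integrable_mult_indicator[OF interior_lebesgue(1)[OF that] int])
    also have "(\<lambda>x. indicator (interior T) x *\<^sub>R (indicator \<Omega> x * h x)) = (\<lambda>x. indicator (interior T) x * h x)"
      using mesh_interior[OF \<Omega> mesh that] by (auto simp: indicator_def fun_eq_iff)
    finally show ?thesis .
  qed
  have "AE x in lebesgue. \<forall>T\<in>\<T>. x \<notin> frontier T"
    by (rule AE_finite_allI[OF mesh_finite[OF \<Omega> mesh]]) (rule AE_not_frontier[OF mesh_simplex[OF \<Omega> mesh]])
  then have ae: "AE x in lebesgue. indicator \<Omega> x * h x = (\<Sum>T\<in>\<T>. indicator (interior T) x * h x)"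
  proof eventually_elim
    case (elim x)
    show ?case
    proof (cases "x \<in> \<Omega>")
      case True
      then have "x \<in> \<Union>\<T>" unfolding mesh_Union[OF \<Omega> mesh] by (rule subsetD[OF closure_subset])
      then obtain T where T: "T \<in> \<T>" "x \<in> T" by blast
      have "x \<in> interior T"
        using elim T closure_subset[of T] unfolding frontier_def by blast
      from sum_mesh_interior[OF T(1) this, of "\<lambda>_. h x"] True show ?thesis by simp
    next
      case False
      then have "x \<notin> interior T" if "T \<in> \<T>" for T using mesh_interior[OF \<Omega> mesh that] by blast
      then show ?thesis using False by simp
    qed
  qed
  have "l2_inner \<Omega> f g = (LINT x|lebesgue. indicator \<Omega> x * h x)"
    unfolding l2_inner_def integral_lebesgue_on[OF domain_lebesgue] h_def ..
  also have "\<dots> = (LINT x|lebesgue. (\<Sum>T\<in>\<T>. indicator (interior T) x * h x))"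
    using ae int intT by (intro integral_cong_AE borel_measurable_integrable Bochner_Integration.integrable_sum)
  also have "\<dots> = (\<Sum>T\<in>\<T>. LINT x|lebesgue. indicator (interior T) x * h x)"
    by (rule Bochner_Integration.integral_sum) (rule intT)
  also have "\<dots> = (\<Sum>T\<in>\<T>. l2_inner (interior T) f g)"
    by (rule sum.cong[OF refl]) (simp add: l2_inner_def integral_lebesgue_on interior_lebesgue h_def)
  finally show ?thesis .
qed

text \<open>Test functions belong to \<open>H10\<close>, so their traces are admissible in the
  second equation. Summed over the elements, the vanishing of such a pairing is the defining
  identity of the weak divergence, with the piecewise divergence as its value.\<close>

lemma orthogonal_W_imp_Hdiv:
  assumes \<sigma>: "\<sigma> \<in> Sigma_space \<Omega> \<T>" and \<epsilon>: "0 < \<epsilon>" and orth: "\<forall>v\<in>W_space \<Omega> \<T>. b_dual \<epsilon> v \<sigma> = 0"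
  shows "\<sigma> \<in> Hdiv \<Omega>"
proof -
  have \<sigma>L: "\<sigma> \<in> L2 \<Omega>" and \<sigma>T: "\<And>T. T \<in> \<T> \<Longrightarrow> \<sigma> \<in> Hdiv (interior T)"
    using \<sigma> by (auto simp: Sigma_space_def)
  have div: "div_mesh \<T> \<sigma> \<in> L2 \<Omega>"
    by (rule div_mesh_L2) (rule weak_div_in_Hdiv(1)[OF \<sigma>T])
  have "l2_inner \<Omega> \<sigma> (gradient \<phi>) = - l2_inner \<Omega> (div_mesh \<T> \<sigma>) \<phi>" if \<phi>: "\<phi> \<in> test_functions \<Omega>" for \<phi>
  proof -
    have "trace_grad \<Omega> \<T> \<phi> \<in> W_space \<Omega> \<T>"
      unfolding W_space_def using test_functions_subset_H10[OF domain_open bounded] \<phi> by blast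
    then have "trace_grad \<Omega> \<T> \<phi> \<sigma> = 0"
      using orth \<epsilon> by (auto simp: b_dual_def)
    then have 0: "(\<Sum>T\<in>\<T>. l2_inner (interior T) (weak_div (interior T) \<sigma>) \<phi>
            + l2_inner (interior T) \<sigma> (weak_grad \<Omega> \<phi>)) = 0"
      using \<sigma> by (simp add: trace_grad_def)
    note wg = weak_grad_test_function[OF domain_open bounded \<phi>]
    note \<phi>L = test_functions_L2[OF \<phi> domain_lebesgue bounded]
    have "l2_inner (interior T) (weak_div (interior T) \<sigma>) \<phi> = l2_inner (interior T) (div_mesh \<T> \<sigma>) \<phi>" if "T \<in> \<T>" for T
      by (rule l2_inner_cong) (simp add: div_mesh_interior[OF that])
    then have "(\<Sum>T\<in>\<T>. l2_inner (interior T) (div_mesh \<T> \<sigma>) \<phi>) + (\<Sum>T\<in>\<T>. l2_inner (interior T) \<sigma> (weak_grad \<Omega> \<phi>)) = 0"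
      using 0 by (simp add: sum.distrib)
    then have "l2_inner \<Omega> (div_mesh \<T> \<sigma>) \<phi> + l2_inner \<Omega> \<sigma> (weak_grad \<Omega> \<phi>) = 0"
      by (simp only: l2_inner_mesh[OF div \<phi>L(1)] l2_inner_mesh[OF \<sigma>L wg(1)])
    \<comment> \<open>The trace is defined with the chosen weak gradient, which agrees with the
      classical one almost everywhere.\<close>
    moreover have "l2_inner \<Omega> \<sigma> (weak_grad \<Omega> \<phi>) = l2_inner \<Omega> \<sigma> (gradient \<phi>)"
      using wg(2) by (intro l2_inner_cong_AE L2_measurable \<sigma>L wg(1) \<phi>L(3)) (auto elim!: eventually_mono)
    ultimately show ?thesis by simp
  qed
  then have "has_weak_divergence \<sigma> (div_mesh \<T> \<sigma>) \<Omega>" by (simp add: has_weak_divergence_def)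
  with \<sigma>L div show ?thesis by (auto simp: Hdiv_def)
qed

lemma interior_in_patch:
  assumes "T' \<in> \<T>" "T \<inter> T' \<noteq> {}"
  shows "interior T' \<subseteq> patch \<T> T"
  unfolding patch_def using assms by (intro interior_mono) blast

lemma patch_lebesgue: "patch \<T> T \<in> sets lebesgue"
  by (simp add: patch_def)

text \<open>The divergence theorem on each of the two elements. Off T \<union> T' the function
  \<phi> vanishes, and on its support each element looks like the half-space behind
  \<open>F\<close>, so no other facet contributes. The two boundary integrals add up to the jump
  because the normals are opposite.\<close>

lemma jump_identity:
  assumes T: "T \<in> \<T>" "F \<in> facets T" and T': "T' \<in> \<T>" "F \<in> facets T'" and ne: "T \<noteq> T'"
    and \<tau>: "\<And>T i. T \<in> \<T> \<Longrightarrow> smooth (\<lambda>x. \<tau> T x $ i)"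
    and \<phi>: "\<phi> \<in> test_functions (interior (T \<union> T'))"
    and K: "compact K" "\<And>x. x \<notin> K \<Longrightarrow> \<phi> x = 0"
      "\<And>x. x \<in> K \<Longrightarrow> x \<in> T \<longleftrightarrow> x \<bullet> exterior_normal T F \<le> facet_offset T F"
      "\<And>x. x \<in> K \<Longrightarrow> x \<in> T' \<longleftrightarrow> x \<bullet> exterior_normal T' F \<le> facet_offset T' F"
  shows "l2_inner (patch \<T> T) (div_mesh \<T> (glue \<T> \<tau>)) \<phi> + l2_inner (patch \<T> T) (glue \<T> \<tau>) (gradient \<phi>)
       = (LINT y:F|facet_measure T F. (\<tau> T y \<bullet> exterior_normal T F) * \<phi> y)
       + (LINT y:F|facet_measure T' F. (\<tau> T' y \<bullet> exterior_normal T' F) * \<phi> y)"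
proof -
  let ?U = "patch \<T> T" and ?g = "glue \<T> \<tau>"
  note s = mesh_simplex[OF \<Omega> mesh T(1)] and s' = mesh_simplex[OF \<Omega> mesh T'(1)]
  note sm = test_functions_smooth[OF \<phi>]
  define k where "k T x = divergence (\<tau> T) x * \<phi> x + \<tau> T x \<bullet> gradient \<phi> x" for T x
  define h where "h x = div_mesh \<T> ?g x * \<phi> x + ?g x \<bullet> gradient \<phi> x" for x
  have wd: "weak_div (interior S) ?g \<in> L2 (interior S)" "AE x in lebesgue_on (interior S). weak_div (interior S) ?g x = divergence (\<tau> S) x"
    if "S \<in> \<T>" for S
  proof -
    have g: "?g x = \<tau> S x" if "x \<in> interior S" for x by (rule glue_interior[OF \<open>S \<in> \<T>\<close> that])
    show "weak_div (interior S) ?g \<in> L2 (interior S)"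
      by (rule weak_div_smooth(1)[OF open_interior interior_lebesgue(2)[OF that] \<tau>[OF that] g])
    show "AE x in lebesgue_on (interior S). weak_div (interior S) ?g x = divergence (\<tau> S) x"
      by (rule weak_div_smooth(2)[OF open_interior interior_lebesgue(2)[OF that] \<tau>[OF that] g])
  qed
  have FT: "F \<subseteq> T" "F \<subseteq> T'" "F \<noteq> {}"
    using T(2) T'(2) by (auto simp: facets_def facet_of_def dest: face_of_imp_subset)
  have sub: "interior T \<subseteq> ?U" "interior T' \<subseteq> ?U"
    using interior_in_patch[OF T(1), of T] interior_in_patch[OF T'(1), of T] FT by blast+
  have disj: "interior T \<inter> T' = {}" "interior T' \<inter> T = {}"
    using mesh_interior_disjoint[OF \<Omega> mesh T(1) T'(1) ne] mesh_interior_disjoint[OF \<Omega> mesh T'(1) T(1)] ne by auto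
  have ae: "AE x in lebesgue. indicator ?U x * h x = indicator T x * k T x + indicator T' x * k T' x"
    using AE_not_frontier[OF s] AE_not_frontier[OF s']
      AE_on_interior[OF wd(2)[OF T(1)] interior_lebesgue(1)[OF T(1)]]
      AE_on_interior[OF wd(2)[OF T'(1)] interior_lebesgue(1)[OF T'(1)]]
  proof eventually_elim
    case (elim x)
    consider "x \<in> interior T" | "x \<in> interior T'" | "x \<notin> T" "x \<notin> T'"
      using elim(1,2) closure_subset[of T] closure_subset[of T'] unfolding frontier_def by blast
    then show ?case
    proof cases
      case 1
      then have "x \<in> ?U" "x \<in> T" "x \<notin> T'" using sub disj interior_subset by blast+
      moreover have "h x = k T x"
        using 1 elim(3) by (simp add: h_def k_def div_mesh_interior[OF T(1)] glue_interior[OF T(1)])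
      ultimately show ?thesis by simp
    next
      case 2
      then have "x \<in> ?U" "x \<in> T'" "x \<notin> T" using sub disj interior_subset by blast+
      moreover have "h x = k T' x"
        using 2 elim(4) by (simp add: h_def k_def div_mesh_interior[OF T'(1)] glue_interior[OF T'(1)])
      ultimately show ?thesis by simp
    next
      case 3
      then have "x \<notin> interior (T \<union> T')" using interior_subset[of "T \<union> T'"] by blast
      then have "h x = 0" using test_functions_outside(1,2)[OF \<phi>, of x] by (simp add: h_def)
      then show ?thesis using 3 by simp
    qed
  qed
  have PU: "?U \<subseteq> \<Omega>" by (rule patch_subset[OF \<Omega> mesh])
  have bU: "bounded ?U" by (rule bounded_subset[OF bounded PU])
  have gL: "?g \<in> L2 ?U" "div_mesh \<T> ?g \<in> L2 ?U"
    using L2_subset[OF glue_L2[OF \<tau>] PU domain_lebesgue patch_lebesgue]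
      L2_subset[OF div_mesh_L2[OF wd(1)] PU domain_lebesgue patch_lebesgue] by auto
  note \<phi>L = test_functions_L2[OF \<phi> patch_lebesgue bU]
  have hint: "integrable (lebesgue_on ?U) h"
    unfolding h_def using L2_inner_integrable[OF gL(2) \<phi>L(1)] L2_inner_integrable[OF gL(1) \<phi>L(3)] by simp
  then have hm: "(\<lambda>x. indicator ?U x * h x) \<in> borel_measurable lebesgue"
    using patch_lebesgue[of T] borel_measurable_restrict_space_iff[of ?U lebesgue h] by auto
  have kint: "integrable lborel (\<lambda>x. indicator S x * k S x)" if "S \<in> \<T>" for S
  proof -
    have "continuous_on S (k S)"
      unfolding k_def[abs_def]
      by (intro continuous_intros continuous_on_divergence continuous_on_gradient smooth_continuous continuous_on_smooth_vec \<tau> that sm)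
    then have "integrable lborel (\<lambda>x. indicator S x *\<^sub>R k S x)"
      by (rule borel_integrable_compact[OF compact_simplex[OF mesh_simplex[OF \<Omega> mesh that]]])
    then show ?thesis by simp
  qed
  have km: "(\<lambda>x. indicator S x * k S x) \<in> borel_measurable borel" if "S \<in> \<T>" for S
    using borel_measurable_integrable[OF kint[OF that]] by simp
  have "l2_inner ?U (div_mesh \<T> ?g) \<phi> + l2_inner ?U ?g (gradient \<phi>) = (LINT x|lebesgue_on ?U. h x)"
    unfolding h_def l2_inner_def
    using L2_inner_integrable[OF gL(2) \<phi>L(1)] L2_inner_integrable[OF gL(1) \<phi>L(3)] by simp
  also have "\<dots> = (LINT x|lebesgue. indicator ?U x * h x)"
    by (rule integral_lebesgue_on[OF patch_lebesgue])
  also have "\<dots> = (LINT x|lebesgue. indicator T x * k T x + indicator T' x * k T' x)"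
    by (rule integral_cong_AE[OF hm _ ae])
       (intro measurable_completion borel_measurable_add, simp_all add: km T(1) T'(1))
  also have "\<dots> = (\<integral>x. indicator T x * k T x + indicator T' x * k T' x \<partial>lborel)"
    by (rule integral_completion) (simp, intro borel_measurable_add km T(1) T'(1))
  also have "\<dots> = (\<integral>x. indicator T x * k T x \<partial>lborel) + (\<integral>x. indicator T' x * k T' x \<partial>lborel)"
    by (rule Bochner_Integration.integral_add[OF kint[OF T(1)] kint[OF T'(1)]])
  also have "(\<integral>x. indicator T x * k T x \<partial>lborel) = (LINT y:F|facet_measure T F. (\<tau> T y \<bullet> exterior_normal T F) * \<phi> y)"
    unfolding k_def by (rule gauss_facet[OF s T(2) \<tau>[OF T(1)] sm K(1,2,3)])
  also have "(\<integral>x. indicator T' x * k T' x \<partial>lborel) = (LINT y:F|facet_measure T' F. (\<tau> T' y \<bullet> exterior_normal T' F) * \<phi> y)"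
    unfolding k_def by (rule gauss_facet[OF s' T'(2) \<tau>[OF T'(1)] sm K(1,2,4)])
  finally show ?thesis .
qed

end

section \<open>The local efficiency estimate\<close>

lemma l2_norm_bound:
  fixes f :: "real^'n::finite \<Rightarrow> 'b::euclidean_space"
  assumes U: "U \<in> sets lebesgue" and K: "compact K" and A: "0 \<le> A"
    and f: "\<And>x. x \<in> K \<Longrightarrow> norm (f x) \<le> A" "\<And>x. x \<notin> K \<Longrightarrow> f x = 0"
  shows "l2_norm U f \<le> A * sqrt (measure lborel K)"
proof -
  have Kb: "K \<in> sets borel" by (rule borel_compact[OF K])
  have m: "measure lebesgue K = measure lborel K" using Kb by (simp add: measure_completion)
  have "l2_inner U f f = (LINT x|lebesgue. indicator U x * (f x \<bullet> f x))"
    unfolding l2_inner_def by (rule integral_lebesgue_on[OF U])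
  also have "\<dots> \<le> (LINT x|lebesgue. A\<^sup>2 * indicator K x)"
  proof (rule integral_mono')
    have "emeasure lebesgue K < \<infinity>"
      using emeasure_compact_finite[OF K] Kb by simp
    then show "integrable lebesgue (\<lambda>x. A\<^sup>2 * indicator K x)" using Kb by simp
    fix x
    show "indicator U x * (f x \<bullet> f x) \<le> A\<^sup>2 * indicator K x"
    proof (cases "x \<in> K")
      case True
      have "f x \<bullet> f x \<le> A\<^sup>2"
        unfolding dot_square_norm by (rule power_mono[OF f(1)[OF True] norm_ge_zero])
      then show ?thesis using True by (simp add: indicator_def)
    qed (simp add: f(2))
  qed (simp add: indicator_def)
  also have "\<dots> = A\<^sup>2 * measure lborel K" using Kb m by simp
  finally have "l2_norm U f \<le> sqrt (A\<^sup>2 * measure lborel K)"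
    unfolding l2_norm_def by (rule real_sqrt_le_mono)
  then show ?thesis using A by (simp add: real_sqrt_mult)
qed

text \<open>From dimension two on a facet contains an edge; that edge is shared by the two
  neighbours and links their diameters.\<close>

lemma distinct_facet_vertices:
  fixes w :: "'n::finite \<Rightarrow> 'a"
  assumes "2 \<le> CARD('n)" "bij_betw w UNIV V"
  obtains v v' where "v \<in> V" "v' \<in> V" "v \<noteq> v'"
proof -
  have c: "2 \<le> card V" "finite V" using assms bij_betw_same_card[OF assms(2)] bij_betw_finite[OF assms(2)] by simp_all
  then show thesis using that by (metis card_2_iff' card_le_Suc0_iff_eq not_less_eq_eq numeral_2_eq_2)
qed

text \<open>The common edge is no longer than the diameter of T', while the gradient bound on
  \<open>T\<close> makes it at least diameter T / K. Hence diameter T \<le> K diameter T', and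
  expressing the gradient bound of T' through the diameter of \<open>T\<close> costs the second
  factor K.\<close>

lemma neighbour_bary_grad:
  fixes T T' F :: "(real^'n::finite) set"
  assumes n: "2 \<le> CARD('n)" and T: "int CARD('n) simplex T" "F \<in> facets T" and T': "int CARD('n) simplex T'" "F \<in> facets T'"
    and K: "1 \<le> K" "\<forall>z\<in>vertices T. norm (bary_grad T z) * diameter T \<le> K"
      "\<forall>z\<in>vertices T'. norm (bary_grad T' z) * diameter T' \<le> K"
    and v: "v \<in> vertices F"
  shows "0 < diameter T" "norm (bary_grad T v) \<le> K\<^sup>2 / diameter T" "norm (bary_grad T' v) \<le> K\<^sup>2 / diameter T"
proof -
  obtain w :: "'n \<Rightarrow> real^'n" where w: "bij_betw w UNIV (vertices F)" using bij_vertices[OF T] by blast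
  obtain a b where ab: "a \<in> vertices F" "b \<in> vertices F" "a \<noteq> b" by (rule distinct_facet_vertices[OF n w])
  note V = facet_vertex[OF T] and V' = facet_vertex[OF T']
  have d: "dist a b \<le> diameter T" "dist a b \<le> diameter T'"
    using diameter_bounded_bound[OF compact_imp_bounded[OF compact_simplex[OF T(1)]], of a b]
      diameter_bounded_bound[OF compact_imp_bounded[OF compact_simplex[OF T'(1)]], of a b]
      subsetD[OF vertices_subset[OF T(1)] V[OF ab(1)]] subsetD[OF vertices_subset[OF T(1)] V[OF ab(2)]]
      subsetD[OF vertices_subset[OF T'(1)] V'[OF ab(1)]] subsetD[OF vertices_subset[OF T'(1)] V'[OF ab(2)]]
    by simp_all
  have "0 < dist a b" using ab by simp
  then show h: "0 < diameter T" using d by linarith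
  have "1 \<le> norm (bary_grad T a) * dist a b" by (rule vertex_distance[OF T(1) V[OF ab(1)] V[OF ab(2)] ab(3)])
  also have "\<dots> \<le> norm (bary_grad T a) * diameter T'" using d by (intro mult_left_mono) auto
  finally have "diameter T \<le> diameter T * (norm (bary_grad T a) * diameter T')"
    using h by simp
  also have "\<dots> \<le> K * diameter T'"
  proof -
    have "0 \<le> diameter T'" using d(2) \<open>0 < dist a b\<close> by linarith
    from mult_right_mono[OF bspec[OF K(2) V[OF ab(1)]] this] show ?thesis by (simp add: mult_ac)
  qed
  finally have hh: "diameter T \<le> K * diameter T'" .
  have "norm (bary_grad T v) * diameter T \<le> K" by (rule bspec[OF K(2) V[OF v]])
  also have "K \<le> K\<^sup>2" using K(1) by (simp add: power2_eq_square)
  finally show "norm (bary_grad T v) \<le> K\<^sup>2 / diameter T" using h by (simp add: pos_le_divide_eq)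
  have "norm (bary_grad T' v) * diameter T \<le> norm (bary_grad T' v) * (K * diameter T')"
    using hh by (intro mult_left_mono) auto
  also have "\<dots> = K * (norm (bary_grad T' v) * diameter T')" by (simp add: mult_ac)
  also have "\<dots> \<le> K * K" using K(1) bspec[OF K(3) V'[OF v]] by (intro mult_left_mono) auto
  finally show "norm (bary_grad T' v) \<le> K\<^sup>2 / diameter T" using h by (simp add: pos_le_divide_eq power2_eq_square)
qed

text \<open>The property of the constant in \<open>ref_form_coercive\<close>, named so that the
  constant can be fixed before \<epsilon> and the mesh are introduced.\<close>

definition coercive_const :: "'n::finite \<Rightarrow> real \<Rightarrow> real \<Rightarrow> bool" where
  "coercive_const k \<beta> C \<longleftrightarrow> (\<forall>c. \<exists>c'. (\<forall>\<mu>. (\<forall>i::'n. 0 \<le> \<mu> i) \<longrightarrow> sum \<mu> UNIV = 1 \<longrightarrow> mpoly c' \<mu> = mpoly c \<mu>)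
      \<and> (\<Sum>S\<in>UNIV. \<bar>c' $ S\<bar>)\<^sup>2 \<le> C * ref_form k \<beta> c')"

text \<open>Here \<open>a\<close> is the area of the facet, \<open>L\<close> the sum of the
  coefficients, \<open>I\<close> the jump tested with \<phi>, and \<open>E1\<close>,
  \<open>E2\<close> are the errors of divergence and field. After division by sqrt a L the factor
  sqrt m completes the remaining sqrt \<delta>: the field term loses all scales, and the divergence
  term keeps m, which is at most \<epsilon>.\<close>

lemma layer_arithmetic:
  fixes X C E1 E2 B \<delta> a L m c0 \<epsilon> :: real
  assumes X: "a * L\<^sup>2 \<le> C * I" and I: "I \<le> E1 * (L * sqrt (2 * \<delta> * a)) + E2 * (L * (B / \<delta>) * sqrt (2 * \<delta> * a))"
    and pos: "0 \<le> a" "0 \<le> L" "0 \<le> C" "0 \<le> E1" "0 \<le> E2" "0 \<le> B" "0 < m" "0 < c0" "m \<le> \<epsilon>"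
    and \<delta>: "\<delta> = c0 * m"
  shows "sqrt m * (sqrt a * L) \<le> C * sqrt (2 * c0) * (1 + B / c0) * (E2 + \<epsilon> * E1)"
proof (cases "sqrt a * L = 0")
  case True
  have "0 \<le> C * sqrt (2 * c0) * (1 + B / c0) * (E2 + \<epsilon> * E1)"
    using pos by (intro mult_nonneg_nonneg add_nonneg_nonneg divide_nonneg_nonneg) auto
  then show ?thesis unfolding True by simp
next
  case False
  define Y where "Y = sqrt a * L"
  have Y: "0 < Y" using False pos unfolding Y_def by (simp add: less_le)
  have sq: "sqrt (2 * \<delta> * a) = sqrt (2 * c0) * sqrt m * sqrt a" by (simp add: \<delta> real_sqrt_mult)
  have mm: "sqrt m * sqrt m = m" using pos by simp
  have "Y * Y = a * L\<^sup>2" using pos by (simp add: Y_def power2_eq_square mult_ac)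
  also have "\<dots> \<le> C * (E1 * (L * sqrt (2 * \<delta> * a)) + E2 * (L * (B / \<delta>) * sqrt (2 * \<delta> * a)))"
    using X mult_left_mono[OF I pos(3)] by linarith
  also have "\<dots> = (C * sqrt (2 * c0) * sqrt m * (E1 + E2 * (B / \<delta>))) * Y"
    unfolding sq Y_def by (simp add: algebra_simps)
  finally have "Y \<le> C * sqrt (2 * c0) * sqrt m * (E1 + E2 * (B / \<delta>))" using Y by simp
  then have "sqrt m * Y \<le> sqrt m * (C * sqrt (2 * c0) * sqrt m * (E1 + E2 * (B / \<delta>)))"
    using pos by (intro mult_left_mono) auto
  also have "\<dots> = C * sqrt (2 * c0) * ((sqrt m * sqrt m) * (E1 + E2 * (B / \<delta>)))" by (simp only: mult_ac)
  also have "\<dots> = C * sqrt (2 * c0) * (m * E1 + E2 * (B / c0))"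
    unfolding mm using pos by (simp add: \<delta> field_simps)
  also have "\<dots> \<le> C * sqrt (2 * c0) * ((1 + B / c0) * (E2 + \<epsilon> * E1))"
  proof (rule mult_left_mono)
    define q where "q = B / c0"
    have b: "0 \<le> q" using pos by (simp add: q_def)
    have "m * E1 \<le> \<epsilon> * E1" using pos by (intro mult_right_mono) auto
    moreover have "0 \<le> q * (\<epsilon> * E1)" using pos b by (intro mult_nonneg_nonneg) auto
    ultimately have "m * E1 + E2 * q \<le> (1 + q) * (E2 + \<epsilon> * E1)"
      using pos by (simp add: algebra_simps)
    then show "m * E1 + E2 * (B / c0) \<le> (1 + B / c0) * (E2 + \<epsilon> * E1)" by (simp only: q_def)
  qed (use pos in auto)
  finally show ?thesis unfolding Y_def by (simp only: mult.assoc)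
qed

lemma facet_jump_bound:
  fixes \<Omega> :: "(real^'n::finite) set" and k :: 'n
  defines "\<beta> \<equiv> 1 / (2 * real CARD('n))"
  assumes n: "2 \<le> CARD('n)" and \<Omega>: "lipschitz_domain \<Omega>" "bounded \<Omega>" and mesh: "mesh_of \<Omega> \<T>"
    and shape: "shape_regular \<kappa> \<T>" and \<epsilon>: "0 < \<epsilon>"
    and \<sigma>: "\<sigma> \<in> Sigma_space \<Omega> \<T>" "\<forall>v\<in>W_space \<Omega> \<T>. b_dual \<epsilon> v \<sigma> = 0"
    and \<tau>: "\<tau> \<in> Sigma_h \<epsilon> zv tv \<T>"
    and T: "T \<in> \<T>" "F \<in> facets T" "\<not> F \<subseteq> frontier \<Omega>"
    and C: "0 \<le> C" "coercive_const k \<beta> C"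
    and K: "K = max 1 (shape_const TYPE('n) \<kappa>)" and c0: "c0 = \<beta> / (4 * K\<^sup>2)"
  shows "sqrt (min \<epsilon> (diameter T)) * sqrt (LINT y:F|facet_measure T F. (normal_jump \<T> \<tau> F y)\<^sup>2)
    \<le> (C * measure lborel (ref_prism k) * exp 2) * sqrt (2 * c0) * (1 + (3 * real CARD('n) + 4) / c0)
       * (l2_norm (patch \<T> T) (\<lambda>x. \<sigma> x - glue \<T> \<tau> x)
          + \<epsilon> * l2_norm (patch \<T> T) (\<lambda>x. weak_div \<Omega> \<sigma> x - div_mesh \<T> (glue \<T> \<tau>) x))"
proof -
  let ?U = "patch \<T> T" and ?n = "exterior_normal T F" and ?g = "glue \<T> \<tau>"
  note s = mesh_simplex[OF \<Omega>(1) mesh T(1)]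
  obtain T' where T': "T' \<in> \<T>" "T' \<noteq> T" "F \<in> facets T'" and set: "{T'' \<in> \<T>. F facet_of T''} = {T, T'}"
    by (rule mesh_neighbour[OF \<Omega>(1) mesh T])
  note s' = mesh_simplex[OF \<Omega>(1) mesh T'(1)]
  note opp = mesh_normals_opposite[OF \<Omega>(1) mesh T(1,2) T'(1,3) T'(2)[symmetric]]
  have loc: "\<tau> S \<in> local_space \<epsilon> zv tv S" if "S \<in> \<T>" for S
    using \<tau> that unfolding Sigma_h_def by (rule PiE_mem)
  have sm: "smooth (\<lambda>x. \<tau> S x $ i)" if "S \<in> \<T>" for S i
    by (rule smooth_local_space[OF mesh_simplex[OF \<Omega>(1) mesh that] loc[OF that]])
  have \<beta>: "0 < \<beta>" "\<beta> \<le> 1" "\<beta> * real CARD('n) \<le> 1 / 2"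
    using n by (simp_all add: \<beta>_def field_simps)
  have K1: "1 \<le> K" by (simp add: K)
  have grad: "norm (bary_grad S z) * diameter S \<le> K" if "S \<in> \<T>" "z \<in> vertices S" for S z
  proof -
    have "diameter S ^ CARD('n) / measure lebesgue S \<le> \<kappa>" using shape that by (simp add: shape_regular_def)
    from bary_grad_bound[OF mesh_simplex[OF \<Omega>(1) mesh that(1)] that(2) this] show ?thesis by (simp add: K)
  qed
  obtain w :: "'n \<Rightarrow> real^'n" where w: "bij_betw w UNIV (vertices F)" by (rule bij_vertices[OF s T(2)])
  define G where "G = K\<^sup>2 / diameter T"
  have "\<forall>z\<in>vertices T. norm (bary_grad T z) * diameter T \<le> K" "\<forall>z\<in>vertices T'. norm (bary_grad T' z) * diameter T' \<le> K"
    using grad[OF T(1)] grad[OF T'(1)] by auto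
  note nb = neighbour_bary_grad[OF n s T(2) s' T'(3) K1 this]
  have G: "\<forall>v\<in>vertices F. norm (bary_grad T v) \<le> G" "\<forall>v\<in>vertices F. norm (bary_grad T' v) \<le> G"
    unfolding G_def using nb(2,3) by blast+
  have h: "0 < diameter T" by (rule nb(1)[OF facet_enum_vertex(1)[OF s T(2) w]])
  define m where "m = min \<epsilon> (diameter T)"
  have m: "0 < m" "m \<le> \<epsilon>" "m \<le> diameter T" using \<epsilon> h by (auto simp: m_def)
  have c0p: "0 < c0" using \<beta>(1) K1 by (simp add: c0)
  define \<delta> where "\<delta> = c0 * m"
  have \<delta>: "0 < \<delta>" using c0p m by (simp add: \<delta>_def)
  have small: "4 * G * \<delta> \<le> \<beta>"
  proof -
    \<comment> \<open>The factors K^2 cancel by the choice of \<open>c0\<close>. The remaining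
      quotient is at most one because the minimum includes the diameter.\<close>
    have "4 * G * \<delta> = \<beta> * (m / diameter T)" using K1 by (simp add: G_def \<delta>_def c0)
    also have "\<dots> \<le> \<beta> * 1" using \<beta> m h by (intro mult_left_mono) auto
    finally show ?thesis by simp
  qed
  define J where "J y = \<tau> T y \<bullet> ?n + \<tau> T' y \<bullet> exterior_normal T' F" for y
  have jump: "normal_jump \<T> \<tau> F y = J y" for y
    unfolding normal_jump_def set J_def using T'(2) by simp
  have "facet_poly T F J"
    unfolding J_def
    by (intro facet_poly_add facet_poly_normal_trace[OF s T(2) loc[OF T(1)]]
        facet_poly_transfer[OF s T(2) s' T'(3) facet_poly_normal_trace[OF s' T'(3) loc[OF T'(1)]]])
  then obtain c' where c': "\<And>y. y \<in> F \<Longrightarrow> J y = mpoly c' (\<lambda>i. bary T (w i) y)"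
    by (rule facet_poly_mpoly[OF w]) (rule that)
  \<comment> \<open>The coefficients \<open>c'\<close> may contain an arbitrarily large part that
    vanishes on the facet; \<open>c\<close> has the same values there and is controlled by the
    quadratic form.\<close>
  obtain c where c: "\<forall>\<mu>. (\<forall>i::'n. 0 \<le> \<mu> i) \<longrightarrow> sum \<mu> UNIV = 1 \<longrightarrow> mpoly c \<mu> = mpoly c' \<mu>"
    and cC: "(\<Sum>S\<in>UNIV. \<bar>c $ S\<bar>)\<^sup>2 \<le> C * ref_form k \<beta> c"
    using C(2)[unfolded coercive_const_def, rule_format, of c'] by (elim exE conjE) (rule that)
  define L where "L = (\<Sum>S\<in>UNIV. \<bar>c $ S\<bar>)"
  have L0: "0 \<le> L" by (simp add: L_def sum_nonneg)
  define fc where "fc = facet_coord T F w"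
  define P where "P = facet_prism T F"
  define R where "R = facet_layer T F w \<beta> \<delta>"
  have coord: "0 \<le> fc x i" "fc x i \<le> 1" "sum (fc x) UNIV = 1" if "x \<in> P" for x i
  proof -
    have PF: "facet_proj T F x \<in> F" using that by (simp add: P_def facet_prism_def[OF s T(2)])
    then show 0: "0 \<le> fc x i" for i using facet_proj_in_facet_iff[OF s T(2) w, of x] by (simp add: fc_def)
    show 1: "sum (fc x) UNIV = 1" using sum_facet_coord(1)[OF s T(2) w, of x] by (simp add: fc_def)
    show "fc x i \<le> 1" by (rule simplex_coord_le_1[OF 0 1])
  qed
  have JP: "J (facet_proj T F x) = mpoly c (fc x)" if x: "x \<in> P" for x
  proof -
    have "facet_proj T F x \<in> F" using x by (simp add: P_def facet_prism_def[OF s T(2)])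
    from c'[OF this] have "J (facet_proj T F x) = mpoly c' (fc x)"
      unfolding fc_def facet_coord_def[OF s T(2) w, abs_def] .
    also have "\<dots> = mpoly c (fc x)" using c coord(1,3)[OF x] by simp
    finally show ?thesis .
  qed
  define \<phi> where "\<phi> = layer_function (tangential_grad T F w) (facet_coord T F w 0) ?n (facet_offset T F) \<delta> \<beta> c"
  note Q = s T(2) s' T'(3) opp w \<beta>(1,2) \<delta> small G
  have \<phi>s: "smooth \<phi>" unfolding \<phi>_def by (rule test_fun_smooth[OF Q])
  have \<phi>t: "\<phi> \<in> test_functions (interior (T \<union> T'))" unfolding \<phi>_def by (rule test_fun_test_function[OF Q])
  have \<phi>0: "\<phi> x = 0" if "x \<notin> R" for x
    using that unfolding \<phi>_def R_def by (rule test_fun_outside[OF Q])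
  have \<phi>b: "\<bar>\<phi> x\<bar> \<le> L" "norm (gradient \<phi> x) \<le> L * ((3 * real CARD('n) + 4) / \<delta>)" if "x \<in> R" for x
    using that unfolding \<phi>_def R_def L_def by (rule test_fun_bound[OF Q])+
  have Rc: "compact R" unfolding R_def by (rule compact_facet_layer[OF s T(2) w \<beta>(1) \<delta>])
  have g0: "gradient \<phi> x = 0" if "x \<notin> R" for x by (rule gradient_outside[OF \<phi>s Rc \<phi>0 that])
  have \<phi>P: "\<phi> (facet_proj T F x) = mpoly c (fc x) * layer_weight \<beta> (fc x) * exp (- 2)" for x
    unfolding \<phi>_def fc_def by (rule test_fun_facet[OF Q])
  have area: "0 \<le> facet_area T F" by (simp add: facet_area_def[OF s T(2) w])
  have Jc: "continuous_on UNIV J"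
    unfolding J_def by (intro continuous_intros continuous_on_smooth_vec sm T(1) T'(1))
  define I where "I = (\<integral>x. indicator P x * (J (facet_proj T F x) * \<phi> (facet_proj T F x)) \<partial>lborel)"
  have "facet_area T F * L\<^sup>2 \<le> C * measure lborel (ref_prism k) *
    (\<integral>x. indicator P x * ((mpoly c (fc x))\<^sup>2 * layer_weight \<beta> (fc x)) \<partial>lborel)"
    unfolding L_def P_def fc_def by (rule facet_form_ge[OF s T(2) w cC])
  also have "(\<integral>x. indicator P x * ((mpoly c (fc x))\<^sup>2 * layer_weight \<beta> (fc x)) \<partial>lborel) = exp 2 * I"
  proof -
    have "indicator P x * ((mpoly c (fc x))\<^sup>2 * layer_weight \<beta> (fc x))
        = exp 2 * (indicator P x * (J (facet_proj T F x) * \<phi> (facet_proj T F x)))" for x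
    proof (cases "x \<in> P")
      case True
      have "exp 2 * (a * (a * b * exp (- 2))) = (exp 2 * exp (- 2)) * (a\<^sup>2 * b)" for a b :: real
        by (simp only: power2_eq_square mult_ac)
      moreover have "exp 2 * exp (- 2) = (1::real)" by (simp add: exp_minus)
      ultimately have "exp 2 * (a * (a * b * exp (- 2))) = a\<^sup>2 * b" for a b :: real by simp
      note e = this[of "mpoly c (fc x)" "layer_weight \<beta> (fc x)"]
      have i: "indicator P x = (1::real)" using True by simp
      show ?thesis unfolding i JP[OF True] \<phi>P mult_1 by (rule e[symmetric])
    qed simp
    then have "(\<integral>x. indicator P x * ((mpoly c (fc x))\<^sup>2 * layer_weight \<beta> (fc x)) \<partial>lborel)
        = (\<integral>x. exp 2 * (indicator P x * (J (facet_proj T F x) * \<phi> (facet_proj T F x))) \<partial>lborel)"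
      by (rule Bochner_Integration.integral_cong[OF refl])
    then show ?thesis unfolding I_def by (simp only: Bochner_Integration.integral_mult_right_zero)
  qed
  finally have lower: "facet_area T F * L\<^sup>2 \<le> (C * measure lborel (ref_prism k) * exp 2) * I"
    by (simp only: mult.assoc)
  have PU: "?U \<subseteq> \<Omega>" by (rule patch_subset[OF \<Omega>(1) mesh])
  have op: "open \<Omega>" using \<Omega>(1) by (simp add: lipschitz_domain_def)
  have \<Omega>l: "\<Omega> \<in> sets lebesgue" using op by simp
  have Ul: "?U \<in> sets lebesgue" by (simp add: patch_def)
  have FT: "F \<subseteq> T" "F \<subseteq> T'" "F \<noteq> {}"
    using T(2) T'(3) by (auto simp: facets_def facet_of_def dest: face_of_imp_subset)
  have intU: "interior (T \<union> T') \<subseteq> ?U"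
  proof -
    have "T \<inter> T \<noteq> {}" "T \<inter> T' \<noteq> {}" using FT by blast+
    then show ?thesis unfolding patch_def using T(1) T'(1) by (intro interior_mono) blast
  qed
  have \<phi>U: "\<phi> \<in> test_functions ?U" using test_functions_mono[OF intU] \<phi>t by blast
  have \<phi>\<Omega>: "\<phi> \<in> test_functions \<Omega>" using test_functions_mono[OF PU] \<phi>U by blast
  have \<sigma>H: "\<sigma> \<in> Hdiv \<Omega>" by (rule orthogonal_W_imp_Hdiv[OF \<Omega>(1) mesh \<Omega>(2) \<sigma>(1) \<epsilon> \<sigma>(2)])
  have \<sigma>L: "\<sigma> \<in> L2 \<Omega>" using \<sigma>H by (simp add: Hdiv_def)
  note wd = weak_div_in_Hdiv[OF \<sigma>H]
  have gL: "?g \<in> L2 ?U" by (rule L2_subset[OF glue_L2[OF \<Omega>(1) mesh \<Omega>(2) sm] PU \<Omega>l Ul])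
  have dL: "div_mesh \<T> ?g \<in> L2 ?U"
  proof (rule L2_subset[OF div_mesh_L2[OF \<Omega>(1) mesh \<Omega>(2)] PU \<Omega>l Ul])
    fix S assume S: "S \<in> \<T>"
    show "weak_div (interior S) ?g \<in> L2 (interior S)"
    proof (rule weak_div_smooth(1)[OF open_interior interior_lebesgue(2)[OF \<Omega>(1) mesh \<Omega>(2) S] sm[OF S]])
      show "?g x = \<tau> S x" if "x \<in> interior S" for x by (rule glue_interior[OF \<Omega>(1) mesh \<Omega>(2) S that])
    qed
  qed
  have \<sigma>U: "\<sigma> \<in> L2 ?U" "weak_div \<Omega> \<sigma> \<in> L2 ?U"
    by (rule L2_subset[OF \<sigma>L PU \<Omega>l Ul], rule L2_subset[OF wd(1) PU \<Omega>l Ul])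
  note \<phi>L = test_functions_L2[OF \<phi>t Ul bounded_subset[OF \<Omega>(2) PU]]
  \<comment> \<open>The exact solution has no jump: tested with \<phi>, its divergence and flux
    terms cancel. Subtracting them from the discrete terms turns these into errors at no
    cost.\<close>
  have "l2_inner \<Omega> \<sigma> (gradient \<phi>) = - l2_inner \<Omega> (weak_div \<Omega> \<sigma>) \<phi>"
    using wd(2) \<phi>\<Omega> by (simp add: has_weak_divergence_def)
  moreover have "l2_inner \<Omega> \<sigma> (gradient \<phi>) = l2_inner ?U \<sigma> (gradient \<phi>)"
    by (rule l2_inner_restrict[OF PU \<Omega>l Ul]) (simp add: test_functions_outside(2)[OF \<phi>U])
  moreover have "l2_inner \<Omega> (weak_div \<Omega> \<sigma>) \<phi> = l2_inner ?U (weak_div \<Omega> \<sigma>) \<phi>"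
    by (rule l2_inner_restrict[OF PU \<Omega>l Ul]) (simp add: test_functions_outside(1)[OF \<phi>U])
  ultimately have weak: "l2_inner ?U (weak_div \<Omega> \<sigma>) \<phi> + l2_inner ?U \<sigma> (gradient \<phi>) = 0" by simp
  have c1: "continuous_on UNIV (\<lambda>y. (\<tau> T y \<bullet> ?n) * \<phi> y)" "continuous_on UNIV (\<lambda>y. (\<tau> T' y \<bullet> exterior_normal T' F) * \<phi> y)"
    by (intro continuous_intros continuous_on_smooth_vec sm T(1) T'(1) smooth_continuous \<phi>s)+
  have side: "x \<in> T \<longleftrightarrow> x \<bullet> ?n \<le> facet_offset T F" "x \<in> T' \<longleftrightarrow> x \<bullet> exterior_normal T' F \<le> facet_offset T' F" if "x \<in> R" for x
    using that unfolding R_def by (rule facet_layer_side'[OF Q])+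
  have "I = (LINT y:F|facet_measure T F. (\<tau> T y \<bullet> ?n) * \<phi> y) + (LINT y:F|facet_measure T F. (\<tau> T' y \<bullet> exterior_normal T' F) * \<phi> y)"
    unfolding facet_integral_full(1)[OF s T(2) c1(1)] facet_integral_full(1)[OF s T(2) c1(2)] I_def P_def
      Bochner_Integration.integral_add[OF facet_integral_full(2)[OF s T(2) c1(1)] facet_integral_full(2)[OF s T(2) c1(2)], symmetric]
    by (rule Bochner_Integration.integral_cong[OF refl]) (simp add: J_def algebra_simps)
  also have "(LINT y:F|facet_measure T F. (\<tau> T' y \<bullet> exterior_normal T' F) * \<phi> y) = (LINT y:F|facet_measure T' F. (\<tau> T' y \<bullet> exterior_normal T' F) * \<phi> y)"
    by (rule facet_integral_opposite[OF Q c1(2), symmetric])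
  also have "(LINT y:F|facet_measure T F. (\<tau> T y \<bullet> ?n) * \<phi> y) + \<dots>
      = l2_inner ?U (div_mesh \<T> ?g) \<phi> + l2_inner ?U ?g (gradient \<phi>)"
    by (rule jump_identity[OF \<Omega>(1) mesh \<Omega>(2) T(1,2) T'(1,3) T'(2)[symmetric] sm \<phi>t Rc \<phi>0 side, symmetric])
  also have "\<dots> = l2_inner ?U (\<lambda>x. div_mesh \<T> ?g x - weak_div \<Omega> \<sigma> x) \<phi> + l2_inner ?U (\<lambda>x. ?g x - \<sigma> x) (gradient \<phi>)"
    using weak by (simp add: l2_inner_diff_left dL gL \<sigma>U \<phi>L)
  finally have I: "I = l2_inner ?U (\<lambda>x. div_mesh \<T> ?g x - weak_div \<Omega> \<sigma> x) \<phi> + l2_inner ?U (\<lambda>x. ?g x - \<sigma> x) (gradient \<phi>)" .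
  define E1 where "E1 = l2_norm ?U (\<lambda>x. weak_div \<Omega> \<sigma> x - div_mesh \<T> ?g x)"
  define E2 where "E2 = l2_norm ?U (\<lambda>x. \<sigma> x - ?g x)"
  have E: "0 \<le> E1" "0 \<le> E2" by (simp_all add: E1_def E2_def l2_norm_nonneg)
  define A where "A = sqrt (2 * \<delta> * facet_area T F)"
  have vol: "sqrt (measure lborel R) \<le> A"
    unfolding A_def R_def by (rule real_sqrt_le_mono[OF facet_layer_volume[OF s T(2) w \<beta>(1) \<delta>]])
  have B0: "0 \<le> L * ((3 * real CARD('n) + 4) / \<delta>)" using L0 \<delta> by simp
  have n1: "l2_norm ?U \<phi> \<le> L * A"
    using l2_norm_bound[OF Ul Rc L0, of \<phi>] \<phi>b(1) \<phi>0 mult_left_mono[OF vol L0] by (auto intro: order_trans)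
  have n2: "l2_norm ?U (gradient \<phi>) \<le> L * ((3 * real CARD('n) + 4) / \<delta>) * A"
    using l2_norm_bound[OF Ul Rc B0, of "gradient \<phi>"] \<phi>b(2) g0 mult_left_mono[OF vol B0] by (meson order_trans)
  have "I \<le> E1 * l2_norm ?U \<phi> + E2 * l2_norm ?U (gradient \<phi>)"
    unfolding I E1_def E2_def l2_norm_diff_commute[of ?U "weak_div \<Omega> \<sigma>"] l2_norm_diff_commute[of ?U \<sigma>]
    using l2_Cauchy_Schwarz[OF L2_diff[OF dL \<sigma>U(2)] \<phi>L(1)] l2_Cauchy_Schwarz[OF L2_diff[OF gL \<sigma>U(1)] \<phi>L(3)]
    by linarith
  also have "\<dots> \<le> E1 * (L * A) + E2 * (L * ((3 * real CARD('n) + 4) / \<delta>) * A)"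
    by (intro add_mono mult_left_mono n1 n2 E)
  finally have upper: "I \<le> E1 * (L * A) + E2 * (L * ((3 * real CARD('n) + 4) / \<delta>) * A)" .
  have main: "sqrt m * (sqrt (facet_area T F) * L) \<le> (C * measure lborel (ref_prism k) * exp 2) * sqrt (2 * c0) * (1 + (3 * real CARD('n) + 4) / c0) * (E2 + \<epsilon> * E1)"
    by (rule layer_arithmetic[OF lower upper[unfolded A_def] area L0 _ E _ m(1) c0p m(2) \<delta>_def]) (use C(1) in simp_all)
  \<comment> \<open>All coordinates lie between 0 and 1 on the facet, so the jump is at most L there
    and its norm at most sqrt |F| L, the quantity bounded in \<open>main\<close>.\<close>
  have "(LINT y:F|facet_measure T F. (normal_jump \<T> \<tau> F y)\<^sup>2) = (\<integral>x. indicator P x * (J (facet_proj T F x))\<^sup>2 \<partial>lborel)"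
    unfolding jump P_def by (rule facet_integral_full(1)[OF s T(2)]) (intro continuous_intros Jc)
  also have "\<dots> \<le> (\<integral>x. L\<^sup>2 * indicator P x \<partial>lborel)"
  proof (rule integral_mono')
    have "integrable lborel (\<lambda>x. indicator P x * L\<^sup>2)"
      unfolding P_def by (rule facet_integral_full(2)[OF s T(2), of "\<lambda>_. L\<^sup>2"]) (rule continuous_on_const)
    then show "integrable lborel (\<lambda>x. L\<^sup>2 * indicator P x)" by (simp add: mult.commute)
    fix x
    show "indicator P x * (J (facet_proj T F x))\<^sup>2 \<le> L\<^sup>2 * indicator P x"
    proof (cases "x \<in> P")
      case True
      have "\<bar>mpoly c (fc x)\<bar> \<le> L" unfolding L_def by (rule mpoly_bound[OF coord(1,2)[OF True]])
      then have "(mpoly c (fc x))\<^sup>2 \<le> L\<^sup>2" using power_mono[of "\<bar>mpoly c (fc x)\<bar>" L 2] by simp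
      then show ?thesis using True by (simp add: JP)
    qed simp
  qed simp
  also have "\<dots> = L\<^sup>2 * facet_area T F"
    unfolding facet_area_eq[OF s T(2) w] P_def by simp
  finally have "sqrt (LINT y:F|facet_measure T F. (normal_jump \<T> \<tau> F y)\<^sup>2) \<le> sqrt (L\<^sup>2 * facet_area T F)"
    by (rule real_sqrt_le_mono)
  then have "sqrt (LINT y:F|facet_measure T F. (normal_jump \<T> \<tau> F y)\<^sup>2) \<le> sqrt (facet_area T F) * L"
    using L0 by (simp add: real_sqrt_mult mult.commute)
  then have "sqrt m * sqrt (LINT y:F|facet_measure T F. (normal_jump \<T> \<tau> F y)\<^sup>2) \<le> sqrt m * (sqrt (facet_area T F) * L)"
    using m by (intro mult_left_mono) auto
  with main show ?thesis unfolding m_def E1_def E2_def by linarith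
qed

theorem lemma21:
  fixes \<Omega> :: "(real^'n::finite) set" and \<kappa> :: real
  assumes "CARD('n) = 2 \<or> CARD('n) = 3"
    and "bounded \<Omega>" and "lipschitz_domain \<Omega>" and "polyhedral_boundary \<Omega>"
  shows "\<exists>C>0. \<forall>(\<epsilon>::real) (\<T>::(real^'n) set set)
            (zv::(real^'n) set \<Rightarrow> real^'n) (tv::(real^'n) set \<Rightarrow> (real^'n) set \<Rightarrow> real^'n)
            (f::real^'n \<Rightarrow> real) (\<sigma>::real^'n \<Rightarrow> real^'n) (w::(real^'n \<Rightarrow> real^'n) \<Rightarrow> real)
            (\<sigma>h::(real^'n) set \<Rightarrow> real^'n \<Rightarrow> real^'n) (wh::(real^'n \<Rightarrow> real^'n) \<Rightarrow> real).
          0 < \<epsilon> \<longrightarrow> \<epsilon> \<le> 1 \<longrightarrow>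
          mesh_of \<Omega> \<T> \<longrightarrow> shape_regular \<kappa> \<T> \<longrightarrow>
          (\<forall>T\<in>\<T>. zv T \<in> vertices T \<and> (\<forall>E\<in>edges_at T (zv T). unit_tangent (tv T E) E)) \<longrightarrow>
          f \<in> L2 \<Omega> \<longrightarrow>
          dual_solution \<epsilon> \<Omega> \<T> f \<sigma> w \<longrightarrow>
          discrete_dual_solution \<epsilon> \<Omega> \<T> zv tv f \<sigma>h wh \<longrightarrow>
          (\<forall>T\<in>\<T>.
             min (sqrt \<epsilon>) (sqrt (diameter T)) * jump_norm \<Omega> \<T> \<sigma>h T
             \<le> C * (l2_norm (patch \<T> T) (\<lambda>x. \<sigma> x - glue \<T> \<sigma>h x)
                    + \<epsilon> * l2_norm (patch \<T> T)
                            (\<lambda>x. weak_div \<Omega> \<sigma> x - div_mesh \<T> (glue \<T> \<sigma>h) x)))"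
proof -
  have n: "2 \<le> CARD('n)" using assms(1) by linarith
  \<comment> \<open>Any index serves: it only selects the coordinate of the reference prism that
    acts as height.\<close>
  obtain k :: 'n where True by blast
  define \<beta> where "\<beta> = 1 / (2 * real CARD('n))"
  have \<beta>: "0 < \<beta>" "\<beta> * real CARD('n) \<le> 1 / 2" using n by (simp_all add: \<beta>_def)
  obtain C where C: "0 < C" and C': "coercive_const k \<beta> C"
    by (rule ref_form_coercive[OF \<beta>, of k]) (auto simp: coercive_const_def)
  define K where "K = max 1 (shape_const TYPE('n) \<kappa>)"
  define c0 where "c0 = \<beta> / (4 * K\<^sup>2)"
  \<comment> \<open>All factors are determined by the dimension and \<kappa>, before \<epsilon> and
    the mesh enter.\<close>
  define M where "M = (C * measure lborel (ref_prism k) * exp 2) * sqrt (2 * c0) * (1 + (3 * real CARD('n) + 4) / c0)"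
  have "1 \<le> K" by (simp add: K_def)
  then have "0 < c0" using \<beta>(1) by (simp add: c0_def)
  then have M: "0 \<le> M" using C by (simp add: M_def)
  \<comment> \<open>One contribution for each of the d + 1 facets; the additional 1 makes the
    constant positive, as \<open>M\<close> is only shown to be nonnegative.\<close>
  let ?C = "real (CARD('n) + 1) * M + 1"
  have "min (sqrt \<epsilon>) (sqrt (diameter T)) * jump_norm \<Omega> \<T> \<tau> T
      \<le> ?C * (l2_norm (patch \<T> T) (\<lambda>x. \<sigma> x - glue \<T> \<tau> x)
          + \<epsilon> * l2_norm (patch \<T> T) (\<lambda>x. weak_div \<Omega> \<sigma> x - div_mesh \<T> (glue \<T> \<tau>) x))"
    if \<epsilon>: "0 < \<epsilon>" and mesh: "mesh_of \<Omega> \<T>" and shape: "shape_regular \<kappa> \<T>"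
      and sol: "dual_solution \<epsilon> \<Omega> \<T> f \<sigma> w" "discrete_dual_solution \<epsilon> \<Omega> \<T> zv tv f \<tau> wh"
      and T: "T \<in> \<T>"
    for \<epsilon> \<T> zv tv f \<sigma> w \<tau> wh T
  proof -
    define m where "m = min \<epsilon> (diameter T)"
    define E where "E = l2_norm (patch \<T> T) (\<lambda>x. \<sigma> x - glue \<T> \<tau> x)
          + \<epsilon> * l2_norm (patch \<T> T) (\<lambda>x. weak_div \<Omega> \<sigma> x - div_mesh \<T> (glue \<T> \<tau>) x)"
    have E: "0 \<le> E" using \<epsilon> by (simp add: E_def l2_norm_nonneg)
    note s = mesh_simplex[OF assms(3) mesh T]
    have \<sigma>: "\<sigma> \<in> Sigma_space \<Omega> \<T>" "\<forall>v\<in>W_space \<Omega> \<T>. b_dual \<epsilon> v \<sigma> = 0"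
      using sol(1) by (simp_all add: dual_solution_def)
    have \<tau>: "\<tau> \<in> Sigma_h \<epsilon> zv tv \<T>" using sol(2) by (simp add: discrete_dual_solution_def)
    have sm: "smooth (\<lambda>x. \<tau> S x $ i)" if "S \<in> \<T>" for S i
      by (rule smooth_local_space[OF mesh_simplex[OF assms(3) mesh that] PiE_mem[OF \<tau>[unfolded Sigma_h_def] that]])
    define a where "a F = (LINT y:(F - frontier \<Omega>)|facet_measure T F. (normal_jump \<T> \<tau> F y)\<^sup>2)" for F
    have a0: "0 \<le> a F" for F
      unfolding a_def set_lebesgue_integral_def by (rule Bochner_Integration.integral_nonneg) simp
    have a: "sqrt m * sqrt (a F) \<le> M * E" if F: "F \<in> facets T" for F
    proof (cases "F \<subseteq> frontier \<Omega>")
      case True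
      then have "F - frontier \<Omega> = {}" by blast
      then have "a F = 0" unfolding a_def by (simp only:) (simp add: set_lebesgue_integral_def)
      then show ?thesis using M E by simp
    next
      case False
      \<comment> \<open>A facet that is not contained in the frontier may still touch it. Removing
        the contact set only lowers the integral, so the bound on the full facet is enough.\<close>
      have "continuous_on UNIV (\<lambda>y. (normal_jump \<T> \<tau> F y)\<^sup>2)"
        unfolding normal_jump_def by (intro continuous_intros continuous_on_smooth_vec sm) simp
      from facet_integral_minus_le[OF s F this _ frontier_closed]
      have "a F \<le> (LINT y:F|facet_measure T F. (normal_jump \<T> \<tau> F y)\<^sup>2)"
        unfolding a_def by simp
      then have "sqrt m * sqrt (a F) \<le> sqrt m * sqrt (LINT y:F|facet_measure T F. (normal_jump \<T> \<tau> F y)\<^sup>2)"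
        using \<epsilon> diameter_ge_0[OF compact_imp_bounded[OF compact_simplex[OF s]]]
        by (intro mult_left_mono) (auto simp: m_def)
      also have "\<dots> \<le> M * E"
        unfolding m_def M_def E_def
        by (rule facet_jump_bound[OF n assms(3,2) mesh shape \<epsilon> \<sigma> \<tau> T F False less_imp_le[OF C]
            C'[unfolded \<beta>_def] K_def c0_def[unfolded \<beta>_def]])
      finally show ?thesis .
    qed
    note V = simplex_vertices[OF s]
    have "facets T = (\<lambda>z. convex hull (vertices T - {z})) ` vertices T"
      using facets_iff[OF s] by blast
    then have card: "finite (facets T)" "card (facets T) \<le> CARD('n) + 1"
      using V(2,3) card_image_le[OF V(3), of "\<lambda>z. convex hull (vertices T - {z})"] by simp_all
    have "jump_norm \<Omega> \<T> \<tau> T = sqrt (\<Sum>F\<in>facets T. a F)" by (simp add: jump_norm_def a_def)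
    also have "\<dots> = L2_set (\<lambda>F. sqrt (a F)) (facets T)" by (simp add: L2_set_def a0)
    also have "\<dots> \<le> (\<Sum>F\<in>facets T. sqrt (a F))" by (rule L2_set_le_sum) (simp add: a0)
    finally have "sqrt m * jump_norm \<Omega> \<T> \<tau> T \<le> sqrt m * (\<Sum>F\<in>facets T. sqrt (a F))"
      using \<epsilon> diameter_ge_0[OF compact_imp_bounded[OF compact_simplex[OF s]]]
      by (intro mult_left_mono) (auto simp: m_def)
    also have "\<dots> = (\<Sum>F\<in>facets T. sqrt m * sqrt (a F))" by (rule sum_distrib_left)
    also have "\<dots> \<le> real (card (facets T)) * (M * E)" by (rule sum_bounded_above) (rule a)
    also have "\<dots> \<le> real (CARD('n) + 1) * (M * E)"
      using card(2) M E by (intro mult_right_mono) auto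
    also have "\<dots> \<le> ?C * E" using E by (simp add: algebra_simps)
    also have "sqrt m = min (sqrt \<epsilon>) (sqrt (diameter T))" by (simp add: m_def min_def)
    finally show ?thesis unfolding E_def .
  qed
  moreover have "0 < ?C" using M by (simp add: add_nonneg_pos)
  ultimately show ?thesis by (intro exI[of _ ?C]) blast
qed

end
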